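(* If $s>1$, $t>0$ and $u\in\mathscr E_s'(\mathbf R^d)+\Sigma_t^s(\mathbf R^d)$ then $$\mathrm{WF}^{t,s}(u)\subseteq\{0\}\times\pi_2\mathrm{WF}_s(u).$$
   Context: Notation: $\mathbf N=\{0,1,2,\dots\}$, $D^\beta=(-i)^{|\beta|}\partial^\beta$, $\pi_2(x,\xi)=\xi$ for $(x,\xi)\in T^*\mathbf R^d\simeq\mathbf R^{2d}$. For $s,t>0$ with $s+t>1$, the (Beurling type) Gelfand--Shilov space $\Sigma_t^s(\mathbf R^d)$ consists of all $f\in C^\infty(\mathbf R^d)$ such that for every $h>0$ $$\|f\|_{\mathcal S_{t,h}^s}=\sup_{\alpha,\beta\in\mathbf N^d,\,x\in\mathbf R^d}\frac{|x^\alpha D^\beta f(x)|}{h^{|\alpha+\beta|}\alpha!^t\beta!^s}<\infty,$$ with the Fréchet topology given by these seminorms. $(\Sigma_t^s)'(\mathbf R^d)$ is its topological dual; the action $(u,\varphi)$ is conjugate linear in $\varphi$ and consistent with the $L^2$ inner product. Short-time Fourier transform: with $T_xf(y)=f(y-x)$, $M_\xi f(y)=e^{i\langle y,\xi\rangle}f(y)$, set $V_\psi u(x,\xi)=(2\pi)^{-d/2}(u,M_\xi T_x\psi)$. Wave front set $\mathrm{WF}^{t,s}$: for $u\in(\Sigma_t^s)'(\mathbf R^d)$ and a fixed $\psi\in\Sigma_t^s(\mathbf R^d)\setminus\{0\}$, $(x_0,\xi_0)\in T^*\mathbf R^d\setminus0$ satisfies $(x_0,\xi_0)\notin\mathrm{WF}^{t,s}(u)$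 if there is an open set $U\subseteq T^*\mathbf R^d\setminus0$ containing $(x_0,\xi_0)$ such that $$\sup_{\lambda>0,\,(x,\xi)\in U}e^{r\lambda}|V_\psi u(\lambda^tx,\lambda^s\xi)|<\infty\quad\forall r>0.$$ The definition does not depend on the choice of $\psi$. Gevrey notions ($s>1$, Beurling type): $G^s(\mathbf R^d)$ is the set of $f\in C^\infty(\mathbf R^d)$ such that for each compact $K\subseteq\mathbf R^d$ and each $h>0$ there is $C_{K,h}>0$ with $|\partial^\alpha f(x)|\leq C_{K,h}h^{|\alpha|}\alpha!^s$ for $x\in K$, $\alpha\in\mathbf N^d$. $G_c^s(\mathbf R^d)$ is the subspace of compactly supported functions, $\mathscr D_s'(\mathbf R^d)$ its topological dual (Gevrey ultradistributions), and $\mathscr E_s'(\mathbf R^d)$ the subspace of $\mathscr D_s'(\mathbf R^d)$ of ultradistributions of compact support. One has $\mathscr E_s'(\mathbf R^d)\subseteq(\Sigma_t^s)'(\mathbf R^d)\subseteq\mathscr D_s'(\mathbf R^d)$ for $s>1$, $t>0$. Gevrey wave front set: for $u\in\mathscr D_s'(\mathbf R^d)$, a point $(x_0,\xi_0)\in\mathbf R^d\times(\mathbf R^d\setminus0)$ satisfies $(x_0,\xi_0)\notin\mathrm{WF}_s(u)$ if there exist $\varphi\in G_c^s(\mathbf R^d)$ with $\varphi(x_0)=1$ and an open conical neighborhood $\Gamma\subseteq\mathbf R^d\setminus0$ of $\xi_0$ such that $\sup_{\xi\in\Gamma}e^{r|\xi|^{1/s}}|\widehat{u\varphi}(\xi)|<\infty$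 for all $r>0$, where $\widehat f(\xi)=(2\pi)^{-d/2}\int f(x)e^{-i\langle x,\xi\rangle}dx$. *)

theory Defs
  imports "HOL-Analysis.Analysis"
begin

section \<open>Multi-indices and smooth functions\<close>

text \<open>Multi-indices on \<open>R^d\<close> are vectors of type \<open>nat ^ 'n\<close>, where \<open>d = CARD('n)\<close>.\<close>

definition mi_order :: "nat ^ 'n::finite \<Rightarrow> nat" where
  "mi_order \<alpha> = (\<Sum>i\<in>UNIV. \<alpha> $ i)"

definition mi_fact :: "nat ^ 'n::finite \<Rightarrow> real" where
  "mi_fact \<alpha> = (\<Prod>i\<in>UNIV. fact (\<alpha> $ i))"

definition mi_monom :: "real ^ 'n::finite \<Rightarrow> nat ^ 'n \<Rightarrow> real" where
  "mi_monom x \<alpha> = (\<Prod>i\<in>UNIV. (x $ i) ^ (\<alpha> $ i))"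

definition partial_d :: "'n \<Rightarrow> (real ^ 'n::finite \<Rightarrow> complex) \<Rightarrow> real ^ 'n \<Rightarrow> complex" where
  "partial_d i f = (\<lambda>x. frechet_derivative f (at x) (axis i 1))"

fun iter_partial :: "'n list \<Rightarrow> (real ^ 'n::finite \<Rightarrow> complex) \<Rightarrow> real ^ 'n \<Rightarrow> complex" where
  "iter_partial [] f = f"
| "iter_partial (i # js) f = partial_d i (iter_partial js f)"

definition smooth_fun :: "(real ^ 'n::finite \<Rightarrow> complex) \<Rightarrow> bool" where
  "smooth_fun f \<longleftrightarrow> (\<forall>js x. iter_partial js f differentiable (at x))"

text \<open>\<open>'n\<close> carries no order, so an arbitrary order of differentiation is chosen; for smooth
  functions, the only ones to which \<open>mi_deriv\<close> is applied, the order is irrelevant.\<close>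

definition mi_deriv :: "nat ^ 'n::finite \<Rightarrow> (real ^ 'n \<Rightarrow> complex) \<Rightarrow> real ^ 'n \<Rightarrow> complex" where
  "mi_deriv \<alpha> f = iter_partial (SOME js. \<forall>i. count_list js i = \<alpha> $ i) f"

lemma mi_deriv_list_exists: "\<exists>js. \<forall>i. count_list js i = (\<alpha> :: nat ^ 'n::finite) $ i"
proof -
  obtain js where "mset js = (\<Sum>i\<in>UNIV. replicate_mset (\<alpha> $ i) i)"
    using ex_mset by blast
  moreover have "count (\<Sum>i\<in>UNIV. replicate_mset (\<alpha> $ i) i) k = \<alpha> $ k" for k
    by (simp add: count_sum)
  ultimately show ?thesis
    by (metis count_mset)
qed

definition mi_D :: "nat ^ 'n::finite \<Rightarrow> (real ^ 'n \<Rightarrow> complex) \<Rightarrow> real ^ 'n \<Rightarrow> complex" where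
  "mi_D \<beta> f = (\<lambda>x. (- \<i>) ^ mi_order \<beta> * mi_deriv \<beta> f x)"

section \<open>Topologies given by seminorms, and antilinear functionals\<close>

text \<open>\<open>V\<close> is a vector space of functions and \<open>p h\<close>, for \<open>h \<in> I\<close>, are seminorms that are
  finite on \<open>V\<close>.  Functionals are total HOL functions of which only the values on \<open>V\<close> matter.\<close>

definition seminorm_topology ::
  "('a \<Rightarrow> complex) set \<Rightarrow> ('i \<Rightarrow> ('a \<Rightarrow> complex) \<Rightarrow> ennreal) \<Rightarrow> 'i set \<Rightarrow> ('a \<Rightarrow> complex) topology"
where
  "seminorm_topology V p I = topology_generated_by
     {{g \<in> V. p h (\<lambda>x. g x - f x) < e} | f h e. f \<in> V \<and> h \<in> I \<and> 0 < e}"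

definition antilinear_on :: "('a \<Rightarrow> complex) set \<Rightarrow> (('a \<Rightarrow> complex) \<Rightarrow> complex) \<Rightarrow> bool" where
  "antilinear_on V u \<longleftrightarrow>
     (\<forall>f\<in>V. \<forall>g\<in>V. \<forall>a b. u (\<lambda>x. a * f x + b * g x) = cnj a * u f + cnj b * u g)"

definition L2_pairing :: "(real ^ 'n::finite \<Rightarrow> complex) \<Rightarrow> (real ^ 'n \<Rightarrow> complex) \<Rightarrow> complex" where
  "L2_pairing f \<phi> = (\<integral>x. f x * cnj (\<phi> x) \<partial>lborel)"

section \<open>Gelfand--Shilov spaces of Beurling type\<close>

definition GS_seminorm ::
  "real \<Rightarrow> real \<Rightarrow> real \<Rightarrow> (real ^ 'n::finite \<Rightarrow> complex) \<Rightarrow> ennreal" where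
  "GS_seminorm t s h f =
     (SUP \<alpha>. SUP \<beta>. SUP x. ennreal (cmod (mi_monom x \<alpha> * mi_D \<beta> f x) /
        (h ^ mi_order (\<alpha> + \<beta>) * mi_fact \<alpha> powr t * mi_fact \<beta> powr s)))"

definition GS_space :: "real \<Rightarrow> real \<Rightarrow> (real ^ 'n::finite \<Rightarrow> complex) set" where
  "GS_space t s = {f. smooth_fun f \<and> (\<forall>h>0. GS_seminorm t s h f < \<infinity>)}"

definition GS_topology :: "real \<Rightarrow> real \<Rightarrow> (real ^ 'n::finite \<Rightarrow> complex) topology" where
  "GS_topology t s = seminorm_topology (GS_space t s) (GS_seminorm t s) {0<..}"

definition GS_dual :: "real \<Rightarrow> real \<Rightarrow> ((real ^ 'n::finite \<Rightarrow> complex) \<Rightarrow> complex) set" where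
  "GS_dual t s =
     {u. antilinear_on (GS_space t s) u \<and> continuous_map (GS_topology t s) euclidean u}"

section \<open>Gevrey functions and ultradistributions of Beurling type\<close>

definition fun_supp :: "(real ^ 'n::finite \<Rightarrow> complex) \<Rightarrow> (real ^ 'n) set" where
  "fun_supp f = closure {x. f x \<noteq> 0}"

definition Gevrey :: "real \<Rightarrow> (real ^ 'n::finite \<Rightarrow> complex) set" where
  "Gevrey s = {f. smooth_fun f \<and>
     (\<forall>K h. compact K \<and> h > 0 \<longrightarrow>
        (\<exists>C>0. \<forall>x\<in>K. \<forall>\<alpha>. cmod (mi_deriv \<alpha> f x) \<le> C * h ^ mi_order \<alpha> * mi_fact \<alpha> powr s))}"

definition Gevrey_c :: "real \<Rightarrow> (real ^ 'n::finite \<Rightarrow> complex) set" where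
  "Gevrey_c s = {f \<in> Gevrey s. compact (fun_supp f)}"

definition Gevrey_K :: "real \<Rightarrow> (real ^ 'n::finite) set \<Rightarrow> (real ^ 'n \<Rightarrow> complex) set" where
  "Gevrey_K s K = {f \<in> Gevrey s. fun_supp f \<subseteq> K}"

definition Gevrey_seminorm ::
  "real \<Rightarrow> (real ^ 'n::finite) set \<Rightarrow> real \<Rightarrow> (real ^ 'n \<Rightarrow> complex) \<Rightarrow> ennreal" where
  "Gevrey_seminorm s K h f =
     (SUP x\<in>K. SUP \<alpha>. ennreal (cmod (mi_deriv \<alpha> f x) / (h ^ mi_order \<alpha> * mi_fact \<alpha> powr s)))"

definition Gevrey_K_topology ::
  "real \<Rightarrow> (real ^ 'n::finite) set \<Rightarrow> (real ^ 'n \<Rightarrow> complex) topology" where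
  "Gevrey_K_topology s K = seminorm_topology (Gevrey_K s K) (Gevrey_seminorm s K) {0<..}"

text \<open>The locally convex inductive limit of the Frechet spaces \<open>Gevrey_K s K\<close>, \<open>K\<close> compact: its
  convex open sets are exactly the convex sets whose trace on each step is open, and these form a
  base.\<close>

definition Gevrey_c_topology :: "real \<Rightarrow> (real ^ 'n::finite \<Rightarrow> complex) topology" where
  "Gevrey_c_topology s = topology_generated_by
     {U. U \<subseteq> Gevrey_c s \<and>
         (\<forall>f\<in>U. \<forall>g\<in>U. \<forall>c::real. 0 \<le> c \<and> c \<le> 1 \<longrightarrow> (\<lambda>x. (1 - c) * f x + c * g x) \<in> U) \<and>
         (\<forall>K. compact K \<longrightarrow> openin (Gevrey_K_topology s K) (U \<inter> Gevrey_K s K))}"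

definition ultradistributions :: "real \<Rightarrow> ((real ^ 'n::finite \<Rightarrow> complex) \<Rightarrow> complex) set" where
  "ultradistributions s =
     {u. antilinear_on (Gevrey_c s) u \<and> continuous_map (Gevrey_c_topology s) euclidean u}"

definition ultra_supp ::
  "real \<Rightarrow> ((real ^ 'n::finite \<Rightarrow> complex) \<Rightarrow> complex) \<Rightarrow> (real ^ 'n) set" where
  "ultra_supp s u = - \<Union>{\<Omega>. open \<Omega> \<and> (\<forall>\<phi>\<in>Gevrey_c s. fun_supp \<phi> \<subseteq> \<Omega> \<longrightarrow> u \<phi> = 0)}"

definition compact_ultradistributions ::
  "real \<Rightarrow> ((real ^ 'n::finite \<Rightarrow> complex) \<Rightarrow> complex) set" where
  "compact_ultradistributions s = {u \<in> ultradistributions s. compact (ultra_supp s u)}"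

text \<open>The subset of the Gelfand--Shilov dual that consists of the sums of a compactly supported
  ultradistribution and a Gelfand--Shilov function.  The Gelfand--Shilov dual is included in the
  ultradistributions by restricting functionals to \<open>Gevrey_c s\<close>, and functions act by the
  \<open>L2\<close> pairing; hence the identity \<open>u = v + f\<close> is tested on \<open>Gevrey_c s\<close>.  Since \<open>Gevrey_c s\<close> is
  dense in \<open>GS_space t s\<close> when \<open>s > 1\<close>, this determines \<open>u\<close> on \<open>GS_space t s\<close>.\<close>

definition compact_plus_GS ::
  "real \<Rightarrow> real \<Rightarrow> ((real ^ 'n::finite \<Rightarrow> complex) \<Rightarrow> complex) set" where
  "compact_plus_GS t s =
     {u \<in> GS_dual t s. \<exists>v\<in>compact_ultradistributions s. \<exists>f\<in>GS_space t s.
        \<forall>\<phi>\<in>Gevrey_c s. u \<phi> = v \<phi> + L2_pairing f \<phi>}"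

section \<open>Wave front sets\<close>

definition translate_fun ::
  "real ^ 'n::finite \<Rightarrow> (real ^ 'n \<Rightarrow> complex) \<Rightarrow> real ^ 'n \<Rightarrow> complex" where
  "translate_fun x f = (\<lambda>y. f (y - x))"

definition modulate_fun ::
  "real ^ 'n::finite \<Rightarrow> (real ^ 'n \<Rightarrow> complex) \<Rightarrow> real ^ 'n \<Rightarrow> complex" where
  "modulate_fun \<xi> f = (\<lambda>y. exp (\<i> * of_real (y \<bullet> \<xi>)) * f y)"

definition STFT ::
  "(real ^ 'n::finite \<Rightarrow> complex) \<Rightarrow> ((real ^ 'n \<Rightarrow> complex) \<Rightarrow> complex) \<Rightarrow>
   real ^ 'n \<Rightarrow> real ^ 'n \<Rightarrow> complex" where
  "STFT \<psi> u x \<xi> = of_real ((2 * pi) powr (- real CARD('n) / 2)) *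
     u (modulate_fun \<xi> (translate_fun x \<psi>))"

text \<open>The cotangent bundle minus \<open>0\<close> is \<open>R^(2d)\<close> minus the origin, not minus the zero section.
  \<open>\<psi>\<close> is the fixed window function.\<close>

definition WF_GS ::
  "real \<Rightarrow> real \<Rightarrow> (real ^ 'n::finite \<Rightarrow> complex) \<Rightarrow> ((real ^ 'n \<Rightarrow> complex) \<Rightarrow> complex) \<Rightarrow>
   ((real ^ 'n) \<times> (real ^ 'n)) set" where
  "WF_GS t s \<psi> u = {z. z \<noteq> (0, 0) \<and>
     \<not> (\<exists>U. open U \<and> U \<subseteq> - {(0, 0)} \<and> z \<in> U \<and>
          (\<forall>r>0. bdd_above {exp (r * \<tau>) * cmod (STFT \<psi> u (\<tau> powr t *\<^sub>R x) (\<tau> powr s *\<^sub>R \<xi>))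
                            | \<tau> x \<xi>. \<tau> > 0 \<and> (x, \<xi>) \<in> U}))}"

text \<open>The Fourier transform of \<open>u \<phi>\<close>.  As \<open>(u \<phi>, g) = (u, cnj \<phi> g)\<close> in the antilinear pairing, and
  \<open>u \<phi>\<close> has compact support, its value at \<open>\<xi>\<close> is \<open>(2 pi)^(-d/2)\<close> times the pairing of \<open>u\<close> with
  \<open>cnj \<phi> exp (i x \<xi>)\<close>; for locally integrable \<open>u\<close> this is the Fourier integral of \<open>u \<phi>\<close>.\<close>

definition localized_fourier ::
  "((real ^ 'n::finite \<Rightarrow> complex) \<Rightarrow> complex) \<Rightarrow> (real ^ 'n \<Rightarrow> complex) \<Rightarrow> real ^ 'n \<Rightarrow> complex" where
  "localized_fourier u \<phi> \<xi> = of_real ((2 * pi) powr (- real CARD('n) / 2)) *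
     u (\<lambda>x. cnj (\<phi> x) * exp (\<i> * of_real (x \<bullet> \<xi>)))"

text \<open>The library's \<open>conic\<close> requires the origin to be included, hence the explicit condition.\<close>

definition WF_Gevrey ::
  "real \<Rightarrow> ((real ^ 'n::finite \<Rightarrow> complex) \<Rightarrow> complex) \<Rightarrow> ((real ^ 'n) \<times> (real ^ 'n)) set" where
  "WF_Gevrey s u = {(x\<^sub>0, \<xi>\<^sub>0). \<xi>\<^sub>0 \<noteq> 0 \<and>
     \<not> (\<exists>\<phi>\<in>Gevrey_c s. \<phi> x\<^sub>0 = 1 \<and>
          (\<exists>\<Gamma>. open \<Gamma> \<and> \<Gamma> \<subseteq> - {0} \<and> \<xi>\<^sub>0 \<in> \<Gamma> \<and> (\<forall>\<xi>\<in>\<Gamma>. \<forall>c>0. c *\<^sub>R \<xi> \<in> \<Gamma>) \<and>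
             (\<forall>r>0. bdd_above
                ((\<lambda>\<xi>. exp (r * norm \<xi> powr (1 / s)) * cmod (localized_fourier u \<phi> \<xi>)) ` \<Gamma>))))}"

end

theory Submission
  imports Defs "HOL-Complex_Analysis.Cauchy_Integral_Formula" "HOL-Probability.Sinc_Integral"
begin

text \<open>Write \<open>u = v + f\<close> with \<open>v\<close> compactly supported and \<open>f\<close> in the Gelfand--Shilov space, and let
  \<open>\<kappa>\<close> be a compactly supported Gevrey function equal to 1 near the support of \<open>v\<close>.  By density,
  \<open>(u, g) = (u, \<kappa> g) + (f, (1 - \<kappa>) g)\<close> for every \<open>g\<close>, in particular for \<open>g = M\<^sub>\<xi> T\<^sub>x \<psi>\<close>.

  On the support of \<open>\<kappa>\<close> the translate \<open>T\<^sub>x \<psi>\<close> and its derivatives are of size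
  \<open>exp (- \<rho> \<bar>x\<bar> powr (1/t))\<close> for every \<open>\<rho>\<close>, which beats the growth \<open>exp (q \<bar>\<xi>\<bar> powr (1/s))\<close> due to the
  modulation; hence no point \<open>(x0, \<xi>0)\<close> with \<open>x0 \<noteq> 0\<close> belongs to the wave front set.

  If no \<open>(y, \<xi>0)\<close> lies in the Gevrey wave front set, finitely many cutoffs \<open>\<phi>\<close> with decaying
  localized Fourier transform around \<open>\<xi>0\<close> cover the support of \<open>\<kappa>\<close>, and
  \<open>\<kappa> T\<^sub>x \<psi> = (\<Sum>\<phi>. b\<^sub>\<phi> cnj \<phi>)\<close> with \<open>b\<^sub>\<phi>\<close> bounded in the Gevrey class uniformly in \<open>x\<close>.  Multiplication
  by \<open>b\<^sub>\<phi>\<close> preserves the decay in a smaller cone, as its Fourier series shows.\<close>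

subsection \<open>Iterated partial derivatives\<close>

lemma has_derivative_imp_partial_d:
  assumes "(f has_derivative f') (at x)"
  shows "partial_d i f x = f' (axis i 1)"
  using frechet_derivative_at[OF assms] by (simp add: partial_d_def)

lemma iter_partial_append: "iter_partial (js @ ks) f = iter_partial js (iter_partial ks f)"
  by (induction js) auto

lemma iter_partial_snoc: "iter_partial (js @ [i]) f = iter_partial js (partial_d i f)"
  by (simp add: iter_partial_append)

fun smooth_upto :: "nat \<Rightarrow> (real ^ 'n::finite \<Rightarrow> complex) \<Rightarrow> bool" where
  "smooth_upto 0 f \<longleftrightarrow> (\<forall>x. f differentiable (at x))"
| "smooth_upto (Suc n) f \<longleftrightarrow> (\<forall>x. f differentiable (at x)) \<and> (\<forall>i. smooth_upto n (partial_d i f))"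

lemma smooth_upto_iff:
  "smooth_upto n f \<longleftrightarrow> (\<forall>js x. length js \<le> n \<longrightarrow> iter_partial js f differentiable (at x))"
proof (induction n arbitrary: f)
  case (Suc n)
  show ?case
  proof
    assume L: "smooth_upto (Suc n) f"
    show "\<forall>js x. length js \<le> Suc n \<longrightarrow> iter_partial js f differentiable at x"
    proof (intro allI impI)
      fix js :: "'a list" and x assume "length js \<le> Suc n"
      then show "iter_partial js f differentiable at x"
        using L Suc.IH by (cases js rule: rev_cases) (auto simp: iter_partial_snoc)
    qed
  next
    assume R: "\<forall>js x. length js \<le> Suc n \<longrightarrow> iter_partial js f differentiable at x"
    have "smooth_upto n (partial_d i f)" for i
      unfolding Suc.IH
    proof (intro allI impI)
      fix js :: "'a list" and x assume "length js \<le> n"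
      then show "iter_partial js (partial_d i f) differentiable at x"
        using R[rule_format, of "js @ [i]" x] by (simp add: iter_partial_snoc)
    qed
    moreover have "f differentiable at x" for x
      using R[rule_format, of "[]" x] by simp
    ultimately show "smooth_upto (Suc n) f" by simp
  qed
qed auto

lemma smooth_fun_iff: "smooth_fun f \<longleftrightarrow> (\<forall>n. smooth_upto n f)"
  unfolding smooth_fun_def smooth_upto_iff by blast

lemma smooth_upto_Suc_D: "smooth_upto (Suc n) f \<Longrightarrow> smooth_upto n f"
  unfolding smooth_upto_iff by auto

lemma smooth_upto_differentiable: "smooth_upto n f \<Longrightarrow> f differentiable (at x)"
  by (cases n) auto

lemma smooth_fun_differentiable: "smooth_fun f \<Longrightarrow> f differentiable (at x)"
  using smooth_upto_differentiable smooth_fun_iff by blast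

lemma smooth_fun_partial: "smooth_fun f \<Longrightarrow> smooth_fun (partial_d i f)"
  using smooth_fun_iff smooth_upto.simps(2) by blast

lemma smooth_fun_iter: "smooth_fun f \<Longrightarrow> smooth_fun (iter_partial js f)"
  by (induction js) (auto intro: smooth_fun_partial)

lemma smooth_fun_continuous: "smooth_fun f \<Longrightarrow> continuous_on A f"
  by (intro continuous_at_imp_continuous_on ballI differentiable_imp_continuous_within
      smooth_fun_differentiable)

lemma differentiable_has_derivative:
  "f differentiable (at x) \<Longrightarrow> (f has_derivative frechet_derivative f (at x)) (at x)"
  using frechet_derivative_works by blast

lemma partial_d_lincomb:
  assumes "\<And>x. f differentiable (at x)" "\<And>x. g differentiable (at x)"
  shows "partial_d i (\<lambda>x. a * f x + b * g x) = (\<lambda>x. a * partial_d i f x + b * partial_d i g x)"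
proof
  fix x
  have "((\<lambda>x. a * f x + b * g x) has_derivative
     (\<lambda>v. a * frechet_derivative f (at x) v + b * frechet_derivative g (at x) v)) (at x)"
    by (intro has_derivative_add has_derivative_mult_right differentiable_has_derivative assms)
  from has_derivative_imp_partial_d[OF this]
  show "partial_d i (\<lambda>x. a * f x + b * g x) x = a * partial_d i f x + b * partial_d i g x"
    by (simp add: partial_d_def)
qed

lemma partial_d_mult:
  assumes "\<And>x. f differentiable (at x)" "\<And>x. g differentiable (at x)"
  shows "partial_d i (\<lambda>x. f x * g x) = (\<lambda>x. partial_d i f x * g x + f x * partial_d i g x)"
proof
  fix x
  have "((\<lambda>x. f x * g x) has_derivative
     (\<lambda>v. f x * frechet_derivative g (at x) v + frechet_derivative f (at x) v * g x)) (at x)"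
    by (intro has_derivative_mult differentiable_has_derivative assms)
  from has_derivative_imp_partial_d[OF this]
  show "partial_d i (\<lambda>x. f x * g x) x = partial_d i f x * g x + f x * partial_d i g x"
    by (simp add: partial_d_def)
qed

lemma partial_d_cnj:
  assumes "\<And>x. f differentiable (at x)"
  shows "partial_d i (\<lambda>x. cnj (f x)) = (\<lambda>x. cnj (partial_d i f x))"
proof
  fix x
  have "((\<lambda>x. cnj (f x)) has_derivative (\<lambda>v. cnj (frechet_derivative f (at x) v))) (at x)"
    by (intro bounded_linear.has_derivative[OF bounded_linear_cnj] differentiable_has_derivative assms)
  from has_derivative_imp_partial_d[OF this]
  show "partial_d i (\<lambda>x. cnj (f x)) x = cnj (partial_d i f x)"
    by (simp add: partial_d_def)
qed

lemma differentiable_inverse_complex: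
  fixes f :: "real ^ 'n::finite \<Rightarrow> complex"
  assumes "f differentiable (at x)" "f x \<noteq> 0"
  shows "(\<lambda>x. inverse (f x)) differentiable (at x)"
  using Deriv.has_derivative_inverse[OF assms(2) differentiable_has_derivative[OF assms(1)]]
  unfolding differentiable_def by blast

lemma partial_d_inverse:
  assumes "\<And>x. f differentiable (at x)" "\<And>x. f x \<noteq> 0"
  shows "partial_d i (\<lambda>x. inverse (f x)) =
    (\<lambda>x. (-1) * (partial_d i f x * (inverse (f x) * inverse (f x))))"
proof
  fix x
  from has_derivative_imp_partial_d[OF Deriv.has_derivative_inverse[OF assms(2) differentiable_has_derivative[OF assms(1)]]]
  show "partial_d i (\<lambda>x. inverse (f x)) x = (-1) * (partial_d i f x * (inverse (f x) * inverse (f x)))"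
    by (simp add: partial_d_def)
qed

lemma partial_d_affine:
  assumes "\<And>x. f differentiable (at x)"
  shows "partial_d i (\<lambda>x. f (c *\<^sub>R x + a)) = (\<lambda>x. of_real c * partial_d i f (c *\<^sub>R x + a))"
proof
  fix x
  have "((\<lambda>x. f (c *\<^sub>R x + a)) has_derivative (\<lambda>v. frechet_derivative f (at (c *\<^sub>R x + a)) (c *\<^sub>R v))) (at x)"
    by (rule has_derivative_compose[where g = f and f = "\<lambda>x. c *\<^sub>R x + a"])
       (auto intro!: derivative_eq_intros differentiable_has_derivative assms)
  from has_derivative_imp_partial_d[OF this]
  show "partial_d i (\<lambda>x. f (c *\<^sub>R x + a)) x = of_real c * partial_d i f (c *\<^sub>R x + a)"
    using linear_scale[OF linear_frechet_derivative[OF assms]]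
    by (simp add: partial_d_def scaleR_conv_of_real)
qed

lemma partial_d_const: "partial_d i (\<lambda>x. c) = (\<lambda>x. 0)"
  by (rule ext) (simp add: has_derivative_imp_partial_d[OF has_derivative_const])

lemma smooth_upto_const: "smooth_upto n (\<lambda>x. c)"
  by (induction n arbitrary: c) (auto simp: partial_d_const)

lemma smooth_upto_lincomb:
  "smooth_upto n f \<Longrightarrow> smooth_upto n g \<Longrightarrow> smooth_upto n (\<lambda>x. a * f x + b * g x)"
proof (induction n arbitrary: f g)
  case (Suc n)
  then show ?case
    by (auto simp: partial_d_lincomb)
qed auto

lemma smooth_upto_mult:
  "smooth_upto n f \<Longrightarrow> smooth_upto n g \<Longrightarrow> smooth_upto n (\<lambda>x. f x * g x)"
proof (induction n arbitrary: f g)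
  case (Suc n)
  have "smooth_upto n (\<lambda>x. 1 * (partial_d i f x * g x) + 1 * (f x * partial_d i g x))" for i
    using Suc.prems smooth_upto_Suc_D[OF Suc.prems(1)] smooth_upto_Suc_D[OF Suc.prems(2)]
    by (intro smooth_upto_lincomb Suc.IH) auto
  with Suc.prems show ?case
    by (auto simp: partial_d_mult)
qed auto

lemma smooth_upto_cnj:
  fixes f :: "real ^ 'n::finite \<Rightarrow> complex"
  assumes "smooth_upto n f" shows "smooth_upto n (\<lambda>x. cnj (f x))"
proof -
  have d: "(\<lambda>x. cnj (f x)) differentiable (at x)"
    if "f differentiable (at x)" for f :: "real ^ 'n \<Rightarrow> complex" and x
    using bounded_linear.has_derivative[OF bounded_linear_cnj differentiable_has_derivative[OF that]]
    unfolding differentiable_def by blast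
  show ?thesis using assms
    by (induction n arbitrary: f) (auto simp: partial_d_cnj intro: d)
qed

lemma smooth_upto_inverse:
  fixes f :: "real ^ 'n::finite \<Rightarrow> complex"
  assumes "smooth_upto n f" "\<And>x. f x \<noteq> 0"
  shows "smooth_upto n (\<lambda>x. inverse (f x))"
  using assms(1)
proof (induction n)
  case 0
  then show ?case using assms(2) by (simp add: differentiable_inverse_complex)
next
  case (Suc n)
  have "smooth_upto n (\<lambda>x. (-1) * (partial_d i f x * (inverse (f x) * inverse (f x))))" for i
    using Suc.prems smooth_upto_Suc_D[OF Suc.prems(1)]
    by (intro smooth_upto_mult smooth_upto_const Suc.IH) auto
  with Suc.prems show ?case
    using assms(2) by (simp add: partial_d_inverse differentiable_inverse_complex)
qed

lemma smooth_upto_affine: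
  fixes f :: "real ^ 'n::finite \<Rightarrow> complex"
  assumes "smooth_upto n f" shows "smooth_upto n (\<lambda>x. f (c *\<^sub>R x + a))"
proof -
  have d: "(\<lambda>x. f (c *\<^sub>R x + a)) differentiable (at x)"
    if "\<And>x. f differentiable (at x)" for f :: "real ^ 'n \<Rightarrow> complex" and x
  proof -
    have "((\<lambda>x. f (c *\<^sub>R x + a)) has_derivative (\<lambda>v. frechet_derivative f (at (c *\<^sub>R x + a)) (c *\<^sub>R v))) (at x)"
      by (rule has_derivative_compose[where g = f and f = "\<lambda>x. c *\<^sub>R x + a"])
         (auto intro!: derivative_eq_intros differentiable_has_derivative that)
    then show ?thesis unfolding differentiable_def by blast
  qed
  show ?thesis using assms
  proof (induction n arbitrary: f)
    case (Suc n)
    have "smooth_upto n (\<lambda>x. of_real c * partial_d i f (c *\<^sub>R x + a))" for i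
      using Suc by (intro smooth_upto_mult[where f = "\<lambda>x. of_real c"] smooth_upto_const Suc.IH) auto
    with Suc.prems show ?case by (auto simp: partial_d_affine d)
  qed (auto simp: d)
qed

lemma smooth_const [simp]: "smooth_fun (\<lambda>x. c)"
  by (simp add: smooth_fun_iff smooth_upto_const)

lemma smooth_lincomb: "smooth_fun f \<Longrightarrow> smooth_fun g \<Longrightarrow> smooth_fun (\<lambda>x. a * f x + b * g x)"
  by (simp add: smooth_fun_iff smooth_upto_lincomb)

lemma smooth_mult: "smooth_fun f \<Longrightarrow> smooth_fun g \<Longrightarrow> smooth_fun (\<lambda>x. f x * g x)"
  by (simp add: smooth_fun_iff smooth_upto_mult)

lemma smooth_cnj: "smooth_fun f \<Longrightarrow> smooth_fun (\<lambda>x. cnj (f x))"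
  by (simp add: smooth_fun_iff smooth_upto_cnj)

lemma smooth_inverse: "smooth_fun f \<Longrightarrow> (\<And>x. f x \<noteq> 0) \<Longrightarrow> smooth_fun (\<lambda>x. inverse (f x))"
  by (simp add: smooth_fun_iff smooth_upto_inverse)

lemma smooth_affine: "smooth_fun f \<Longrightarrow> smooth_fun (\<lambda>x. f (c *\<^sub>R x + a))"
  by (simp add: smooth_fun_iff smooth_upto_affine)

lemma iter_partial_lincomb:
  assumes "smooth_fun f" "smooth_fun g"
  shows "iter_partial js (\<lambda>x. a * f x + b * g x) =
    (\<lambda>x. a * iter_partial js f x + b * iter_partial js g x)"
  using assms
  by (induction js) (auto simp: partial_d_lincomb smooth_fun_differentiable smooth_fun_iter)

lemma iter_partial_cnj:
  assumes "smooth_fun f"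
  shows "iter_partial js (\<lambda>x. cnj (f x)) = (\<lambda>x. cnj (iter_partial js f x))"
  using assms
  by (induction js) (auto simp: partial_d_cnj smooth_fun_differentiable smooth_fun_iter)

lemma iter_partial_affine:
  assumes "smooth_fun f"
  shows "iter_partial js (\<lambda>x. f (c *\<^sub>R x + a)) =
    (\<lambda>x. of_real c ^ length js * iter_partial js f (c *\<^sub>R x + a))"
proof (induction js)
  case (Cons i js)
  have "partial_d i (\<lambda>x. of_real c ^ length js * iter_partial js f (c *\<^sub>R x + a)) =
    (\<lambda>x. of_real c ^ length js * partial_d i (\<lambda>x. iter_partial js f (c *\<^sub>R x + a)) x)"
    using partial_d_lincomb[of "\<lambda>x. iter_partial js f (c *\<^sub>R x + a)" "\<lambda>x. 0" i "of_real c ^ length js" 0]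
    by (simp add: smooth_fun_differentiable smooth_affine smooth_fun_iter assms)
  with Cons show ?case
    by (simp add: partial_d_affine smooth_fun_differentiable smooth_fun_iter assms mult_ac)
qed simp

lemma iter_partial_const: "iter_partial js (\<lambda>x. c) = (\<lambda>x. if js = [] then c else 0)"
  by (induction js) (auto simp: partial_d_const)

lemma partial_d_cong_open:
  assumes "open S" "x \<in> S" "\<And>y. y \<in> S \<Longrightarrow> f y = g y"
  shows "partial_d i f x = partial_d i g x"
proof -
  have "(f has_derivative D) (at x) \<longleftrightarrow> (g has_derivative D) (at x)" for D
    using has_derivative_transform_within_open[OF _ assms(1,2)] assms(3) by (metis (no_types, lifting))
  then show ?thesis unfolding partial_d_def frechet_derivative_def by simp
qed

lemma iter_partial_cong_open:
  assumes "open S" "x \<in> S" "\<And>y. y \<in> S \<Longrightarrow> f y = g y"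
  shows "iter_partial js f x = iter_partial js g x"
  using assms(2)
proof (induction js arbitrary: x)
  case (Cons i js)
  then show ?case by (auto intro: partial_d_cong_open[OF assms(1)])
qed (use assms in auto)

lemma iter_partial_eq_0_outside_supp:
  assumes "x \<notin> fun_supp f" shows "iter_partial js f x = 0"
proof -
  have "iter_partial js f x = iter_partial js (\<lambda>x. 0) x"
    using assms closure_subset[of "{x. f x \<noteq> 0}"]
    by (intro iter_partial_cong_open[of "- fun_supp f"]) (auto simp: fun_supp_def)
  then show ?thesis by (simp add: iter_partial_const)
qed

lemma Leibniz_bound:
  fixes f g :: "real ^ 'n::finite \<Rightarrow> complex"
  assumes "smooth_fun f" "smooth_fun g"
    and "\<And>js. length js \<le> n \<Longrightarrow> cmod (iter_partial js f x) \<le> F (length js)"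
    and "\<And>js. length js \<le> n \<Longrightarrow> cmod (iter_partial js g x) \<le> G (length js)"
    and "length js = n"
  shows "cmod (iter_partial js (\<lambda>x. f x * g x) x) \<le> (\<Sum>k\<le>n. real (n choose k) * F k * G (n - k))"
  using assms
proof (induction n arbitrary: f g F G js)
  case 0
  have f: "cmod (f x) \<le> F 0" and g: "cmod (g x) \<le> G 0"
    using 0(3)[of "[]"] 0(4)[of "[]"] by simp_all
  have "0 \<le> F 0" using f norm_ge_zero order_trans by blast
  then have "cmod (f x) * cmod (g x) \<le> F 0 * G 0" using f g by (intro mult_mono) auto
  then show ?case using 0(5) by (simp add: norm_mult)
next
  case (Suc n)
  obtain ks i where js: "js = ks @ [i]" and ks: "length ks = n"
    using Suc.prems(5) by (metis length_Suc_conv_rev)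
  have sm: "smooth_fun (partial_d i f)" "smooth_fun (partial_d i g)"
    using Suc.prems smooth_fun_partial by blast+
  have 1: "cmod (iter_partial ks (\<lambda>x. partial_d i f x * g x) x) \<le>
    (\<Sum>k\<le>n. real (n choose k) * F (Suc k) * G (n - k))"
  proof (rule Suc.IH[OF sm(1) Suc.prems(2), where F = "\<lambda>k. F (Suc k)" and G = G, OF _ _ ks])
    fix ls :: "'n list" assume "length ls \<le> n"
    then show "cmod (iter_partial ls (partial_d i f) x) \<le> F (Suc (length ls))"
      using Suc.prems(3)[of "ls @ [i]"] by (simp add: iter_partial_snoc)
  qed (use Suc.prems in auto)
  have 2: "cmod (iter_partial ks (\<lambda>x. f x * partial_d i g x) x) \<le>
    (\<Sum>k\<le>n. real (n choose k) * F k * G (Suc (n - k)))"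
  proof (rule Suc.IH[OF Suc.prems(1) sm(2), where F = F and G = "\<lambda>k. G (Suc k)", OF _ _ ks])
    fix ls :: "'n list" assume "length ls \<le> n"
    then show "cmod (iter_partial ls (partial_d i g) x) \<le> G (Suc (length ls))"
      using Suc.prems(4)[of "ls @ [i]"] by (simp add: iter_partial_snoc)
  qed (use Suc.prems in auto)
  have "iter_partial js (\<lambda>x. f x * g x) x =
    iter_partial ks (\<lambda>x. partial_d i f x * g x) x + iter_partial ks (\<lambda>x. f x * partial_d i g x) x"
    using iter_partial_lincomb[OF smooth_mult[OF sm(1) Suc.prems(2)] smooth_mult[OF Suc.prems(1) sm(2)], of ks 1 1]
      Suc.prems(1,2)
    by (simp add: js iter_partial_snoc partial_d_mult smooth_fun_differentiable)
  also have "cmod \<dots> \<le> (\<Sum>k\<le>n. real (n choose k) * F (Suc k) * G (n - k))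
      + (\<Sum>k\<le>n. real (n choose k) * F k * G (Suc (n - k)))"
    using 1 2 norm_triangle_mono by blast
  also have "\<dots> = (\<Sum>k\<le>Suc n. real (Suc n choose k) * F k * G (Suc n - k))"
  proof -
    have "(\<Sum>k\<le>Suc n. real (Suc n choose k) * F k * G (Suc n - k)) =
      F 0 * G (Suc n) + (\<Sum>k\<le>n. real (Suc n choose Suc k) * F (Suc k) * G (n - k))"
      by (subst sum.atMost_Suc_shift) simp
    moreover have "(\<Sum>k\<le>n. real (Suc n choose Suc k) * F (Suc k) * G (n - k)) =
      (\<Sum>k\<le>n. real (n choose k) * F (Suc k) * G (n - k)) + (\<Sum>k\<le>n. real (n choose Suc k) * F (Suc k) * G (n - k))"
      by (simp add: sum.distrib[symmetric] algebra_simps)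
    moreover have "(\<Sum>k\<le>n. real (n choose Suc k) * F (Suc k) * G (n - k)) + F 0 * G (Suc n) =
      (\<Sum>k\<le>Suc n. real (n choose k) * F k * G (Suc n - k))"
      by (subst sum.atMost_Suc_shift) simp
    moreover have "(\<Sum>k\<le>Suc n. real (n choose k) * F k * G (Suc n - k)) =
        (\<Sum>k\<le>n. real (n choose k) * F k * G (Suc (n - k)))"
      by (simp add: Suc_diff_le)
    ultimately show ?thesis by linarith
  qed
  finally show ?case .
qed

text \<open>Both mixed partials at \<open>x\<close> are the limit of the same symmetric second difference quotient.\<close>

lemma second_difference_mean_value:
  fixes g :: "real ^ 'n::finite \<Rightarrow> real"
  assumes 1: "\<And>x. (g has_derivative D x) (at x)"
    and 2: "\<And>x. ((\<lambda>x. D x (axis i 1)) has_derivative D2 x) (at x)"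
    and "h > 0"
  shows "\<exists>a b. 0 \<le> a \<and> a \<le> h \<and> 0 \<le> b \<and> b \<le> h \<and>
    g (x + h *\<^sub>R axis i 1 + h *\<^sub>R axis j 1) - g (x + h *\<^sub>R axis i 1) - g (x + h *\<^sub>R axis j 1) + g x =
    h * h * D2 (x + a *\<^sub>R axis i 1 + b *\<^sub>R axis j 1) (axis j 1)"
proof -
  have lin: "D x (c *\<^sub>R v) = c * D x v" "D2 x (c *\<^sub>R v) = c * D2 x v" for x c v
    using linear_scale[OF has_derivative_linear[OF 1]] linear_scale[OF has_derivative_linear[OF 2]] by simp_all
  have line: "((\<lambda>a. y + a *\<^sub>R v + w) has_derivative (\<lambda>c. c *\<^sub>R v)) (at a)"
    and line': "((\<lambda>a. y + a *\<^sub>R v) has_derivative (\<lambda>c. c *\<^sub>R v)) (at a)" for y v w :: "real ^ 'n" and a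
    by (auto intro!: derivative_eq_intros)
  define \<phi> where "\<phi> a = g (x + a *\<^sub>R axis i 1 + h *\<^sub>R axis j 1) - g (x + a *\<^sub>R axis i 1)" for a
  have d1: "(\<phi> has_real_derivative
      (D (x + a *\<^sub>R axis i 1 + h *\<^sub>R axis j 1) (axis i 1) - D (x + a *\<^sub>R axis i 1) (axis i 1))) (at a)" for a
  proof -
    have "(\<phi> has_derivative (\<lambda>c. D (x + a *\<^sub>R axis i 1 + h *\<^sub>R axis j 1) (c *\<^sub>R axis i 1)
      - D (x + a *\<^sub>R axis i 1) (c *\<^sub>R axis i 1))) (at a)"
      unfolding \<phi>_def
      by (intro has_derivative_diff has_derivative_compose[OF line 1]
          has_derivative_compose[OF line' 1])
    then show ?thesis
      unfolding has_field_derivative_def lin right_diff_distrib[symmetric]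
      by (simp add: mult.commute[of _ "D _ _ - _"])
  qed
  obtain a where a: "0 < a" "a < h" "\<phi> h - \<phi> 0 = (h - 0) *
     (D (x + a *\<^sub>R axis i 1 + h *\<^sub>R axis j 1) (axis i 1) - D (x + a *\<^sub>R axis i 1) (axis i 1))"
    using MVT2[OF \<open>h > 0\<close>, of \<phi>, OF d1] by blast
  define \<theta> where "\<theta> b = D (x + a *\<^sub>R axis i 1 + b *\<^sub>R axis j 1) (axis i 1)" for b
  have d2: "(\<theta> has_real_derivative D2 (x + a *\<^sub>R axis i 1 + b *\<^sub>R axis j 1) (axis j 1)) (at b)" for b
  proof -
    have "(\<theta> has_derivative (\<lambda>c. D2 (x + a *\<^sub>R axis i 1 + b *\<^sub>R axis j 1) (c *\<^sub>R axis j 1))) (at b)"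
      unfolding \<theta>_def
      by (rule has_derivative_compose[OF line' 2])
    then show ?thesis
      unfolding has_field_derivative_def lin by (simp add: mult.commute[of _ "D2 _ _"])
  qed
  obtain b where b: "0 < b" "b < h" "\<theta> h - \<theta> 0 = (h - 0) * D2 (x + a *\<^sub>R axis i 1 + b *\<^sub>R axis j 1) (axis j 1)"
    using MVT2[OF \<open>h > 0\<close>, of \<theta>, OF d2] by blast
  have "\<phi> h - \<phi> 0 = h * h * D2 (x + a *\<^sub>R axis i 1 + b *\<^sub>R axis j 1) (axis j 1)"
    using a(3) b(3) by (simp add: \<theta>_def)
  with a(1,2) b(1,2) show ?thesis
    by (intro exI[of _ a] exI[of _ b]) (auto simp: \<phi>_def)
qed

lemma mixed_partials_eq_real:
  fixes g :: "real ^ 'n::finite \<Rightarrow> real"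
  assumes 1: "\<And>x. (g has_derivative D x) (at x)"
    and 2: "\<And>i x. ((\<lambda>x. D x (axis i 1)) has_derivative D2 i x) (at x)"
    and 3: "\<And>i j. continuous_on UNIV (\<lambda>x. D2 i x (axis j 1))"
  shows "D2 i x (axis j 1) = D2 j x (axis i 1)"
proof -
  have lim: "((\<lambda>h. (g (x + h *\<^sub>R axis i 1 + h *\<^sub>R axis j 1) - g (x + h *\<^sub>R axis i 1) - g (x + h *\<^sub>R axis j 1) + g x) / (h * h))
      \<longlongrightarrow> D2 i x (axis j 1)) (at_right 0)" for i j
  proof (rule tendstoI)
    fix e :: real assume "e > 0"
    have "isCont (\<lambda>x. D2 i x (axis j 1)) x"
      using 3 by (simp add: continuous_on_eq_continuous_at)
    then obtain d where d: "d > 0" "\<And>y. dist y x < d \<Longrightarrow> dist (D2 i y (axis j 1)) (D2 i x (axis j 1)) < e"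
      using \<open>e > 0\<close> unfolding continuous_at_eps_delta by blast
    show "\<forall>\<^sub>F h in at_right 0. dist ((g (x + h *\<^sub>R axis i 1 + h *\<^sub>R axis j 1) - g (x + h *\<^sub>R axis i 1) - g (x + h *\<^sub>R axis j 1) + g x) / (h * h)) (D2 i x (axis j 1)) < e"
      unfolding eventually_at_right_field
    proof (intro exI[of _ "d / 2"] conjI allI impI)
      fix h :: real assume h: "0 < h" "h < d / 2"
      obtain a b where ab: "0 \<le> a" "a \<le> h" "0 \<le> b" "b \<le> h"
        "g (x + h *\<^sub>R axis i 1 + h *\<^sub>R axis j 1) - g (x + h *\<^sub>R axis i 1) - g (x + h *\<^sub>R axis j 1) + g x =
          h * h * D2 i (x + a *\<^sub>R axis i 1 + b *\<^sub>R axis j 1) (axis j 1)"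
        using second_difference_mean_value[OF 1 2[of i] h(1), of x j] by blast
      have "norm (a *\<^sub>R axis i (1::real) + b *\<^sub>R axis j 1) \<le> \<bar>a\<bar> + \<bar>b\<bar>"
        by (rule order_trans[OF norm_triangle_ineq]) simp
      then have "dist (x + a *\<^sub>R axis i 1 + b *\<^sub>R axis j 1) x < d"
        using ab h by (simp add: dist_norm add.assoc)
      from d(2)[OF this] show "dist ((g (x + h *\<^sub>R axis i 1 + h *\<^sub>R axis j 1) - g (x + h *\<^sub>R axis i 1) - g (x + h *\<^sub>R axis j 1) + g x) / (h * h)) (D2 i x (axis j 1)) < e"
        using h by (simp add: ab(5))
    qed (use d in simp)
  qed
  have eq: "x + h *\<^sub>R axis j 1 + h *\<^sub>R axis i 1 = x + h *\<^sub>R axis i 1 + h *\<^sub>R axis j (1::real)" for h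
    by (simp add: add_ac)
  have "((\<lambda>h. (g (x + h *\<^sub>R axis i 1 + h *\<^sub>R axis j 1) - g (x + h *\<^sub>R axis i 1) - g (x + h *\<^sub>R axis j 1) + g x) / (h * h))
      \<longlongrightarrow> D2 j x (axis i 1)) (at_right 0)"
    using lim[of j i] unfolding eq by (simp add: algebra_simps)
  with lim[of i j] show ?thesis
    by (rule tendsto_unique[rotated]) simp
qed

lemma partial_d_commute:
  assumes "smooth_fun f"
  shows "partial_d i (partial_d j f) = partial_d j (partial_d i f)"
proof
  fix x
  have *: "L (partial_d i (partial_d j f) x) = L (partial_d j (partial_d i f) x)"
    if L: "bounded_linear L" for L :: "complex \<Rightarrow> real"
  proof -
    define D where "D x = (\<lambda>v. L (frechet_derivative f (at x) v))" for x
    define D2 where "D2 i x = (\<lambda>v. L (frechet_derivative (partial_d i f) (at x) v))" for i x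
    have "D2 j x (axis i 1) = D2 i x (axis j 1)"
    proof (rule mixed_partials_eq_real[where g = "\<lambda>x. L (f x)" and D = D])
      show "((\<lambda>x. L (f x)) has_derivative D x) (at x)" for x
        unfolding D_def
        by (intro bounded_linear.has_derivative[OF L] differentiable_has_derivative
            smooth_fun_differentiable assms)
      have "((\<lambda>x. L (partial_d i f x)) has_derivative D2 i x) (at x)" for i x
        unfolding D2_def
        by (intro bounded_linear.has_derivative[OF L] differentiable_has_derivative
            smooth_fun_differentiable smooth_fun_partial assms)
      then show "((\<lambda>x. D x (axis i 1)) has_derivative D2 i x) (at x)" for i x
        by (simp add: D_def partial_d_def)
      have "continuous_on UNIV (\<lambda>x. L (partial_d j (partial_d i f) x))" for i j
        by (intro bounded_linear.continuous_on[OF L] smooth_fun_continuous smooth_fun_partial assms)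
      then show "continuous_on UNIV (\<lambda>x. D2 i x (axis j 1))" for i j
        by (simp add: D2_def partial_d_def)
    qed
    then show ?thesis by (simp add: D2_def partial_d_def)
  qed
  show "partial_d i (partial_d j f) x = partial_d j (partial_d i f) x"
    using *[OF bounded_linear_Re] *[OF bounded_linear_Im] by (simp add: complex_eq_iff)
qed

lemma iter_partial_move:
  assumes "smooth_fun f"
  shows "iter_partial (js @ i # ks) f = iter_partial (i # js @ ks) f"
proof (induction js)
  case (Cons j js)
  have "iter_partial ((j # js) @ i # ks) f = partial_d j (partial_d i (iter_partial (js @ ks) f))"
    using Cons by simp
  also have "\<dots> = partial_d i (partial_d j (iter_partial (js @ ks) f))"
    by (rule partial_d_commute[OF smooth_fun_iter[OF assms]])
  finally show ?case by simp
qed simp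

lemma iter_partial_perm:
  assumes "smooth_fun f" "mset js = mset ks"
  shows "iter_partial js f = iter_partial ks f"
  using assms(2)
proof (induction js arbitrary: ks)
  case (Cons i js)
  then have "i \<in> set ks" by (metis list.set_intros(1) set_mset_mset)
  then obtain as bs where ks: "ks = as @ i # bs" by (meson split_list)
  with Cons.prems have "mset js = mset (as @ bs)" by simp
  from Cons.IH[OF this] show ?case
    using iter_partial_move[OF assms(1), of as i bs] by (simp add: ks)
qed simp

lemma mi_deriv_eq_iter_partial:
  assumes "smooth_fun f" "\<And>i. count_list js i = \<alpha> $ i"
  shows "mi_deriv \<alpha> f = iter_partial js f"
proof -
  have "\<forall>i. count_list (SOME js. \<forall>i. count_list js i = \<alpha> $ i) i = \<alpha> $ i"
    by (rule someI_ex[OF mi_deriv_list_exists])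
  then have "mset (SOME js. \<forall>i. count_list js i = \<alpha> $ i) = mset js"
    using assms(2) by (intro multiset_eqI) (simp add: count_mset)
  from iter_partial_perm[OF assms(1) this] show ?thesis by (simp add: mi_deriv_def)
qed

lemma sum_count_list: "(\<Sum>i\<in>UNIV. count_list js i) = length (js :: 'n::finite list)"
proof (induction js)
  case (Cons a js)
  have "count_list (a # js) i = count_list js i + (if i = a then 1 else 0)" for i by simp
  with Cons show ?case by (simp only: sum.distrib) simp
qed simp

lemma iter_partial_eq_mi_deriv:
  fixes f :: "real ^ 'n::finite \<Rightarrow> complex"
  assumes "smooth_fun f"
  obtains \<alpha> where "mi_order \<alpha> = length js" "iter_partial js f = mi_deriv \<alpha> f"
proof
  show "mi_order (\<chi> i. count_list js i) = length js"
    by (simp add: mi_order_def sum_count_list)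
  show "iter_partial js f = mi_deriv (\<chi> i. count_list js i) f"
    by (rule mi_deriv_eq_iter_partial[OF assms, symmetric]) simp
qed

lemma mi_deriv_eq_some_iter_partial:
  fixes f :: "real ^ 'n::finite \<Rightarrow> complex"
  assumes "smooth_fun f"
  obtains js where "length js = mi_order \<alpha>" "mi_deriv \<alpha> f = iter_partial js f"
proof -
  obtain js where js: "\<forall>i. count_list js i = \<alpha> $ i" using mi_deriv_list_exists by blast
  show ?thesis
  proof
    show "length js = mi_order \<alpha>" using js sum_count_list[of js] by (simp add: mi_order_def)
    show "mi_deriv \<alpha> f = iter_partial js f" using mi_deriv_eq_iter_partial[OF assms] js by blast
  qed
qed

subsection \<open>Factorials and exponentials\<close>

lemma power_le_fact_powr_exp:
  fixes X s :: real
  assumes "0 \<le> X" "0 < s"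
  shows "X ^ n \<le> fact n powr s * exp (s * X powr (1 / s))"
proof (cases "X = 0")
  case True
  then show ?thesis by (cases n) auto
next
  case False
  with assms have X: "X > 0" by simp
  define y where "y = X powr (1 / s)"
  have y: "y > 0" "y powr s = X" using X assms by (auto simp: y_def powr_powr)
  have "y ^ n / fact n \<le> exp y"
  proof -
    have "sum (\<lambda>k. y ^ k /\<^sub>R fact k) {n} \<le> exp y"
      using exp_converges[of y] y(1)
      by (intro sum_le_suminf[of "\<lambda>k. y ^ k /\<^sub>R fact k" "{n}", unfolded sums_unique[OF exp_converges, symmetric]])
         (auto simp: sums_iff)
    then show ?thesis by (simp add: divide_inverse mult.commute)
  qed
  then have "y ^ n \<le> fact n * exp y" by (simp add: field_simps)
  then have "(y ^ n) powr s \<le> (fact n * exp y) powr s"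
    using y(1) assms by (intro powr_mono2) auto
  moreover have "(y ^ n) powr s = X ^ n"
    using y by (simp add: powr_realpow[symmetric] powr_powr mult.commute)
       (simp add: powr_powr[symmetric] powr_realpow X)
  moreover have "(fact n * exp y) powr s = fact n powr s * exp (s * y)"
    by (simp add: powr_mult exp_powr_real mult.commute)
  ultimately show ?thesis by (simp add: y_def)
qed

lemma moments_imp_exp_decay:
  fixes A B X r t :: real
  assumes "0 < t" "0 < r" "0 \<le> A" "0 \<le> B" "0 \<le> X"
    and le: "\<And>m. A * X ^ m \<le> B * ((t / (2 * r)) powr t) ^ m * fact m powr t"
  shows "A * exp (r * X powr (1 / t)) \<le> 2 powr t * B"
proof -
  define a b y where "a = A powr (1 / t)" and "b = B powr (1 / t)" and "y = X powr (1 / t)"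
  have ab: "a \<ge> 0" "b \<ge> 0" "y \<ge> 0" by (auto simp: a_def b_def y_def)
  have tm: "a * ((r / t * y) ^ m /\<^sub>R fact m) \<le> b * (1 / 2) ^ m" for m
  proof -
    have "(A * X ^ m) powr (1 / t) \<le> (B * ((t / (2 * r)) powr t) ^ m * fact m powr t) powr (1 / t)"
      using assms by (intro powr_mono2) auto
    also have "\<dots> = b * (t / (2 * r)) ^ m * fact m"
    proof -
      have "(((t / (2 * r)) powr t) ^ m) powr (1 / t) = (t / (2 * r)) ^ m"
        using assms by (simp add: powr_power powr_powr) (simp add: powr_realpow)
      then show ?thesis
        using assms by (simp add: powr_mult b_def powr_powr)
    qed
    also have "(A * X ^ m) powr (1 / t) = a * y ^ m"
    proof (cases "X = 0")
      case True
      then show ?thesis by (cases m) (auto simp: a_def y_def)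
    next
      case False
      then show ?thesis using assms
        by (simp add: powr_mult a_def y_def powr_power) (simp add: powr_realpow[symmetric] powr_powr)
    qed
    finally have 1: "a * y ^ m \<le> b * (t / (2 * r)) ^ m * fact m" .
    have "a * ((r / t * y) ^ m /\<^sub>R fact m) = (r / t) ^ m / fact m * (a * y ^ m)"
      by (simp add: power_mult_distrib divide_inverse)
    also have "\<dots> \<le> (r / t) ^ m / fact m * (b * (t / (2 * r)) ^ m * fact m)"
      using assms 1 by (intro mult_left_mono) auto
    also have "\<dots> = b * ((r / t) * (t / (2 * r))) ^ m"
      by (simp only: power_mult_distrib) simp
    also have "(r / t) * (t / (2 * r)) = 1 / 2" using assms by simp
    finally show ?thesis .
  qed
  have "a * exp (r / t * y) \<le> b * 2"
  proof (rule sums_le[OF tm])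
    show "(\<lambda>m. a * ((r / t * y) ^ m /\<^sub>R fact m)) sums (a * exp (r / t * y))"
      by (intro sums_mult exp_converges)
    show "(\<lambda>m. b * (1 / 2) ^ m) sums (b * 2)"
      using geometric_sums[of "1 / 2 :: real"] by (intro sums_mult) simp
  qed
  then have "(a * exp (r / t * y)) powr t \<le> (b * 2) powr t"
    using ab assms by (intro powr_mono2) auto
  moreover have "(a * exp (r / t * y)) powr t = A * exp (r * y)"
    using assms by (simp add: powr_mult a_def powr_powr exp_powr_real)
  moreover have "(b * 2) powr t = 2 powr t * B"
    using assms by (simp add: powr_mult b_def powr_powr)
  ultimately show ?thesis by (simp add: y_def)
qed

lemma binomial_fact_powr:
  assumes "k \<le> n"
  shows "real (n choose k) * (fact k powr s * fact (n - k) powr s) =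
    real (n choose k) powr (1 - s) * fact n powr s"
proof -
  have C: "real (n choose k) > 0" using assms by simp
  have "fact n = real (n choose k) * (fact k * fact (n - k))"
    using binomial_fact_lemma[OF assms] by (metis (mono_tags, opaque_lifting) mult.commute of_nat_fact of_nat_mult)
  then have "real (n choose k) powr (1 - s) * fact n powr s =
     (real (n choose k) powr (1 - s) * real (n choose k) powr s) * (fact k powr s * fact (n - k) powr s)"
    by (simp add: powr_mult mult_ac)
  also have "real (n choose k) powr (1 - s) * real (n choose k) powr s = real (n choose k)"
    using C by (simp add: powr_add[symmetric])
  finally show ?thesis by simp
qed

lemma mi_fact_ge_1: "mi_fact \<alpha> \<ge> 1"
  unfolding mi_fact_def by (intro prod_ge_1) simp

lemma prod_fact_le_fact_sum:
  "finite A \<Longrightarrow> (\<Prod>i\<in>A. fact (\<alpha> i) :: real) \<le> fact (\<Sum>i\<in>A. \<alpha> i)"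
proof (induction A rule: finite_induct)
  case (insert x A)
  have "fact (\<alpha> x) * fact (\<Sum>i\<in>A. \<alpha> i) \<le> (fact (\<alpha> x + (\<Sum>i\<in>A. \<alpha> i)) :: real)"
    using dvd_imp_le[OF fact_fact_dvd_fact[of "\<alpha> x" "\<Sum>i\<in>A. \<alpha> i"]]
    by (metis (mono_tags, lifting) fact_gt_zero of_nat_fact of_nat_le_iff of_nat_mult)
  with insert show ?case
    by (auto intro: order_trans[OF mult_left_mono])
qed simp

lemma mi_fact_le_fact_order: "mi_fact \<alpha> \<le> fact (mi_order \<alpha>)"
  unfolding mi_fact_def mi_order_def by (rule prod_fact_le_fact_sum) simp

lemma fact_sum_le_prod_fact:
  "finite A \<Longrightarrow> fact (\<Sum>i\<in>A. \<alpha> i) \<le> real (card A) ^ (\<Sum>i\<in>A. \<alpha> i) * (\<Prod>i\<in>A. fact (\<alpha> i))"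
proof (induction A rule: finite_induct)
  case (insert x A)
  define a b c where "a = \<alpha> x" and "b = (\<Sum>i\<in>A. \<alpha> i)" and "c = real (card A)"
  have bin: "real (a + b choose a) * c ^ b \<le> (1 + c) ^ (a + b)"
  proof -
    have "(\<Sum>k\<in>{a}. real (a + b choose k) * 1 ^ k * c ^ (a + b - k)) \<le>
      (\<Sum>k\<le>a + b. real (a + b choose k) * 1 ^ k * c ^ (a + b - k))"
      by (rule sum_mono2) (auto simp: c_def)
    then show ?thesis using binomial_ring[of 1 c "a + b"] by simp
  qed
  have "fact (a + b) = real (a + b choose a) * (fact a * fact b)"
    using binomial_fact_lemma[of a "a + b"]
    by (metis add_diff_cancel_left' le_add1 mult.commute of_nat_fact of_nat_mult)
  also have "\<dots> \<le> real (a + b choose a) * (fact a * (c ^ b * (\<Prod>i\<in>A. fact (\<alpha> i))))"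
    using insert.IH by (intro mult_left_mono) (auto simp: b_def c_def)
  also have "\<dots> = (real (a + b choose a) * c ^ b) * (fact a * (\<Prod>i\<in>A. fact (\<alpha> i)))"
    by simp
  also have "\<dots> \<le> (1 + c) ^ (a + b) * (fact a * (\<Prod>i\<in>A. fact (\<alpha> i)))"
    by (intro mult_right_mono bin mult_nonneg_nonneg prod_nonneg) auto
  finally show ?case using insert.hyps by (simp add: a_def b_def c_def)
qed simp

lemma fact_order_le_mi_fact:
  "fact (mi_order \<alpha>) \<le> real CARD('n) ^ mi_order \<alpha> * mi_fact (\<alpha> :: nat ^ 'n::finite)"
  unfolding mi_fact_def mi_order_def using fact_sum_le_prod_fact[of "UNIV :: 'n set" "\<lambda>i. \<alpha> $ i"] by simp

subsection \<open>Weighted Gevrey estimates\<close>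

definition gevrey_le ::
  "real \<Rightarrow> real \<Rightarrow> (real ^ 'n::finite \<Rightarrow> real) \<Rightarrow> (real ^ 'n \<Rightarrow> complex) \<Rightarrow> bool" where
  "gevrey_le s h w f \<longleftrightarrow>
     (\<forall>js x. cmod (iter_partial js f x) \<le> w x * h ^ length js * fact (length js) powr s)"

lemma gevrey_leD:
  "gevrey_le s h w f \<Longrightarrow> cmod (iter_partial js f x) \<le> w x * h ^ length js * fact (length js) powr s"
  by (simp add: gevrey_le_def)

lemma gevrey_le_cmod: "gevrey_le s h w f \<Longrightarrow> cmod (f x) \<le> w x"
  using gevrey_leD[of s h w f "[]" x] by simp

lemma gevrey_le_nonneg: "gevrey_le s h w f \<Longrightarrow> 0 \<le> w x"
  using gevrey_le_cmod[of s h w f x] norm_ge_zero order_trans by blast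

lemma gevrey_le_mono:
  fixes f :: "real ^ 'n::finite \<Rightarrow> complex"
  assumes "gevrey_le s h w f" "0 < h" "h \<le> h'" "\<And>x. w x \<le> w' x"
  shows "gevrey_le s h' w' f"
  unfolding gevrey_le_def
proof (intro allI)
  fix js :: "'n list" and x
  have "w x * h ^ length js * fact (length js) powr s \<le> w' x * h' ^ length js * fact (length js) powr s"
    using assms gevrey_le_nonneg[OF assms(1), of x]
    by (intro mult_right_mono mult_mono power_mono) (auto intro: order_trans)
  with gevrey_leD[OF assms(1)]
  show "cmod (iter_partial js f x) \<le> w' x * h' ^ length js * fact (length js) powr s"
    using order_trans by blast
qed

lemma gevrey_le_lincomb:
  fixes f :: "real ^ 'n::finite \<Rightarrow> complex"
  assumes "smooth_fun f" "smooth_fun g" "gevrey_le s h v f" "gevrey_le s h w g"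
  shows "gevrey_le s h (\<lambda>x. cmod a * v x + cmod b * w x) (\<lambda>x. a * f x + b * g x)"
  unfolding gevrey_le_def
proof (intro allI)
  fix js :: "'n list" and x
  have "cmod (iter_partial js (\<lambda>x. a * f x + b * g x) x) \<le>
    cmod a * cmod (iter_partial js f x) + cmod b * cmod (iter_partial js g x)"
    unfolding iter_partial_lincomb[OF assms(1,2)] norm_mult[symmetric] by (rule norm_triangle_ineq)
  also have "\<dots> \<le> cmod a * (v x * h ^ length js * fact (length js) powr s)
      + cmod b * (w x * h ^ length js * fact (length js) powr s)"
    by (intro add_mono mult_left_mono gevrey_leD assms) auto
  finally show "cmod (iter_partial js (\<lambda>x. a * f x + b * g x) x) \<le>
     (cmod a * v x + cmod b * w x) * h ^ length js * fact (length js) powr s"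
    by (simp add: algebra_simps)
qed

lemma gevrey_le_cnj:
  "smooth_fun f \<Longrightarrow> gevrey_le s h w f \<Longrightarrow> gevrey_le s h w (\<lambda>x. cnj (f x))"
  by (simp add: gevrey_le_def iter_partial_cnj)

lemma gevrey_le_affine:
  fixes f :: "real ^ 'n::finite \<Rightarrow> complex"
  assumes "smooth_fun f" "gevrey_le s h w f" "\<bar>c\<bar> * h \<le> h'" "0 \<le> h"
  shows "gevrey_le s h' (\<lambda>x. w (c *\<^sub>R x + a)) (\<lambda>x. f (c *\<^sub>R x + a))"
  unfolding gevrey_le_def
proof (intro allI)
  fix js :: "'n list" and x
  have "cmod (iter_partial js (\<lambda>x. f (c *\<^sub>R x + a)) x) =
     \<bar>c\<bar> ^ length js * cmod (iter_partial js f (c *\<^sub>R x + a))"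
    by (simp add: iter_partial_affine[OF assms(1)] norm_mult norm_power)
  also have "\<dots> \<le> \<bar>c\<bar> ^ length js * (w (c *\<^sub>R x + a) * h ^ length js * fact (length js) powr s)"
    by (intro mult_left_mono gevrey_leD[OF assms(2)]) auto
  also have "\<dots> = w (c *\<^sub>R x + a) * (\<bar>c\<bar> * h) ^ length js * fact (length js) powr s"
    by (simp add: power_mult_distrib)
  also have "\<dots> \<le> w (c *\<^sub>R x + a) * h' ^ length js * fact (length js) powr s"
    using assms gevrey_le_nonneg[OF assms(2)] by (intro mult_right_mono mult_left_mono power_mono) auto
  finally show "cmod (iter_partial js (\<lambda>x. f (c *\<^sub>R x + a)) x) \<le>
    w (c *\<^sub>R x + a) * h' ^ length js * fact (length js) powr s" .
qed

lemma gevrey_le_mult: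
  fixes f :: "real ^ 'n::finite \<Rightarrow> complex"
  assumes "smooth_fun f" "smooth_fun g" "gevrey_le s h v f" "gevrey_le s h w g" "1 \<le> s" "0 < h"
  shows "gevrey_le s (2 * h) (\<lambda>x. v x * w x) (\<lambda>x. f x * g x)"
  unfolding gevrey_le_def
proof (intro allI)
  fix js :: "'n list" and x
  define n where "n = length js"
  have vw: "v x \<ge> 0" "w x \<ge> 0" using gevrey_le_nonneg assms by blast+
  have "cmod (iter_partial js (\<lambda>x. f x * g x) x) \<le>
    (\<Sum>k\<le>n. real (n choose k) * (v x * h ^ k * fact k powr s) * (w x * h ^ (n - k) * fact (n - k) powr s))"
    by (rule Leibniz_bound[OF assms(1,2), where n = n and F = "\<lambda>k. v x * h ^ k * fact k powr s" and
          G = "\<lambda>k. w x * h ^ k * fact k powr s"])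
       (auto simp: n_def intro: gevrey_leD assms)
  also have "\<dots> \<le> (\<Sum>k\<le>n. v x * w x * h ^ n * fact n powr s)"
  proof (rule sum_mono)
    fix k assume k: "k \<in> {..n}"
    have "real (n choose k) * (v x * h ^ k * fact k powr s) * (w x * h ^ (n - k) * fact (n - k) powr s) =
      v x * w x * (h ^ k * h ^ (n - k)) * (real (n choose k) * (fact k powr s * fact (n - k) powr s))"
      by (simp add: mult_ac)
    also have "real (n choose k) * (fact k powr s * fact (n - k) powr s) =
        real (n choose k) powr (1 - s) * fact n powr s"
      using k by (intro binomial_fact_powr) simp
    also have "h ^ k * h ^ (n - k) = h ^ n" using k by (simp add: power_add[symmetric])
    also have "v x * w x * h ^ n * (real (n choose k) powr (1 - s) * fact n powr s) \<le>
        v x * w x * h ^ n * (1 * fact n powr s)"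
    proof (intro mult_left_mono mult_right_mono)
      have "1 \<le> real (n choose k)" using k
        by (metis One_nat_def Suc_leI atMost_iff of_nat_1 of_nat_le_iff zero_less_binomial)
      then show "real (n choose k) powr (1 - s) \<le> 1"
        using assms(5) k powr_mono[of "1 - s" 0 "real (n choose k)"] by simp
    qed (use vw assms in auto)
    finally show "real (n choose k) * (v x * h ^ k * fact k powr s) * (w x * h ^ (n - k) * fact (n - k) powr s)
      \<le> v x * w x * h ^ n * fact n powr s" by simp
  qed
  also have "\<dots> = real (Suc n) * (v x * w x * h ^ n * fact n powr s)"
    by simp
  also have "\<dots> \<le> 2 ^ n * (v x * w x * h ^ n * fact n powr s)"
  proof (rule mult_right_mono)
    have "Suc n \<le> 2 ^ n" by (induction n) auto
    then show "real (Suc n) \<le> 2 ^ n" by (metis of_nat_le_iff of_nat_numeral of_nat_power)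
  qed (use vw assms in auto)
  finally show "cmod (iter_partial js (\<lambda>x. f x * g x) x) \<le>
      v x * w x * (2 * h) ^ length js * fact (length js) powr s"
    by (simp add: n_def power_mult_distrib mult_ac)
qed

lemma gevrey_le_const: "0 < h \<Longrightarrow> gevrey_le s h (\<lambda>_. cmod c) (\<lambda>_. c)"
  by (auto simp: gevrey_le_def iter_partial_const)

definition gevrey_bdd :: "real \<Rightarrow> (real ^ 'n::finite \<Rightarrow> complex) \<Rightarrow> bool" where
  "gevrey_bdd s f \<longleftrightarrow> smooth_fun f \<and> (\<forall>h>0. \<exists>C. gevrey_le s h (\<lambda>_. C) f)"

lemma gevrey_bddD:
  assumes "gevrey_bdd s f" "h > 0"
  obtains C where "C > 0" "gevrey_le s h (\<lambda>_. C) f"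
proof -
  obtain C where C: "gevrey_le s h (\<lambda>_. C) f" using assms by (auto simp: gevrey_bdd_def)
  have "gevrey_le s h (\<lambda>_. C + 1) f" by (rule gevrey_le_mono[OF C]) (use assms in auto)
  moreover have "C + 1 > 0" using gevrey_le_nonneg[OF C] by (simp add: add_nonneg_pos)
  ultimately show ?thesis using that by blast
qed

lemma gevrey_bdd_smooth: "gevrey_bdd s f \<Longrightarrow> smooth_fun f"
  by (simp add: gevrey_bdd_def)

lemma gevrey_bdd_const: "gevrey_bdd s (\<lambda>_. c)"
  using gevrey_le_const by (auto simp: gevrey_bdd_def)

lemma gevrey_bdd_lincomb:
  assumes "gevrey_bdd s f" "gevrey_bdd s g"
  shows "gevrey_bdd s (\<lambda>x. a * f x + b * g x)"
  unfolding gevrey_bdd_def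
proof (intro conjI allI impI)
  fix h :: real assume h: "h > 0"
  obtain C D where "gevrey_le s h (\<lambda>_. C) f" "gevrey_le s h (\<lambda>_. D) g"
    using assms h unfolding gevrey_bdd_def by blast
  from gevrey_le_lincomb[OF gevrey_bdd_smooth[OF assms(1)] gevrey_bdd_smooth[OF assms(2)] this]
  show "\<exists>C. gevrey_le s h (\<lambda>_. C) (\<lambda>x. a * f x + b * g x)" by blast
qed (use assms smooth_lincomb in \<open>auto simp: gevrey_bdd_def\<close>)

lemma gevrey_bdd_cnj: "gevrey_bdd s f \<Longrightarrow> gevrey_bdd s (\<lambda>x. cnj (f x))"
  using gevrey_le_cnj smooth_cnj unfolding gevrey_bdd_def by blast

lemma gevrey_bdd_mult:
  assumes "gevrey_bdd s f" "gevrey_bdd s g" "1 \<le> s"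
  shows "gevrey_bdd s (\<lambda>x. f x * g x)"
  unfolding gevrey_bdd_def
proof (intro conjI allI impI)
  fix h :: real assume h: "h > 0"
  obtain C D where "gevrey_le s (h/2) (\<lambda>_. C) f" "gevrey_le s (h/2) (\<lambda>_. D) g"
    using assms h unfolding gevrey_bdd_def by (meson half_gt_zero)
  then have "gevrey_le s (2 * (h/2)) (\<lambda>_. C * D) (\<lambda>x. f x * g x)"
    using assms h by (intro gevrey_le_mult) (auto simp: gevrey_bdd_def)
  then show "\<exists>C. gevrey_le s h (\<lambda>_. C) (\<lambda>x. f x * g x)" by auto
qed (use assms smooth_mult in \<open>auto simp: gevrey_bdd_def\<close>)

lemma gevrey_bdd_affine:
  assumes "gevrey_bdd s f"
  shows "gevrey_bdd s (\<lambda>x. f (c *\<^sub>R x + a))"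
  unfolding gevrey_bdd_def
proof (intro conjI allI impI)
  fix h :: real assume h: "h > 0"
  define k where "k = h / max 1 \<bar>c\<bar>"
  have k: "k > 0" "\<bar>c\<bar> * k \<le> h" using h by (auto simp: k_def field_simps max_def)
  obtain C where C: "gevrey_le s k (\<lambda>_. C) f" using assms k by (auto simp: gevrey_bdd_def)
  show "\<exists>C. gevrey_le s h (\<lambda>_. C) (\<lambda>x. f (c *\<^sub>R x + a))"
    using gevrey_le_affine[OF gevrey_bdd_smooth[OF assms(1)] C k(2), of a] k by (intro exI[of _ C]) simp
qed (use assms smooth_affine in \<open>auto simp: gevrey_bdd_def\<close>)

lemma gevrey_bdd_sum:
  assumes "finite A" "\<And>i. i \<in> A \<Longrightarrow> gevrey_bdd s (f i)"
  shows "gevrey_bdd s (\<lambda>x. \<Sum>i\<in>A. f i x)"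
  using assms
proof (induction A rule: finite_induct)
  case empty
  then show ?case by (simp add: gevrey_bdd_const)
next
  case (insert i A)
  then show ?case using gevrey_bdd_lincomb[of s "f i" "\<lambda>x. \<Sum>i\<in>A. f i x" 1 1] by simp
qed

lemma gevrey_bdd_prod:
  assumes "finite A" "\<And>i. i \<in> A \<Longrightarrow> gevrey_bdd s (f i)" "1 \<le> s"
  shows "gevrey_bdd s (\<lambda>x. \<Prod>i\<in>A. f i x)"
  using assms
proof (induction A rule: finite_induct)
  case empty
  then show ?case by (simp add: gevrey_bdd_const)
next
  case (insert i A)
  then show ?case using gevrey_bdd_mult[of s "f i" "\<lambda>x. \<Prod>i\<in>A. f i x"] by simp
qed

lemma finite_lists_length: "finite {js :: 'n::finite list. length js = n}"
  using finite_lists_length_eq[of "UNIV :: 'n set" n] by simp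

text \<open>Apply the Leibniz bound at \<open>x\<close> to \<open>(q - q x) * inverse q = 1 - q x * inverse q\<close>, whose
  first factor vanishes at \<open>x\<close>: only derivatives of \<open>inverse q\<close> of lower order contribute.\<close>

lemma inverse_derivative_step:
  fixes q :: "real ^ 'n::finite \<Rightarrow> complex"
  assumes q: "smooth_fun q" "gevrey_le s (H / 2) (\<lambda>_. A) q" and "1 < s" "0 < H" "0 < c"
    and c: "\<And>x. c \<le> cmod (q x)" and "0 \<le> M"
    and M: "\<And>js x. length js < n \<Longrightarrow>
      cmod (iter_partial js (\<lambda>x. inverse (q x)) x) \<le> M * H ^ length js * fact (length js) powr s"
    and js: "length js = n" "n \<ge> 1"
  shows "cmod (iter_partial js (\<lambda>x. inverse (q x)) x) \<le>
    A * (real n powr (1 - s) + (1 / 2) ^ n) / c * M * H ^ n * fact n powr s"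
proof -
  define w where "w = (\<lambda>x. inverse (q x))"
  have q0: "q x \<noteq> 0" for x using c[of x] \<open>0 < c\<close> by auto
  have A: "A \<ge> 0" using gevrey_le_nonneg[OF q(2)] by blast
  have w: "smooth_fun w" unfolding w_def by (rule smooth_inverse[OF q(1) q0])
  define F where "F k = (if k = 0 then 0 else A * (H / 2) ^ k * fact k powr s)" for k :: nat
  define G where "G k = (if k < n then M * H ^ k * fact k powr s
     else (\<Sum>ks\<in>{ks :: 'n list. length ks = k}. cmod (iter_partial ks w x)))" for k
  define f where "f = (\<lambda>y. 1 * q y + (- q x) * 1)"
  have f: "smooth_fun f" unfolding f_def by (intro smooth_lincomb q smooth_const)
  have df: "iter_partial ks f x = (if ks = [] then 0 else iter_partial ks q x)" for ks
    unfolding f_def by (subst iter_partial_lincomb[OF q(1) smooth_const]) (auto simp: iter_partial_const)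
  have "cmod (iter_partial js (\<lambda>y. f y * w y) x) \<le> (\<Sum>k\<le>n. real (n choose k) * F k * G (n - k))"
  proof (rule Leibniz_bound[OF f w _ _ js(1)])
    fix ks :: "'n list"
    show "cmod (iter_partial ks f x) \<le> F (length ks)"
      using gevrey_leD[OF q(2), of ks x] by (auto simp: df F_def)
    show "cmod (iter_partial ks w x) \<le> G (length ks)"
    proof (cases "length ks < n")
      case True
      then show ?thesis using M[of ks x] by (simp add: G_def w_def)
    next
      case False
      have "cmod (iter_partial ks w x) \<le> (\<Sum>ks\<in>{ls. length ls = length ks}. cmod (iter_partial ks w x))"
        by (rule member_le_sum) (auto simp: finite_lists_length)
      with False show ?thesis by (simp add: G_def)
    qed
  qed
  also have "(\<Sum>k\<le>n. real (n choose k) * F k * G (n - k)) \<le>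
     (\<Sum>k\<in>{1..n}. A * M * H ^ n * fact n powr s * ((1 / 2) ^ k * real n powr (1 - s) + (if k = n then (1/2)^n else 0)))"
  proof -
    have "(\<Sum>k\<le>n. real (n choose k) * F k * G (n - k)) = (\<Sum>k\<in>{1..n}. real (n choose k) * F k * G (n - k))"
      by (rule sum.mono_neutral_right) (auto simp: F_def)
    also have "\<dots> \<le> (\<Sum>k\<in>{1..n}. A * M * H ^ n * fact n powr s * ((1 / 2) ^ k * real n powr (1 - s) + (if k = n then (1/2)^n else 0)))"
    proof (rule sum_mono)
      fix k assume k: "k \<in> {1..n}"
      have "real (n choose k) * F k * G (n - k) =
        A * M * ((H / 2) ^ k * H ^ (n - k)) * (real (n choose k) * (fact k powr s * fact (n - k) powr s))"
        using k by (simp add: F_def G_def mult_ac)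
      also have "real (n choose k) * (fact k powr s * fact (n - k) powr s) =
          real (n choose k) powr (1 - s) * fact n powr s"
        using k by (intro binomial_fact_powr) simp
      also have "(H / 2) ^ k * H ^ (n - k) = H ^ n * (1 / 2) ^ k"
        using k by (simp add: power_divide power_add[symmetric])
      also have "A * M * (H ^ n * (1 / 2) ^ k) * (real (n choose k) powr (1 - s) * fact n powr s) =
         A * M * H ^ n * fact n powr s * ((1 / 2) ^ k * real (n choose k) powr (1 - s))"
        by (simp add: mult_ac)
      also have "\<dots> \<le> A * M * H ^ n * fact n powr s *
          ((1 / 2) ^ k * real n powr (1 - s) + (if k = n then (1/2)^n else 0))"
      proof (rule mult_left_mono)
        show "(1 / 2) ^ k * real (n choose k) powr (1 - s) \<le>
          (1 / 2) ^ k * real n powr (1 - s) + (if k = n then (1/2)^n else 0)"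
        proof (cases "k = n")
          case False
          then have "n \<le> n choose k" using k by (intro upper_le_binomial) auto
          then have "real (n choose k) powr (1 - s) \<le> real n powr (1 - s)"
            using js \<open>1 < s\<close> by (intro powr_mono2') auto
          then show ?thesis using False by simp
        qed simp
      qed (use A \<open>0 \<le> M\<close> \<open>0 < H\<close> in auto)
      finally show "real (n choose k) * F k * G (n - k) \<le> A * M * H ^ n * fact n powr s *
          ((1 / 2) ^ k * real n powr (1 - s) + (if k = n then (1/2)^n else 0))" .
    qed
    finally show ?thesis .
  qed
  also have "\<dots> = A * M * H ^ n * fact n powr s *
      ((\<Sum>k\<in>{1..n}. (1 / 2) ^ k) * real n powr (1 - s) + (1 / 2) ^ n)"
    using js(2) by (simp add: sum_distrib_left[symmetric] sum_distrib_right[symmetric] sum.distrib)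
  also have "\<dots> \<le> A * M * H ^ n * fact n powr s * (1 * real n powr (1 - s) + (1 / 2) ^ n)"
  proof (intro mult_left_mono add_right_mono mult_right_mono)
    have "(\<Sum>k\<in>{1..n}. (1 / 2) ^ k) = 1 - (1 / 2 :: real) ^ n" by (induction n) auto
    then show "(\<Sum>k\<in>{1..n}. (1 / 2) ^ k) \<le> (1 :: real)" by simp
  qed (use A \<open>0 \<le> M\<close> \<open>0 < H\<close> in auto)
  finally have *: "cmod (iter_partial js (\<lambda>y. f y * w y) x) \<le>
      A * M * H ^ n * fact n powr s * (real n powr (1 - s) + (1 / 2) ^ n)" by simp
  have "(\<lambda>y. f y * w y) = (\<lambda>y. 1 * 1 + (- q x) * w y)"
    using q0 by (auto simp: f_def w_def field_simps)
  then have "iter_partial js (\<lambda>y. f y * w y) x = - q x * iter_partial js w x"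
    using js iter_partial_lincomb[OF smooth_const w, of js 1 1 "- q x"] by (auto simp: iter_partial_const)
  then have "c * cmod (iter_partial js w x) \<le> cmod (iter_partial js (\<lambda>y. f y * w y) x)"
    by (simp add: norm_mult c mult_right_mono)
  with * have "c * cmod (iter_partial js w x) \<le> A * M * H ^ n * fact n powr s * (real n powr (1 - s) + (1 / 2) ^ n)"
    by linarith
  then have "cmod (iter_partial js w x) \<le> A * M * H ^ n * fact n powr s * (real n powr (1 - s) + (1 / 2) ^ n) / c"
    using \<open>0 < c\<close> by (simp add: field_simps)
  then show ?thesis by (simp add: w_def mult_ac)
qed

lemma gevrey_bdd_inverse:
  fixes q :: "real ^ 'n::finite \<Rightarrow> complex"
  assumes q: "gevrey_bdd s q" and "1 < s" "0 < c" and c: "\<And>x. c \<le> cmod (q x)"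
  shows "gevrey_bdd s (\<lambda>x. inverse (q x))"
  unfolding gevrey_bdd_def
proof (intro conjI allI impI)
  have q0: "q x \<noteq> 0" for x using c[of x] \<open>0 < c\<close> by auto
  show "smooth_fun (\<lambda>x. inverse (q x))"
    by (rule smooth_inverse[OF gevrey_bdd_smooth[OF q] q0])
  fix H :: real assume H: "H > 0"
  obtain A where A: "A > 0" "gevrey_le s (H / 2) (\<lambda>_. A) q"
    using gevrey_bddD[OF q, of "H / 2"] H by auto
  define w where "w = (\<lambda>x. inverse (q x))"
  define P where "P n M \<longleftrightarrow> M \<ge> 0 \<and> (\<forall>js x. length js \<le> n \<longrightarrow>
     cmod (iter_partial js w x) \<le> M * H ^ length js * fact (length js) powr s)" for n M
  define \<theta> where "\<theta> n = A * (real n powr (1 - s) + (1 / 2) ^ n) / c" for n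
  have \<theta>: "\<theta> n \<ge> 0" for n using A \<open>0 < c\<close> by (simp add: \<theta>_def)
  have step: "P (Suc n) (max 1 (\<theta> (Suc n)) * M)" if "P n M" for n M
    unfolding P_def
  proof (intro conjI allI impI)
    have M: "M \<ge> 0" using that by (simp add: P_def)
    then show "0 \<le> max 1 (\<theta> (Suc n)) * M" by simp
    fix js :: "'n list" and x assume js: "length js \<le> Suc n"
    show "cmod (iter_partial js w x) \<le> max 1 (\<theta> (Suc n)) * M * H ^ length js * fact (length js) powr s"
    proof (cases "length js = Suc n")
      case True
      have "cmod (iter_partial js w x) \<le> \<theta> (Suc n) * M * H ^ Suc n * fact (Suc n) powr s"
        unfolding \<theta>_def w_def
      proof (rule inverse_derivative_step[OF gevrey_bdd_smooth[OF q] A(2) \<open>1 < s\<close> H \<open>0 < c\<close> c M _ True])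
        fix ks :: "'n list" and x assume "length ks < Suc n"
        then show "cmod (iter_partial ks (\<lambda>x. inverse (q x)) x) \<le> M * H ^ length ks * fact (length ks) powr s"
          using that by (auto simp: P_def w_def)
      qed simp
      also have "\<dots> \<le> max 1 (\<theta> (Suc n)) * M * H ^ Suc n * fact (Suc n) powr s"
        using M H by (intro mult_right_mono) auto
      finally show ?thesis using True by simp
    next
      case False
      with js have "length js \<le> n" by simp
      then have "cmod (iter_partial js w x) \<le> M * H ^ length js * fact (length js) powr s"
        using that by (auto simp: P_def)
      also have "\<dots> \<le> (max 1 (\<theta> (Suc n)) * M) * H ^ length js * fact (length js) powr s"
        using M H mult_right_mono[of 1 "max 1 (\<theta> (Suc n))" M] by (intro mult_right_mono) auto
      finally show ?thesis .
    qed
  qed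
  have ex: "\<exists>M. P n M" for n
  proof (induction n)
    case 0
    have "cmod (w x) \<le> 1 / c" for x
      using le_imp_inverse_le[OF c \<open>0 < c\<close>, of x] by (simp add: w_def inverse_eq_divide norm_divide)
    then have "P 0 (1 / c)" using \<open>0 < c\<close> by (simp add: P_def)
    then show ?case by blast
  qed (use step in blast)
  have "\<theta> \<longlonglongrightarrow> A * (0 + 0) / c"
    unfolding \<theta>_def using \<open>1 < s\<close> \<open>0 < c\<close>
    by (intro tendsto_intros tendsto_neg_powr filterlim_real_sequentially) auto
  then have "eventually (\<lambda>n. \<theta> n < 1) sequentially"
    by (intro order_tendstoD[where y = "A * (0 + 0) / c"]) simp_all
  then obtain N where N: "\<And>n. n \<ge> N \<Longrightarrow> \<theta> n < 1"
    by (auto simp: eventually_sequentially)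
  obtain M where M: "P N M" using ex by blast
  have "P (N + k) M" for k
  proof (induction k)
    case (Suc k)
    have "max 1 (\<theta> (Suc (N + k))) = 1" using N[of "Suc (N + k)"] by simp
    with step[OF Suc] show ?case by simp
  qed (use M in simp)
  then have "gevrey_le s H (\<lambda>_. M) w"
    unfolding gevrey_le_def P_def by (metis le_add2)
  then show "\<exists>C. gevrey_le s H (\<lambda>_. C) (\<lambda>x. inverse (q x))" by (auto simp: w_def)
qed

subsection \<open>Gelfand--Shilov spaces through exponential weights\<close>

definition gs_weight :: "real \<Rightarrow> real \<Rightarrow> real ^ 'n::finite \<Rightarrow> real" where
  "gs_weight t r x = exp (- r * norm x powr (1 / t))"

lemma gs_weight_pos [simp]: "gs_weight t r x > 0"
  by (simp add: gs_weight_def)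

lemma gs_weight_nonneg [simp]: "gs_weight t r x \<ge> 0"
  by (simp add: gs_weight_def)

lemma gs_weight_le_1: "0 \<le> r \<Longrightarrow> gs_weight t r x \<le> 1"
  by (simp add: gs_weight_def)

lemma powr_add_le:
  fixes a b p :: real
  assumes "0 \<le> a" "0 \<le> b" "0 \<le> p"
  shows "(a + b) powr p \<le> 2 powr p * (a powr p + b powr p)"
proof -
  have "(a + b) powr p \<le> (2 * max a b) powr p"
    using assms by (intro powr_mono2) auto
  also have "\<dots> = 2 powr p * max a b powr p" using assms by (simp add: powr_mult)
  also have "\<dots> \<le> 2 powr p * (a powr p + b powr p)"
    by (intro mult_left_mono) (auto simp: max_def)
  finally show ?thesis .
qed

lemma gs_weight_diff_le:
  assumes "0 < t" "0 \<le> r"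
  shows "gs_weight t r (y - x) \<le> exp (r * norm x powr (1 / t)) * gs_weight t (r / 2 powr (1 / t)) y"
proof -
  have "norm y powr (1 / t) \<le> (norm (y - x) + norm x) powr (1 / t)"
    using assms norm_triangle_ineq[of "y - x" x] by (intro powr_mono2) auto
  also have "\<dots> \<le> 2 powr (1 / t) * (norm (y - x) powr (1 / t) + norm x powr (1 / t))"
    using assms by (intro powr_add_le) auto
  finally have "norm y powr (1 / t) / 2 powr (1 / t) \<le> norm (y - x) powr (1 / t) + norm x powr (1 / t)"
    by (simp add: field_simps)
  then have "r * (norm y powr (1 / t) / 2 powr (1 / t)) \<le> r * (norm (y - x) powr (1 / t) + norm x powr (1 / t))"
    using assms by (intro mult_left_mono)
  then show ?thesis
    by (simp add: gs_weight_def exp_add[symmetric] algebra_simps)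
qed

lemma norm_le_card_component:
  obtains i where "norm (x :: real ^ 'n::finite) \<le> real CARD('n) * \<bar>x $ i\<bar>"
proof -
  obtain i where i: "\<bar>x $ i\<bar> = Max (range (\<lambda>i. \<bar>x $ i\<bar>))"
    using Max_in[of "range (\<lambda>i. \<bar>x $ i\<bar>)"] by (metis UNIV_not_empty finite_class.finite_UNIV finite_imageI image_is_empty rangeE)
  have "norm x \<le> (\<Sum>j\<in>UNIV. \<bar>x $ j\<bar>)" by (rule norm_le_l1_cart)
  also have "\<dots> \<le> (\<Sum>j\<in>(UNIV :: 'n set). \<bar>x $ i\<bar>)"
    by (rule sum_mono) (simp add: i)
  finally have "norm x \<le> real CARD('n) * \<bar>x $ i\<bar>" by simp
  then show ?thesis by (rule that)
qed

lemma abs_mi_monom_le: "\<bar>mi_monom x \<alpha>\<bar> \<le> norm (x :: real ^ 'n::finite) ^ mi_order \<alpha>"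
proof -
  have "\<bar>mi_monom x \<alpha>\<bar> = (\<Prod>i\<in>UNIV. \<bar>x $ i\<bar> ^ (\<alpha> $ i))"
    by (simp add: mi_monom_def abs_prod power_abs)
  also have "\<dots> \<le> (\<Prod>i\<in>UNIV. norm x ^ (\<alpha> $ i))"
    by (intro prod_mono) (auto intro!: power_mono component_le_norm_cart)
  finally show ?thesis by (simp add: mi_order_def power_sum)
qed

lemma cmod_mi_D: "cmod (mi_D \<beta> f x) = cmod (mi_deriv \<beta> f x)"
  by (simp add: mi_D_def norm_mult norm_power)

lemma GS_seminorm_lessD:
  assumes "GS_seminorm t s h f < \<infinity>" "h > 0"
  obtains C where "C \<ge> 0" "\<And>\<alpha> \<beta> x. \<bar>mi_monom x \<alpha>\<bar> * cmod (mi_deriv \<beta> f x) \<le>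
    C * (h ^ mi_order (\<alpha> + \<beta>) * mi_fact \<alpha> powr t * mi_fact \<beta> powr s)"
proof -
  obtain C where C: "GS_seminorm t s h f = ennreal C" "C \<ge> 0"
    using assms(1) by (cases "GS_seminorm t s h f") auto
  have "\<bar>mi_monom x \<alpha>\<bar> * cmod (mi_deriv \<beta> f x) \<le>
    C * (h ^ mi_order (\<alpha> + \<beta>) * mi_fact \<alpha> powr t * mi_fact \<beta> powr s)" for \<alpha> \<beta> x
  proof -
    have pos: "h ^ mi_order (\<alpha> + \<beta>) * mi_fact \<alpha> powr t * mi_fact \<beta> powr s > 0"
      using assms(2) mi_fact_ge_1[of \<alpha>] mi_fact_ge_1[of \<beta>] by simp
    have "ennreal (cmod (mi_monom x \<alpha> * mi_D \<beta> f x) /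
        (h ^ mi_order (\<alpha> + \<beta>) * mi_fact \<alpha> powr t * mi_fact \<beta> powr s)) \<le> ennreal C"
      unfolding C(1)[symmetric] GS_seminorm_def by (intro SUP_upper2[OF UNIV_I]) (rule order_refl)
    then have "cmod (mi_monom x \<alpha> * mi_D \<beta> f x) /
        (h ^ mi_order (\<alpha> + \<beta>) * mi_fact \<alpha> powr t * mi_fact \<beta> powr s) \<le> C"
      using C(2) by (simp add: ennreal_le_iff)
    then show ?thesis using pos
      by (simp add: divide_le_eq norm_mult cmod_mi_D)
  qed
  with C(2) show ?thesis using that by blast
qed

lemma GS_space_smooth: "f \<in> GS_space t s \<Longrightarrow> smooth_fun f"
  by (simp add: GS_space_def)

lemma GS_space_weightE:
  fixes f :: "real ^ 'n::finite \<Rightarrow> complex"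
  assumes "f \<in> GS_space t s" "0 < t" "0 < s" "0 < h" "0 < r"
  obtains C where "C > 0" "gevrey_le s h (\<lambda>x. C * gs_weight t r x) f"
proof -
  define d where "d = real CARD('n)"
  have d: "d \<ge> 1" using one_le_card_finite[where 'a='n] by (simp add: d_def)
  define hE where "hE = (t / (2 * r)) powr t"
  have hE: "hE > 0" using assms by (simp add: hE_def)
  define k where "k = min h (hE / d)"
  have k: "k > 0" "k \<le> h" "d * k \<le> hE"
    using assms hE d by (auto simp: k_def min_def field_simps)
  obtain C where C: "C \<ge> 0" and le: "\<And>\<alpha> \<beta> x. \<bar>mi_monom x \<alpha>\<bar> * cmod (mi_deriv \<beta> f x) \<le>
    C * (k ^ mi_order (\<alpha> + \<beta>) * mi_fact \<alpha> powr t * mi_fact \<beta> powr s)"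
    using GS_seminorm_lessD[of t s k f] assms k by (auto simp: GS_space_def)
  have "cmod (iter_partial js f x) \<le> (2 powr t * C) * gs_weight t r x * h ^ length js * fact (length js) powr s" for js x
  proof -
    obtain \<beta> where \<beta>: "mi_order \<beta> = length js" "iter_partial js f = mi_deriv \<beta> f"
      using iter_partial_eq_mi_deriv[OF GS_space_smooth[OF assms(1)]] by metis
    obtain i where i: "norm x \<le> d * \<bar>x $ i\<bar>"
      using norm_le_card_component d_def by metis
    define N where "N = length js"
    have "cmod (iter_partial js f x) * exp (r * norm x powr (1 / t)) \<le> 2 powr t * (C * k ^ N * fact N powr s)"
    proof (rule moments_imp_exp_decay)
      fix m
      define \<alpha> :: "nat ^ 'n" where "\<alpha> = (\<chi> j. if j = i then m else 0)"
      have \<alpha>: "mi_order \<alpha> = m" "mi_fact \<alpha> = fact m" "mi_monom x \<alpha> = (x $ i) ^ m"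
        by (auto simp: mi_order_def mi_fact_def mi_monom_def \<alpha>_def if_distrib[of fact]
            if_distrib[of "\<lambda>n. _ ^ n"] prod.delta cong: if_cong)
      have ord: "mi_order (\<alpha> + \<beta>) = m + N"
        using \<alpha>(1) \<beta>(1) by (simp add: mi_order_def sum.distrib N_def)
      have "norm x ^ m \<le> d ^ m * \<bar>x $ i\<bar> ^ m"
        using power_mono[OF i, of m] by (simp add: power_mult_distrib)
      then have "cmod (iter_partial js f x) * norm x ^ m \<le>
          cmod (iter_partial js f x) * (d ^ m * \<bar>x $ i\<bar> ^ m)"
        by (intro mult_left_mono) auto
      also have "\<dots> = d ^ m * (\<bar>mi_monom x \<alpha>\<bar> * cmod (mi_deriv \<beta> f x))"
        by (simp add: \<alpha> \<beta> power_abs)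
      also have "\<dots> \<le> d ^ m * (C * (k ^ (m + N) * fact m powr t * mi_fact \<beta> powr s))"
        using le[of x \<alpha> \<beta>] d by (intro mult_left_mono) (auto simp: ord \<alpha>)
      also have "\<dots> \<le> d ^ m * (C * (k ^ (m + N) * fact m powr t * fact N powr s))"
        using mi_fact_le_fact_order[of \<beta>] mi_fact_ge_1[of \<beta>] \<beta> assms d C k
        by (intro mult_left_mono powr_mono2) (auto simp: N_def)
      also have "\<dots> = (C * k ^ N * fact N powr s) * (d * k) ^ m * fact m powr t"
        by (simp add: power_add power_mult_distrib mult_ac)
      also have "\<dots> \<le> (C * k ^ N * fact N powr s) * hE ^ m * fact m powr t"
        using k d C by (intro mult_left_mono mult_right_mono power_mono) auto
      finally show "cmod (iter_partial js f x) * norm x ^ m \<le>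
        (C * k ^ N * fact N powr s) * ((t / (2 * r)) powr t) ^ m * fact m powr t"
        by (simp add: hE_def)
    qed (use assms C k in auto)
    also have "\<dots> \<le> 2 powr t * (C * h ^ N * fact N powr s)"
      using C k by (intro mult_left_mono mult_right_mono power_mono) auto
    finally have "cmod (iter_partial js f x) * exp (r * norm x powr (1 / t)) * gs_weight t r x \<le>
       2 powr t * (C * h ^ N * fact N powr s) * gs_weight t r x"
      by (intro mult_right_mono) (auto intro: less_imp_le)
    moreover have "cmod (iter_partial js f x) * exp (r * norm x powr (1 / t)) * gs_weight t r x =
        cmod (iter_partial js f x)"
      by (simp add: gs_weight_def mult.assoc exp_add[symmetric])
    ultimately show ?thesis by (simp only: N_def mult_ac)
  qed
  then have g: "gevrey_le s h (\<lambda>x. (2 powr t * C) * gs_weight t r x) f"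
    by (simp add: gevrey_le_def)
  have "gevrey_le s h (\<lambda>x. (2 powr t * C + 1) * gs_weight t r x) f"
    by (rule gevrey_le_mono[OF g]) (use assms in \<open>auto simp: algebra_simps intro: less_imp_le\<close>)
  moreover have "2 powr t * C + 1 > 0" using C by (simp add: add_nonneg_pos)
  ultimately show ?thesis using that by blast
qed

lemma GS_seminorm_le:
  fixes f :: "real ^ 'n::finite \<Rightarrow> complex"
  assumes "0 < t" "0 < s" "0 < h"
  obtains k r where "0 < k" "0 < r"
    "\<And>(f :: real ^ 'n \<Rightarrow> complex) C. smooth_fun f \<Longrightarrow> gevrey_le s k (\<lambda>x. C * gs_weight t r x) f \<Longrightarrow>
       GS_seminorm t s h f \<le> ennreal C"
proof -
  define d where "d = real CARD('n)"
  have d: "d \<ge> 1" using one_le_card_finite[where 'a='n] by (simp add: d_def)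
  define k l r where "k = h / d powr s" and "l = h / d powr t" and "r = t * (1 / l) powr (1 / t)"
  have pos: "k > 0" "l > 0" "r > 0" using assms d by (auto simp: k_def l_def r_def)
  have "GS_seminorm t s h f \<le> ennreal C"
    if f: "smooth_fun f" "gevrey_le s k (\<lambda>x. C * gs_weight t r x) f" for f :: "real ^ 'n \<Rightarrow> complex" and C
    unfolding GS_seminorm_def
  proof (intro SUP_least ennreal_leI)
    fix \<alpha> \<beta> :: "nat ^ 'n" and x :: "real ^ 'n"
    have C: "C \<ge> 0" using gevrey_le_nonneg[OF f(2), of 0] using gs_weight_pos[of t r "0 :: real ^ 'n"] by (simp add: zero_le_mult_iff)
    obtain js :: "'n list" where js: "length js = mi_order \<beta>" "mi_deriv \<beta> f = iter_partial js f"
      using mi_deriv_eq_some_iter_partial[OF f(1)] by metis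
    define m N where "m = mi_order \<alpha>" and "N = mi_order \<beta>"
    have fp: "fact (mi_order \<alpha>) powr p \<le> (d powr p) ^ mi_order \<alpha> * mi_fact \<alpha> powr p" if "p > 0" for p and \<alpha> :: "nat ^ 'n"
    proof -
      have "fact (mi_order \<alpha>) powr p \<le> (d ^ mi_order \<alpha> * mi_fact \<alpha>) powr p"
        using fact_order_le_mi_fact[of \<alpha>] that by (intro powr_mono2) (auto simp: d_def)
      also have "\<dots> = (d powr p) ^ mi_order \<alpha> * mi_fact \<alpha> powr p"
        using d mi_fact_ge_1[of \<alpha>] by (simp add: powr_mult powr_power powr_realpow[symmetric] powr_powr mult.commute)
      finally show ?thesis .
    qed
    have X: "norm x ^ m \<le> l ^ m * fact m powr t * exp (r * norm x powr (1 / t))"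
    proof -
      have "(norm x / l) ^ m \<le> fact m powr t * exp (t * (norm x / l) powr (1 / t))"
        using pos assms by (intro power_le_fact_powr_exp) auto
      also have "t * (norm x / l) powr (1 / t) = r * norm x powr (1 / t)"
        using pos by (simp add: r_def powr_divide)
      finally show ?thesis using pos by (simp add: power_divide field_simps)
    qed
    have "cmod (mi_monom x \<alpha> * mi_D \<beta> f x) = \<bar>mi_monom x \<alpha>\<bar> * cmod (iter_partial js f x)"
      by (simp add: norm_mult cmod_mi_D js)
    also have "\<dots> \<le> norm x ^ m * (C * gs_weight t r x * k ^ N * fact N powr s)"
      using gevrey_leD[OF f(2), of js x] abs_mi_monom_le[of x \<alpha>]
      by (intro mult_mono) (auto simp: m_def N_def js)
    also have "\<dots> \<le> (l ^ m * fact m powr t * exp (r * norm x powr (1 / t))) * (C * gs_weight t r x * k ^ N * fact N powr s)"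
      using X C pos by (intro mult_right_mono) (auto intro: less_imp_le)
    also have "\<dots> = C * l ^ m * k ^ N * fact m powr t * fact N powr s * (exp (r * norm x powr (1 / t)) * gs_weight t r x)"
      by (simp add: mult_ac)
    also have "exp (r * norm x powr (1 / t)) * gs_weight t r x = 1"
      by (simp add: gs_weight_def exp_add[symmetric])
    also have "C * l ^ m * k ^ N * fact m powr t * fact N powr s * 1 \<le>
       C * l ^ m * k ^ N * ((d powr t) ^ m * mi_fact \<alpha> powr t) * ((d powr s) ^ N * mi_fact \<beta> powr s)"
      using fp[OF assms(1), of \<alpha>] fp[OF assms(2), of \<beta>] C pos
      by (simp only: mult_1_right, intro mult_mono) (auto simp: m_def N_def)
    also have "\<dots> = C * (l * d powr t) ^ m * (k * d powr s) ^ N * mi_fact \<alpha> powr t * mi_fact \<beta> powr s"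
      by (simp add: power_mult_distrib mult_ac)
    also have "\<dots> = C * (h ^ mi_order (\<alpha> + \<beta>) * mi_fact \<alpha> powr t * mi_fact \<beta> powr s)"
      using d by (simp add: l_def k_def mi_order_def sum.distrib power_add m_def N_def)
    finally show "cmod (mi_monom x \<alpha> * mi_D \<beta> f x) /
       (h ^ mi_order (\<alpha> + \<beta>) * mi_fact \<alpha> powr t * mi_fact \<beta> powr s) \<le> C"
      using assms mi_fact_ge_1[of \<alpha>] mi_fact_ge_1[of \<beta>] by (simp add: divide_le_eq)
  qed
  with pos show ?thesis using that by blast
qed

lemma GS_spaceI:
  fixes f :: "real ^ 'n::finite \<Rightarrow> complex"
  assumes "0 < t" "0 < s" "smooth_fun f"
    and "\<And>h r. 0 < h \<Longrightarrow> 0 < r \<Longrightarrow> \<exists>C. gevrey_le s h (\<lambda>x. C * gs_weight t r x) f"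
  shows "f \<in> GS_space t s"
proof -
  have "GS_seminorm t s h f < \<infinity>" if h: "h > 0" for h
  proof -
    obtain k r where "0 < k" "0 < r" and le: "\<And>(f :: real ^ 'n \<Rightarrow> complex) C. smooth_fun f \<Longrightarrow>
       gevrey_le s k (\<lambda>x. C * gs_weight t r x) f \<Longrightarrow> GS_seminorm t s h f \<le> ennreal C"
      using GS_seminorm_le[OF assms(1,2) h] by blast
    then obtain C where "gevrey_le s k (\<lambda>x. C * gs_weight t r x) f" using assms(4) by blast
    from le[OF assms(3) this] show ?thesis by (rule order_le_less_trans) simp
  qed
  with assms(3) show ?thesis by (simp add: GS_space_def)
qed

lemma GS_space_gevrey_bdd:
  assumes "f \<in> GS_space t s" "0 < t" "0 < s"
  shows "gevrey_bdd s f"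
  unfolding gevrey_bdd_def
proof (intro conjI allI impI)
  fix h :: real assume h: "h > 0"
  obtain C where C: "C > 0" "gevrey_le s h (\<lambda>x. C * gs_weight t 1 x) f"
    using GS_space_weightE[OF assms h, of 1] by auto
  have "gevrey_le s h (\<lambda>_. C) f"
    by (rule gevrey_le_mono[OF C(2) h order_refl]) (use C gs_weight_le_1[of 1 t] in auto)
  then show "\<exists>C. gevrey_le s h (\<lambda>_. C) f" by blast
qed (rule GS_space_smooth[OF assms(1)])

lemma GS_space_mult:
  assumes "f \<in> GS_space t s" "gevrey_bdd s g" "0 < t" "1 \<le> s"
  shows "(\<lambda>x. f x * g x) \<in> GS_space t s"
proof (rule GS_spaceI)
  have sm: "smooth_fun f" "smooth_fun g" using assms GS_space_smooth gevrey_bdd_smooth by blast+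
  show "smooth_fun (\<lambda>x. f x * g x)" by (intro smooth_mult sm)
  fix h r :: real assume "h > 0" "r > 0"
  obtain C where C: "gevrey_le s (h/2) (\<lambda>x. C * gs_weight t r x) f"
    using GS_space_weightE[OF assms(1), of "h/2" r] assms \<open>h > 0\<close> \<open>r > 0\<close> by auto
  obtain D where D: "gevrey_le s (h/2) (\<lambda>_. D) g"
    using gevrey_bddD[OF assms(2), of "h/2"] \<open>h > 0\<close> by auto
  have "gevrey_le s (2 * (h/2)) (\<lambda>x. C * gs_weight t r x * D) (\<lambda>x. f x * g x)"
    by (rule gevrey_le_mult[OF sm C D]) (use assms \<open>h > 0\<close> in auto)
  then show "\<exists>C. gevrey_le s h (\<lambda>x. C * gs_weight t r x) (\<lambda>x. f x * g x)"
    by (intro exI[of _ "C * D"]) (simp add: mult_ac)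
qed (use assms in auto)

lemma GS_space_lincomb:
  assumes "f \<in> GS_space t s" "g \<in> GS_space t s" "0 < t" "0 < s"
  shows "(\<lambda>x. a * f x + b * g x) \<in> GS_space t s"
proof (rule GS_spaceI)
  have sm: "smooth_fun f" "smooth_fun g" using assms GS_space_smooth by blast+
  show "smooth_fun (\<lambda>x. a * f x + b * g x)" by (intro smooth_lincomb sm)
  fix h r :: real assume hr: "h > 0" "r > 0"
  obtain C where C: "gevrey_le s h (\<lambda>x. C * gs_weight t r x) f"
    using GS_space_weightE[OF assms(1,3,4) hr] by auto
  obtain D where D: "gevrey_le s h (\<lambda>x. D * gs_weight t r x) g"
    using GS_space_weightE[OF assms(2,3,4) hr] by auto
  show "\<exists>C. gevrey_le s h (\<lambda>x. C * gs_weight t r x) (\<lambda>x. a * f x + b * g x)"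
    using gevrey_le_lincomb[OF sm C D, of a b]
    by (intro exI[of _ "cmod a * C + cmod b * D"]) (simp add: algebra_simps)
qed (use assms in auto)

lemma GS_space_translate:
  fixes f :: "real ^ 'n::finite \<Rightarrow> complex"
  assumes "f \<in> GS_space t s" "0 < t" "0 < s"
  shows "translate_fun x f \<in> GS_space t s"
proof (rule GS_spaceI)
  have eq: "translate_fun x f = (\<lambda>y. f (1 *\<^sub>R y + (- x)))" by (simp add: translate_fun_def)
  have sm: "smooth_fun f" using assms GS_space_smooth by blast
  show "smooth_fun (translate_fun x f)" unfolding eq by (rule smooth_affine[OF sm])
  fix h r :: real assume hr: "h > 0" "r > 0"
  define r' where "r' = r * 2 powr (1 / t)"
  obtain C where C: "C > 0" "gevrey_le s h (\<lambda>x. C * gs_weight t r' x) f"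
    using GS_space_weightE[OF assms hr(1), of r'] hr r'_def by auto
  have "gevrey_le s h (\<lambda>y. C * gs_weight t r' (y - x)) (translate_fun x f)"
    using gevrey_le_affine[OF sm C(2), of 1 h "- x"] hr by (simp add: eq)
  then have "gevrey_le s h (\<lambda>y. C * exp (r' * norm x powr (1 / t)) * gs_weight t r y) (translate_fun x f)"
  proof (rule gevrey_le_mono[OF _ hr(1) order_refl])
    fix y
    show "C * gs_weight t r' (y - x) \<le> C * exp (r' * norm x powr (1 / t)) * gs_weight t r y"
      using gs_weight_diff_le[of t r' y x] C hr assms by (simp add: r'_def)
  qed
  then show "\<exists>C. gevrey_le s h (\<lambda>x. C * gs_weight t r x) (translate_fun x f)" by blast
qed (use assms in auto)

subsection \<open>Compactly supported Gevrey functions\<close>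

lemma Gevrey_cI:
  fixes f :: "real ^ 'n::finite \<Rightarrow> complex"
  assumes "gevrey_bdd s f" "compact (fun_supp f)" "0 < s"
  shows "f \<in> Gevrey_c s"
proof -
  define d where "d = real CARD('n)"
  have d: "d \<ge> 1" using one_le_card_finite[where 'a='n] by (simp add: d_def)
  have sm: "smooth_fun f" by (rule gevrey_bdd_smooth[OF assms(1)])
  have "\<exists>C>0. \<forall>x\<in>K. \<forall>\<alpha>. cmod (mi_deriv \<alpha> f x) \<le> C * h ^ mi_order \<alpha> * mi_fact \<alpha> powr s" if h: "h > 0" for K h
  proof -
    obtain C where C: "C > 0" "gevrey_le s (h / d powr s) (\<lambda>_. C) f"
      using gevrey_bddD[OF assms(1), of "h / d powr s"] h d by auto
    have "cmod (mi_deriv \<alpha> f x) \<le> C * h ^ mi_order \<alpha> * mi_fact \<alpha> powr s" for \<alpha> x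
    proof -
      obtain js :: "'n list" where js: "length js = mi_order \<alpha>" "mi_deriv \<alpha> f = iter_partial js f"
        using mi_deriv_eq_some_iter_partial[OF sm] by metis
      have "fact (mi_order \<alpha>) powr s \<le> (d ^ mi_order \<alpha> * mi_fact \<alpha>) powr s"
        using fact_order_le_mi_fact[of \<alpha>] assms by (intro powr_mono2) (auto simp: d_def)
      also have "\<dots> = (d powr s) ^ mi_order \<alpha> * mi_fact \<alpha> powr s"
        using d mi_fact_ge_1[of \<alpha>] by (simp add: powr_mult powr_power powr_realpow[symmetric] powr_powr mult.commute)
      finally have "C * (h / d powr s) ^ mi_order \<alpha> * fact (mi_order \<alpha>) powr s \<le>
         C * (h / d powr s) ^ mi_order \<alpha> * ((d powr s) ^ mi_order \<alpha> * mi_fact \<alpha> powr s)"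
        using C h d by (intro mult_left_mono) auto
      also have "\<dots> = C * h ^ mi_order \<alpha> * mi_fact \<alpha> powr s"
        using d by (simp add: power_divide)
      finally show ?thesis using gevrey_leD[OF C(2), of js x] js by simp
    qed
    with C(1) show ?thesis by blast
  qed
  with sm assms(2) show ?thesis by (simp add: Gevrey_c_def Gevrey_def)
qed

lemma Gevrey_c_gevrey_bdd:
  fixes f :: "real ^ 'n::finite \<Rightarrow> complex"
  assumes "f \<in> Gevrey_c s" "0 < s"
  shows "gevrey_bdd s f"
proof -
  have sm: "smooth_fun f" and K: "compact (fun_supp f)"
    using assms by (auto simp: Gevrey_c_def Gevrey_def)
  show ?thesis unfolding gevrey_bdd_def
  proof (intro conjI allI impI)
    fix h :: real assume "h > 0"
    have "\<And>K h. compact K \<Longrightarrow> h > 0 \<Longrightarrow>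
        \<exists>C>0. \<forall>x\<in>K. \<forall>\<alpha>. cmod (mi_deriv \<alpha> f x) \<le> C * h ^ mi_order \<alpha> * mi_fact \<alpha> powr s"
      using assms(1) by (simp add: Gevrey_c_def Gevrey_def)
    from this[OF K \<open>h > 0\<close>] obtain C where C: "C > 0" "\<And>x \<alpha>. x \<in> fun_supp f \<Longrightarrow>
        cmod (mi_deriv \<alpha> f x) \<le> C * h ^ mi_order \<alpha> * mi_fact \<alpha> powr s"
      by auto
    have "cmod (iter_partial js f x) \<le> C * h ^ length js * fact (length js) powr s" for js x
    proof (cases "x \<in> fun_supp f")
      case True
      obtain \<beta> where \<beta>: "mi_order \<beta> = length js" "iter_partial js f = mi_deriv \<beta> f"
        using iter_partial_eq_mi_deriv[OF sm] by metis
      have "cmod (iter_partial js f x) \<le> C * h ^ mi_order \<beta> * mi_fact \<beta> powr s"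
        using C(2)[OF True, of \<beta>] \<beta>(2) by simp
      also have "\<dots> \<le> C * h ^ length js * fact (length js) powr s"
        using mi_fact_le_fact_order[of \<beta>] mi_fact_ge_1[of \<beta>] \<beta> assms C \<open>h > 0\<close>
        by (simp, intro mult_left_mono powr_mono2) auto
      finally show ?thesis .
    next
      case False
      then show ?thesis using C \<open>h > 0\<close> by (simp add: iter_partial_eq_0_outside_supp)
    qed
    then show "\<exists>C. gevrey_le s h (\<lambda>_. C) f" unfolding gevrey_le_def by blast
  qed (rule sm)
qed

lemma Gevrey_c_supp: "f \<in> Gevrey_c s \<Longrightarrow> compact (fun_supp f)"
  by (simp add: Gevrey_c_def)

lemma fun_supp_subset_closed: "closed S \<Longrightarrow> (\<And>x. f x \<noteq> 0 \<Longrightarrow> x \<in> S) \<Longrightarrow> fun_supp f \<subseteq> S"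
  unfolding fun_supp_def by (rule closure_minimal) auto

lemma closed_fun_supp: "closed (fun_supp f)"
  by (simp add: fun_supp_def)

lemma in_fun_supp: "f x \<noteq> 0 \<Longrightarrow> x \<in> fun_supp f"
  unfolding fun_supp_def using closure_subset[of "{x. f x \<noteq> 0}"] by auto

lemma fun_supp_mono: "(\<And>x. g x = 0 \<Longrightarrow> f x = 0) \<Longrightarrow> fun_supp f \<subseteq> fun_supp g"
  by (rule fun_supp_subset_closed[OF closed_fun_supp]) (use in_fun_supp in blast)

lemma compact_fun_supp: "compact K \<Longrightarrow> fun_supp f \<subseteq> K \<Longrightarrow> compact (fun_supp f)"
  using compact_Int_closed[of K "fun_supp f"] by (simp add: fun_supp_def Int_absorb1)

lemma compact_fun_supp_mono:
  "compact (fun_supp g) \<Longrightarrow> (\<And>x. g x = 0 \<Longrightarrow> f x = 0) \<Longrightarrow> compact (fun_supp f)"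
  using compact_fun_supp fun_supp_mono by metis

lemma Gevrey_c_mult:
  assumes "f \<in> Gevrey_c s" "gevrey_bdd s g" "1 \<le> s"
  shows "(\<lambda>x. f x * g x) \<in> Gevrey_c s"
proof (rule Gevrey_cI)
  show "gevrey_bdd s (\<lambda>x. f x * g x)"
    using assms by (intro gevrey_bdd_mult[OF Gevrey_c_gevrey_bdd[OF assms(1)]]) auto
  show "compact (fun_supp (\<lambda>x. f x * g x))"
    by (rule compact_fun_supp_mono[OF Gevrey_c_supp[OF assms(1)]]) auto
qed (use assms in auto)

lemma Gevrey_c_lincomb:
  assumes "f \<in> Gevrey_c s" "g \<in> Gevrey_c s" "0 < s"
  shows "(\<lambda>x. a * f x + b * g x) \<in> Gevrey_c s"
proof (rule Gevrey_cI)
  show "gevrey_bdd s (\<lambda>x. a * f x + b * g x)"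
    using assms by (intro gevrey_bdd_lincomb Gevrey_c_gevrey_bdd) auto
  have "fun_supp (\<lambda>x. a * f x + b * g x) \<subseteq> fun_supp f \<union> fun_supp g"
  proof (rule fun_supp_subset_closed)
    fix x assume "a * f x + b * g x \<noteq> 0"
    then have "f x \<noteq> 0 \<or> g x \<noteq> 0" by auto
    then show "x \<in> fun_supp f \<union> fun_supp g" using in_fun_supp by blast
  qed (intro closed_Un closed_fun_supp)
  moreover have "compact (fun_supp f \<union> fun_supp g)"
    using assms Gevrey_c_supp by blast
  ultimately show "compact (fun_supp (\<lambda>x. a * f x + b * g x))"
    using compact_fun_supp by blast
qed (use assms in auto)

lemma Gevrey_c_cnj:
  assumes "f \<in> Gevrey_c s" "0 < s" shows "(\<lambda>x. cnj (f x)) \<in> Gevrey_c s"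
proof (rule Gevrey_cI)
  show "gevrey_bdd s (\<lambda>x. cnj (f x))"
    using assms by (intro gevrey_bdd_cnj Gevrey_c_gevrey_bdd) auto
  show "compact (fun_supp (\<lambda>x. cnj (f x)))"
    by (rule compact_fun_supp_mono[OF Gevrey_c_supp[OF assms(1)]]) auto
qed (use assms in auto)

lemma Gevrey_c_ball:
  assumes "f \<in> Gevrey_c s"
  obtains R where "R > 0" "fun_supp f \<subseteq> cball 0 R"
proof -
  obtain b where "\<forall>x\<in>fun_supp f. norm x \<le> b"
    using compact_imp_bounded[OF Gevrey_c_supp[OF assms]] bounded_iff by blast
  then have "fun_supp f \<subseteq> cball 0 (max b 1)" by auto
  then show ?thesis using that[of "max b 1"] by simp
qed

lemma gevrey_le_weight_of_supp:
  assumes "gevrey_le s h (\<lambda>_. C) f" "fun_supp f \<subseteq> cball 0 R" "0 < h" "0 < t" "0 < r" "0 \<le> R"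
  shows "gevrey_le s h (\<lambda>x. C * exp (r * R powr (1 / t)) * gs_weight t r x) f"
  unfolding gevrey_le_def
proof (intro allI)
  fix js x
  have C: "C \<ge> 0" using gevrey_le_nonneg[OF assms(1)] by blast
  show "cmod (iter_partial js f x) \<le> C * exp (r * R powr (1 / t)) * gs_weight t r x * h ^ length js * fact (length js) powr s"
  proof (cases "x \<in> fun_supp f")
    case True
    then have "norm x \<le> R" using assms(2) by auto
    then have "norm x powr (1 / t) \<le> R powr (1 / t)" using assms by (intro powr_mono2) auto
    then have "exp 0 \<le> exp (r * R powr (1 / t) + (- r * norm x powr (1 / t)))"
      using assms by simp
    then have "1 \<le> exp (r * R powr (1 / t)) * gs_weight t r x"
      unfolding gs_weight_def exp_add by simp
    then have "C * 1 \<le> C * (exp (r * R powr (1 / t)) * gs_weight t r x)"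
      using C by (intro mult_left_mono)
    then have "C * h ^ length js * fact (length js) powr s \<le>
      C * exp (r * R powr (1 / t)) * gs_weight t r x * h ^ length js * fact (length js) powr s"
      using assms by (intro mult_right_mono) (auto simp: mult.assoc)
    with gevrey_leD[OF assms(1)] show ?thesis using order_trans by blast
  next
    case False
    then show ?thesis using C assms by (simp add: iter_partial_eq_0_outside_supp)
  qed
qed

lemma Gevrey_c_subset_GS:
  assumes "f \<in> Gevrey_c s" "0 < s" "0 < t"
  shows "f \<in> GS_space t s"
proof (rule GS_spaceI)
  have b: "gevrey_bdd s f" by (rule Gevrey_c_gevrey_bdd) (use assms in auto)
  then show "smooth_fun f" by (rule gevrey_bdd_smooth)
  fix h r :: real assume hr: "h > 0" "r > 0"
  obtain R where "R > 0" "fun_supp f \<subseteq> cball 0 R" using Gevrey_c_ball[OF assms(1)] .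
  moreover obtain C where "gevrey_le s h (\<lambda>_. C) f" using b hr unfolding gevrey_bdd_def by blast
  ultimately show "\<exists>C. gevrey_le s h (\<lambda>x. C * gs_weight t r x) f"
    using gevrey_le_weight_of_supp[of s h C f R t r] hr assms by (meson less_imp_le)
qed (use assms in auto)

subsection \<open>Exponentials\<close>

definition expi :: "real ^ 'n::finite \<Rightarrow> real ^ 'n \<Rightarrow> complex" where
  "expi \<xi> = (\<lambda>y. exp (\<i> * of_real (y \<bullet> \<xi>)))"

lemma cmod_expi [simp]: "cmod (expi \<xi> y) = 1"
  by (simp add: expi_def)

lemma expi_add: "expi (\<xi> + \<eta>) y = expi \<xi> y * expi \<eta> y"
  by (simp add: expi_def inner_add_right algebra_simps exp_add)

lemma cnj_expi: "cnj (expi \<xi> y) = expi (- \<xi>) y"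
  by (simp add: expi_def exp_cnj)

lemma expi_0 [simp]: "expi 0 = (\<lambda>y. 1)"
  by (simp add: expi_def)

lemma expi_has_derivative:
  "(expi \<xi> has_derivative (\<lambda>v. \<i> * of_real (v \<bullet> \<xi>) * expi \<xi> y)) (at y)"
proof -
  have "((\<lambda>y. \<i> * of_real (y \<bullet> \<xi>)) has_derivative (\<lambda>v. \<i> * of_real (v \<bullet> \<xi>))) (at y)"
    by (auto intro!: derivative_eq_intros)
  from has_derivative_compose[OF this DERIV_exp[unfolded has_field_derivative_def]]
  show ?thesis by (simp add: expi_def mult.commute)
qed

lemma differentiable_expi: "expi \<xi> differentiable (at y)"
  using expi_has_derivative unfolding differentiable_def by blast

lemma partial_d_expi: "partial_d i (expi \<xi>) = (\<lambda>y. \<i> * of_real (\<xi> $ i) * expi \<xi> y)"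
  by (rule ext) (simp add: has_derivative_imp_partial_d[OF expi_has_derivative] inner_axis')

lemma smooth_expi: "smooth_fun (expi \<xi>)"
proof -
  have "smooth_upto n (expi \<xi>)" for n
  proof (induction n)
    case (Suc n)
    have "smooth_upto n (\<lambda>y. \<i> * of_real (\<xi> $ i) * expi \<xi> y)" for i
      using Suc by (intro smooth_upto_mult smooth_upto_const)
    then show ?case by (simp add: partial_d_expi differentiable_expi)
  qed (simp add: differentiable_expi)
  then show ?thesis by (simp add: smooth_fun_iff)
qed

lemma iter_partial_expi:
  "iter_partial js (expi \<xi>) = (\<lambda>y. (\<Prod>j\<leftarrow>js. \<i> * of_real (\<xi> $ j)) * expi \<xi> y)"
proof (induction js)
  case (Cons i js)
  have "partial_d i (\<lambda>y. (\<Prod>j\<leftarrow>js. \<i> * of_real (\<xi> $ j)) * expi \<xi> y + 0 * expi \<xi> y) =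
    (\<lambda>y. (\<Prod>j\<leftarrow>js. \<i> * of_real (\<xi> $ j)) * partial_d i (expi \<xi>) y + 0 * partial_d i (expi \<xi>) y)"
    by (rule partial_d_lincomb) (rule differentiable_expi)+
  with Cons show ?case by (simp add: partial_d_expi mult_ac)
qed simp

lemma cmod_prod_list_le:
  fixes \<xi> :: "real ^ 'n::finite"
  shows "cmod (\<Prod>j\<leftarrow>js. \<i> * of_real (\<xi> $ j)) \<le> norm \<xi> ^ length js"
proof (induction js)
  case (Cons j js)
  then show ?case
    by (auto simp: norm_mult intro!: mult_mono component_le_norm_cart)
qed simp

lemma norm_power_le_fact_powr_exp:
  fixes a s h :: real
  assumes "0 < s" "0 < h" "0 \<le> a"
  shows "a ^ n \<le> h ^ n * fact n powr s * exp (s * (1 / h) powr (1 / s) * a powr (1 / s))"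
proof -
  have "(a / h) ^ n \<le> fact n powr s * exp (s * (a / h) powr (1 / s))"
    using assms by (intro power_le_fact_powr_exp) auto
  then show ?thesis using assms by (simp add: power_divide powr_divide field_simps)
qed

lemma gevrey_le_expi:
  assumes "0 < s" "0 < h"
  shows "gevrey_le s h (\<lambda>_. exp (s * (1 / h) powr (1 / s) * norm \<xi> powr (1 / s))) (expi \<xi>)"
  unfolding gevrey_le_def
proof (intro allI)
  fix js :: "'a list" and x :: "real ^ 'a"
  have "cmod (iter_partial js (expi \<xi>) x) \<le> norm \<xi> ^ length js"
    by (simp add: iter_partial_expi norm_mult cmod_prod_list_le)
  also have "\<dots> \<le> h ^ length js * fact (length js) powr s * exp (s * (1 / h) powr (1 / s) * norm \<xi> powr (1 / s))"
    by (rule norm_power_le_fact_powr_exp) (use assms in auto)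
  finally show "cmod (iter_partial js (expi \<xi>) x) \<le>
     exp (s * (1 / h) powr (1 / s) * norm \<xi> powr (1 / s)) * h ^ length js * fact (length js) powr s"
    by (simp add: mult_ac)
qed

lemma gevrey_bdd_expi: "0 < s \<Longrightarrow> gevrey_bdd s (expi \<xi>)"
  using gevrey_le_expi smooth_expi unfolding gevrey_bdd_def by blast

lemma modulate_fun_eq: "modulate_fun \<xi> f = (\<lambda>y. f y * expi \<xi> y)"
  by (auto simp: modulate_fun_def expi_def)

subsection \<open>Compactly supported Gevrey functions exist\<close>

definition flat_exp :: "nat \<Rightarrow> complex \<Rightarrow> complex" where
  "flat_exp m z = exp (- (inverse (1 - z) ^ m) - inverse (1 + z) ^ m)"

definition bump1 :: "nat \<Rightarrow> nat \<Rightarrow> real \<Rightarrow> real" where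
  "bump1 m n x = (if \<bar>x\<bar> < 1 then Re ((deriv ^^ n) (flat_exp m) (of_real x)) else 0)"

lemma flat_exp_holomorphic: "flat_exp m holomorphic_on - {1, -1}"
proof -
  have "1 - z \<noteq> 0" "1 + z \<noteq> 0" if "z \<in> - {1, -1}" for z :: complex
    using that by (auto simp: add_eq_0_iff)
  then show ?thesis unfolding flat_exp_def by (intro holomorphic_intros) auto
qed

lemma open_compl_pm1: "open (- {1, -1 :: complex})"
  by (intro open_Compl finite_imp_closed) simp

text \<open>Cauchy's inequality on a disc of radius \<open>\<epsilon> (1 - \<bar>x\<bar>)\<close> around \<open>x\<close>; for small \<open>\<epsilon>\<close>
  the numbers \<open>inverse (1 \<mp> z) ^ m\<close> stay in a sector where their real part is comparable
  to their modulus.\<close>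

lemma bump1_bound:
  assumes "m \<ge> 1"
  obtains \<epsilon> where "0 < \<epsilon>" "\<epsilon> < 1" "\<And>n j x. \<bar>x\<bar> < 1 \<Longrightarrow> \<bar>bump1 m n x\<bar> \<le>
    fact n * (1 / \<epsilon>) ^ n * 2 ^ (n + j) * fact (n + j) powr (1 / m) * (1 - \<bar>x\<bar>) ^ j"
proof -
  have "isCont (\<lambda>w. inverse (1 + w) ^ m) (0 :: complex)"
    by (intro continuous_intros) auto
  then obtain d where d: "d > 0" "\<And>w :: complex. dist w 0 < d \<Longrightarrow> dist (inverse (1 + w) ^ m) (inverse (1 + 0) ^ m) < 1/2"
    unfolding continuous_at_eps_delta by (metis half_gt_zero zero_less_one)
  define \<epsilon> where "\<epsilon> = min (d / 2) (1 / 2)"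
  have \<epsilon>: "0 < \<epsilon>" "\<epsilon> < 1" "\<epsilon> < d" using d by (auto simp: \<epsilon>_def)
  have re: "Re (inverse (1 + w) ^ m) \<ge> 1/2" if "cmod w \<le> \<epsilon>" for w
  proof -
    have "cmod (inverse (1 + w) ^ m - 1) < 1/2"
      using d(2)[of w] that \<epsilon> by (simp add: dist_norm)
    then have "\<bar>Re (inverse (1 + w) ^ m - 1)\<bar> < 1/2"
      using abs_Re_le_cmod order_le_less_trans by blast
    then show ?thesis unfolding minus_complex.sel one_complex.sel by linarith
  qed
  have "\<bar>bump1 m n x\<bar> \<le> fact n * (1 / \<epsilon>) ^ n * 2 ^ (n + j) * fact (n + j) powr (1 / m) * (1 - \<bar>x\<bar>) ^ j"
    if x: "\<bar>x\<bar> < 1" for n j x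
  proof -
    define \<delta> where "\<delta> = 1 - \<bar>x\<bar>"
    have \<delta>: "0 < \<delta>" "\<delta> \<le> 1 - x" "\<delta> \<le> 1 + x" using x by (auto simp: \<delta>_def)
    define B where "B = exp (- (1/2) * (1 / \<delta>) ^ m)"
    have ball: "z \<notin> {1, -1}" if z: "cmod (of_real x - z) \<le> \<epsilon> * \<delta>" for z
    proof -
      have "\<epsilon> * \<delta> < \<delta>" using \<epsilon> \<delta> by simp
      then have "cmod (of_real x - z) < \<delta>" using z by linarith
      moreover have "cmod (of_real x - 1) = \<bar>x - 1\<bar>" "cmod (of_real x - - 1) = \<bar>x + 1\<bar>"
        by (metis norm_of_real of_real_1 of_real_diff) (metis norm_of_real of_real_1 of_real_add diff_minus_eq_add)
      ultimately show ?thesis using \<delta> by auto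
    qed
    have bd: "cmod (flat_exp m z) \<le> B" if z: "cmod (of_real x - z) \<le> \<epsilon> * \<delta>" for z
    proof -
      have half: "Re (inverse (of_real a + v) ^ m) \<ge> 0"
        "a = \<delta> \<Longrightarrow> Re (inverse (of_real a + v) ^ m) \<ge> (1/2) * (1 / \<delta>) ^ m"
        if a: "a \<ge> \<delta>" and v: "cmod v \<le> \<epsilon> * \<delta>" for a v
      proof -
        have a0: "a > 0" using a \<delta> by simp
        have "cmod (v / of_real a) \<le> \<epsilon>"
        proof -
          have "cmod v \<le> \<epsilon> * a" using v a \<epsilon> mult_left_mono[of \<delta> a \<epsilon>] by linarith
          then show ?thesis using a0 by (simp add: norm_divide divide_le_eq)
        qed
        from re[OF this] have *: "Re (inverse (1 + v / of_real a) ^ m) \<ge> 1/2" .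
        have "of_real a + v = of_real a * (1 + v / of_real a)" using a0 by (simp add: field_simps)
        then have "inverse (of_real a + v) ^ m = of_real ((1 / a) ^ m) * inverse (1 + v / of_real a) ^ m"
          by (simp add: power_mult_distrib inverse_eq_divide power_divide)
        then have **: "Re (inverse (of_real a + v) ^ m) = (1 / a) ^ m * Re (inverse (1 + v / of_real a) ^ m)"
          by simp
        show "Re (inverse (of_real a + v) ^ m) \<ge> 0"
          unfolding ** using * a0 by (intro mult_nonneg_nonneg) auto
        show "Re (inverse (of_real a + v) ^ m) \<ge> (1/2) * (1 / \<delta>) ^ m" if "a = \<delta>"
          unfolding ** using * a0 that mult_left_mono[OF *, of "(1 / a) ^ m"] by simp
      qed
      have e1: "1 - z = of_real (1 - x) + (of_real x - z)" "1 + z = of_real (1 + x) + - (of_real x - z)"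
        by auto
      have z': "cmod (- (of_real x - z)) \<le> \<epsilon> * \<delta>" using z by (simp only: norm_minus_cancel)
      have nn: "Re (inverse (1 - z) ^ m) \<ge> 0" "Re (inverse (1 + z) ^ m) \<ge> 0"
        unfolding e1 by (rule half(1)[OF \<delta>(2) z], rule half(1)[OF \<delta>(3) z'])
      have "Re (inverse (1 - z) ^ m) + Re (inverse (1 + z) ^ m) \<ge> (1/2) * (1 / \<delta>) ^ m"
      proof (cases "x \<ge> 0")
        case True
        then have "1 - x = \<delta>" by (simp add: \<delta>_def)
        then have "Re (inverse (1 - z) ^ m) \<ge> (1/2) * (1 / \<delta>) ^ m"
          unfolding e1 using z \<delta> by (intro half(2)) auto
        with nn show ?thesis by linarith
      next
        case False
        then have "1 + x = \<delta>" by (simp add: \<delta>_def)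
        then have "Re (inverse (1 + z) ^ m) \<ge> (1/2) * (1 / \<delta>) ^ m"
          unfolding e1 using z \<delta> by (intro half(2)) (simp_all only: norm_minus_cancel)
        with nn show ?thesis by linarith
      qed
      then show ?thesis by (simp add: flat_exp_def B_def)
    qed
    have "cball (of_real x) (\<epsilon> * \<delta>) \<subseteq> - {1, -1 :: complex}"
    proof
      fix z :: complex assume "z \<in> cball (of_real x) (\<epsilon> * \<delta>)"
      then show "z \<in> - {1, -1}" using ball[of z] unfolding mem_cball dist_norm by blast
    qed
    then have hol: "flat_exp m holomorphic_on cball (of_real x) (\<epsilon> * \<delta>)"
      by (rule holomorphic_on_subset[OF flat_exp_holomorphic])
    have "cmod ((deriv ^^ n) (flat_exp m) (of_real x)) \<le> fact n * B / (\<epsilon> * \<delta>) ^ n"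
    proof (rule Cauchy_inequality)
      show "flat_exp m holomorphic_on ball (of_real x) (\<epsilon> * \<delta>)"
        using hol by (rule holomorphic_on_subset) auto
      show "continuous_on (cball (of_real x) (\<epsilon> * \<delta>)) (flat_exp m)"
        using hol by (rule holomorphic_on_imp_continuous_on)
    qed (use \<epsilon> \<delta> bd in auto)
    moreover have "\<bar>bump1 m n x\<bar> \<le> cmod ((deriv ^^ n) (flat_exp m) (of_real x))"
      using x abs_Re_le_cmod by (simp add: bump1_def)
    ultimately have 1: "\<bar>bump1 m n x\<bar> \<le> fact n * B / (\<epsilon> * \<delta>) ^ n" by linarith
    have "(1 / (2 * \<delta>)) ^ (n + j) \<le> fact (n + j) powr (1 / m) * exp ((1 / m) * (1 / (2 * \<delta>)) powr (1 / (1 / m)))"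
      using \<delta> assms by (intro power_le_fact_powr_exp) auto
    also have "(1 / (2 * \<delta>)) powr (1 / (1 / m)) = (1 / 2) ^ m * (1 / \<delta>) ^ m"
      using \<delta> by (simp add: powr_realpow power_divide power_mult_distrib)
    also have "fact (n + j) powr (1 / m) * exp ((1 / m) * ((1 / 2) ^ m * (1 / \<delta>) ^ m)) \<le>
      fact (n + j) powr (1 / m) * exp ((1/2) * (1 / \<delta>) ^ m)"
    proof -
      have "(1 / m) * (1 / 2) ^ m \<le> 1 * (1 / 2 :: real) ^ 1"
        using assms by (intro mult_mono power_decreasing) auto
      then have "((1 / m) * (1 / 2) ^ m) * (1 / \<delta>) ^ m \<le> (1 / 2) * (1 / \<delta>) ^ m"
        using \<delta> by (intro mult_right_mono) auto
      then show ?thesis by (intro mult_left_mono) (auto simp: mult_ac)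
    qed
    finally have "(1 / (2 * \<delta>)) ^ (n + j) * B \<le> fact (n + j) powr (1 / m) * exp ((1/2) * (1 / \<delta>) ^ m) * B"
      by (intro mult_right_mono) (auto simp: B_def)
    also have "\<dots> = fact (n + j) powr (1 / m)"
      by (simp add: B_def mult.assoc exp_add[symmetric])
    finally have 2: "(1 / (2 * \<delta>)) ^ (n + j) * B \<le> fact (n + j) powr (1 / m)" .
    have "fact n * B / (\<epsilon> * \<delta>) ^ n = fact n * (1 / \<epsilon>) ^ n * 2 ^ (n + j) * ((1 / (2 * \<delta>)) ^ (n + j) * B) * \<delta> ^ j"
      using \<delta> \<epsilon> by (simp add: power_mult_distrib power_divide power_add)
    also have "\<dots> \<le> fact n * (1 / \<epsilon>) ^ n * 2 ^ (n + j) * fact (n + j) powr (1 / m) * \<delta> ^ j"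
      using 2 \<delta> \<epsilon> by (intro mult_right_mono mult_left_mono) auto
    finally show ?thesis using 1 by (simp add: \<delta>_def)
  qed
  with \<epsilon> show ?thesis using that by blast
qed

lemma bump1_deriv:
  assumes "m \<ge> 1"
  shows "(bump1 m n has_real_derivative bump1 m (Suc n) x) (at x)"
proof -
  obtain \<epsilon> where \<epsilon>: "0 < \<epsilon>" and bd: "\<And>n j x. \<bar>x\<bar> < 1 \<Longrightarrow> \<bar>bump1 m n x\<bar> \<le>
    fact n * (1 / \<epsilon>) ^ n * 2 ^ (n + j) * fact (n + j) powr (1 / m) * (1 - \<bar>x\<bar>) ^ j"
    using bump1_bound[OF assms] by metis
  consider "\<bar>x\<bar> < 1" | "\<bar>x\<bar> > 1" | "\<bar>x\<bar> = 1" by linarith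
  then show ?thesis
  proof cases
    case 1
    have x: "of_real x \<in> - {1, -1 :: complex}"
      using 1 by (auto simp: complex_eq_iff)
    have "((deriv ^^ n) (flat_exp m) has_field_derivative deriv ((deriv ^^ n) (flat_exp m)) (of_real x)) (at (of_real x))"
      by (rule holomorphic_derivI[OF holomorphic_higher_deriv[OF flat_exp_holomorphic open_compl_pm1] open_compl_pm1 x])
    then have "((\<lambda>x. (deriv ^^ n) (flat_exp m) (of_real x)) has_vector_derivative (deriv ^^ Suc n) (flat_exp m) (of_real x)) (at x)"
      using has_vector_derivative_real_field[of "(deriv ^^ n) (flat_exp m)" _ x UNIV] by simp
    from bounded_linear.has_vector_derivative[OF bounded_linear_Re this]
    have "((\<lambda>x. Re ((deriv ^^ n) (flat_exp m) (of_real x))) has_real_derivative bump1 m (Suc n) x) (at x)"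
      using 1 by (simp add: has_real_derivative_iff_has_vector_derivative bump1_def)
    then show ?thesis
    proof (rule has_field_derivative_transform_within_open)
      show "open {-1<..<1::real}" "x \<in> {-1<..<1}" using 1 by auto
    qed (auto simp: bump1_def)
  next
    case 2
    have "((\<lambda>x. 0) has_real_derivative 0) (at x)" by simp
    then have "(bump1 m n has_real_derivative 0) (at x)"
    proof (rule has_field_derivative_transform_within_open)
      have "open ((\<lambda>x::real. \<bar>x\<bar>) -` {1<..})"
        by (intro open_vimage) (auto intro!: continuous_intros)
      then show "open {x::real. \<bar>x\<bar> > 1}" by (simp add: vimage_def)
    qed (use 2 in \<open>auto simp: bump1_def\<close>)
    then show ?thesis using 2 by (simp add: bump1_def)
  next
    case 3
    define C where "C = fact n * (1 / \<epsilon>) ^ n * 2 ^ (n + 2) * fact (n + 2) powr (1 / m)"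
    have C: "C \<ge> 0" using \<epsilon> by (simp add: C_def)
    have quad: "\<bar>bump1 m n y\<bar> \<le> C * \<bar>y - x\<bar> * \<bar>y - x\<bar>" for y
    proof (cases "\<bar>y\<bar> < 1")
      case True
      have le: "1 - \<bar>y\<bar> \<le> \<bar>y - x\<bar>" using 3 by linarith
      have "\<bar>bump1 m n y\<bar> \<le> C * (1 - \<bar>y\<bar>) ^ 2" using bd[OF True, of n 2] by (simp add: C_def)
      also have "\<dots> \<le> C * \<bar>y - x\<bar> ^ 2" using le True C by (intro mult_left_mono power_mono) auto
      finally show ?thesis by (simp add: power2_eq_square)
    qed (use C in \<open>simp add: bump1_def\<close>)
    have "bump1 m n x = 0" "bump1 m (Suc n) x = 0" using 3 by (simp_all add: bump1_def)
    then have nb: "norm ((bump1 m n y - bump1 m n x) / (y - x)) \<le> C * \<bar>y - x\<bar>" for y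
    proof (cases "y = x")
      case False
      then have "\<bar>bump1 m n y\<bar> / \<bar>y - x\<bar> \<le> C * \<bar>y - x\<bar>"
        using quad[of y] by (simp add: pos_divide_le_eq)
      then show ?thesis using \<open>bump1 m n x = 0\<close> by (simp add: abs_divide)
    qed simp
    have lim: "((\<lambda>y. C * \<bar>y - x\<bar>) \<longlongrightarrow> 0) (at x)"
      by (rule tendsto_eq_intros refl | simp)+
    have "((\<lambda>y. (bump1 m n y - bump1 m n x) / (y - x)) \<longlongrightarrow> 0) (at x)"
      using nb lim by (rule Lim_null_comparison[OF always_eventually[OF allI]])
    then show ?thesis
      using \<open>bump1 m (Suc n) x = 0\<close> by (simp add: has_field_derivative_iff)
  qed
qed

lemma bump1_0_pos:
  assumes "\<bar>x\<bar> < 1" shows "bump1 m 0 x > 0"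
proof -
  have "flat_exp m (of_real x) = of_real (exp (- (inverse (1 - x) ^ m) - inverse (1 + x) ^ m))"
    by (simp add: flat_exp_def exp_of_real[symmetric])
  then show ?thesis using assms by (simp add: bump1_def)
qed

lemma power_mult_fact_powr_le:
  fixes A h \<sigma> s :: real
  assumes "\<sigma> < s" "0 < h" "0 \<le> A"
  shows "A ^ n * fact n powr \<sigma> \<le> exp ((s - \<sigma>) * (A / h) powr (1 / (s - \<sigma>))) * h ^ n * fact n powr s"
proof -
  have "(A / h) ^ n \<le> fact n powr (s - \<sigma>) * exp ((s - \<sigma>) * (A / h) powr (1 / (s - \<sigma>)))"
    using assms by (intro power_le_fact_powr_exp) auto
  then have "(A / h) ^ n * (h ^ n * fact n powr \<sigma>) \<le>
     fact n powr (s - \<sigma>) * exp ((s - \<sigma>) * (A / h) powr (1 / (s - \<sigma>))) * (h ^ n * fact n powr \<sigma>)"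
    using assms by (intro mult_right_mono) auto
  moreover have "(A / h) ^ n * (h ^ n * fact n powr \<sigma>) = A ^ n * fact n powr \<sigma>"
    using assms by (simp add: power_divide)
  ultimately have "A ^ n * fact n powr \<sigma> \<le>
    (fact n powr (s - \<sigma>) * fact n powr \<sigma>) * (exp ((s - \<sigma>) * (A / h) powr (1 / (s - \<sigma>))) * h ^ n)"
    by (simp only: mult_ac)
  also have "fact n powr (s - \<sigma>) * fact n powr \<sigma> = (fact n powr s :: real)"
    by (simp add: powr_add[symmetric])
  finally show ?thesis by (simp add: mult_ac)
qed

lemma exists_plateau1:
  fixes s :: real
  assumes "1 < s"
  obtains P :: "nat \<Rightarrow> real \<Rightarrow> real" where
    "\<And>n x. (P n has_real_derivative P (Suc n) x) (at x)"
    "\<And>x. \<bar>x\<bar> \<le> 1 \<Longrightarrow> P 0 x = 1" "\<And>x. \<bar>x\<bar> \<ge> 3 \<Longrightarrow> P 0 x = 0"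
    "\<And>h. h > 0 \<Longrightarrow> \<exists>C. \<forall>n x. \<bar>P n x\<bar> \<le> C * h ^ n * fact n powr s"
proof -
  obtain m :: nat where m: "real m > 1 / (s - 1)" using reals_Archimedean2 by blast
  have "1 / (s - 1) > 0" using assms by simp
  with m have m0: "m \<ge> 1" by (cases m) auto
  define \<sigma> where "\<sigma> = 1 + 1 / real m"
  have \<sigma>: "\<sigma> < s" "\<sigma> > 1" using m m0 assms by (auto simp: \<sigma>_def field_simps)
  obtain \<epsilon> where \<epsilon>: "0 < \<epsilon>" "\<epsilon> < 1" and bd: "\<And>n j x. \<bar>x\<bar> < 1 \<Longrightarrow> \<bar>bump1 m n x\<bar> \<le>
    fact n * (1 / \<epsilon>) ^ n * 2 ^ (n + j) * fact (n + j) powr (1 / m) * (1 - \<bar>x\<bar>) ^ j"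
    using bump1_bound[OF m0] by metis
  define A where "A = 2 / \<epsilon>"
  have A: "A \<ge> 1" using \<epsilon> by (simp add: A_def)
  have gb: "\<bar>bump1 m n x\<bar> \<le> A ^ n * fact n powr \<sigma>" for n x
  proof (cases "\<bar>x\<bar> < 1")
    case True
    from bd[OF True, of n 0] show ?thesis
      by (simp add: A_def \<sigma>_def power_divide powr_add mult_ac)
  qed (use A in \<open>simp add: bump1_def\<close>)
  have "isCont (bump1 m 0) x" for x using bump1_deriv[OF m0] DERIV_isCont by blast
  then obtain F where F0: "\<And>x. (F has_vector_derivative bump1 m 0 x) (at x)"
    using einterval_antiderivative[of "-\<infinity>" "\<infinity>" "bump1 m 0"] by auto
  then have F: "(F has_real_derivative bump1 m 0 x) (at x)" for x
    by (simp add: has_real_derivative_iff_has_vector_derivative)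
  have mono: "F x \<le> F y" if "x \<le> y" for x y
  proof (rule DERIV_nonneg_imp_nondecreasing[OF that])
    fix z
    have "bump1 m 0 z \<ge> 0" using bump1_0_pos[of z m] by (cases "\<bar>z\<bar> < 1") (auto simp: bump1_def)
    then show "\<exists>y. (F has_real_derivative y) (at z) \<and> 0 \<le> y" using F by blast
  qed
  have const: "F x = F y" if "x \<le> y" "\<And>z. x < z \<Longrightarrow> z < y \<Longrightarrow> \<bar>z\<bar> \<ge> 1" for x y
  proof (cases "x = y")
    case False
    then have "x < y" using that by simp
    then obtain z where "z > x" "z < y" "F y - F x = (y - x) * bump1 m 0 z"
      using MVT2[of x y F, OF _ F] by blast
    with that(2)[of z] show ?thesis by (simp add: bump1_def)
  qed simp
  define L where "L = F 1 - F (-1)"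
  have L: "L > 0"
  proof -
    obtain z where "z > -1" "z < 1" "F 1 - F (-1) = (1 - (-1)) * bump1 m 0 z"
      using MVT2[of "-1" 1 F, OF _ F] by auto
    then show ?thesis using bump1_0_pos[of z m] by (simp add: L_def)
  qed
  have right: "F x = F 1" if "x \<ge> 1" for x using const[of 1 x] that by auto
  have left: "F x = F (-1)" if "x \<le> -1" for x using const[of x "-1"] that by auto
  have Fb: "F (-1) \<le> F x" "F x \<le> F 1" for x
  proof -
    show "F (-1) \<le> F x" using left[of x] mono[of "-1" x] by linarith
    show "F x \<le> F 1" using right[of x] mono[of x 1] by linarith
  qed
  define Q where "Q n x = (case n of 0 \<Rightarrow> F x | Suc k \<Rightarrow> bump1 m k x)" for n x
  have Q: "(Q n has_real_derivative Q (Suc n) x) (at x)" for n x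
  proof -
    have "Q 0 = F" "Q (Suc k) = bump1 m k" for k by (auto simp: Q_def)
    then show ?thesis using F bump1_deriv[OF m0] by (cases n) auto
  qed
  define P where "P n x = (Q n (x + 2) - Q n (x - 2)) / L" for n x
  show ?thesis
  proof (rule that[of P])
    fix n x
    have "((\<lambda>x. Q n (x + 2)) has_real_derivative Q (Suc n) (x + 2)) (at x)"
      "((\<lambda>x. Q n (x + (-2))) has_real_derivative Q (Suc n) (x + (-2))) (at x)"
      by (rule DERIV_shift[THEN iffD1], rule Q)+
    then show "(P n has_real_derivative P (Suc n) x) (at x)"
      unfolding P_def using L by (auto intro!: derivative_eq_intros)
  next
    fix x :: real assume "\<bar>x\<bar> \<le> 1"
    then have "F (x + 2) = F 1" "F (x - 2) = F (-1)" by (intro right left; simp)+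
    then show "P 0 x = 1" using L by (simp add: P_def Q_def L_def)
  next
    fix x :: real assume "\<bar>x\<bar> \<ge> 3"
    then have "F (x + 2) = F (x - 2)"
      using right[of "x + 2"] right[of "x - 2"] left[of "x + 2"] left[of "x - 2"] by (cases "x \<ge> 0") auto
    then show "P 0 x = 0" by (simp add: P_def Q_def)
  next
    fix h :: real assume h: "h > 0"
    define E where "E = exp ((s - \<sigma>) * (A / h) powr (1 / (s - \<sigma>)))"
    define D where "D = max 1 (2 / L)"
    have "\<bar>P n x\<bar> \<le> D * (A ^ n * fact n powr \<sigma>)" for n x
    proof (cases n)
      case 0
      have "\<bar>F (x + 2) - F (x - 2)\<bar> \<le> L"
        using Fb[of "x + 2"] Fb[of "x - 2"] by (auto simp: L_def)
      then have "\<bar>P 0 x\<bar> \<le> 1" using L by (simp add: P_def Q_def abs_divide)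
      then show ?thesis using 0 by (simp add: D_def)
    next
      case (Suc k)
      have "\<bar>P n x\<bar> = \<bar>bump1 m k (x + 2) - bump1 m k (x - 2)\<bar> / L"
        using Suc L by (simp add: P_def Q_def abs_divide)
      also have "\<dots> \<le> (2 * (A ^ k * fact k powr \<sigma>)) / L"
        using gb[of k "x + 2"] gb[of k "x - 2"] L by (intro divide_right_mono) auto
      also have "\<dots> = (2 / L) * (A ^ k * fact k powr \<sigma>)" by simp
      also have "\<dots> \<le> D * (A ^ n * fact n powr \<sigma>)"
        using A \<sigma> L Suc
        by (intro mult_mono power_increasing powr_mono2 fact_mono) (auto simp: D_def)
      finally show ?thesis .
    qed
    moreover have "D * (A ^ n * fact n powr \<sigma>) \<le> D * (E * h ^ n * fact n powr s)" for n
      using power_mult_fact_powr_le[OF \<sigma>(1) h, of A n] A by (intro mult_left_mono) (auto simp: E_def D_def)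
    ultimately have "\<bar>P n x\<bar> \<le> (D * E) * h ^ n * fact n powr s" for n x
      unfolding mult.assoc[of D] by (rule order_trans)
    then show "\<exists>C. \<forall>n x. \<bar>P n x\<bar> \<le> C * h ^ n * fact n powr s" by blast
  qed
qed

lemma iter_partial_coord:
  fixes P :: "nat \<Rightarrow> real \<Rightarrow> real"
  assumes P: "\<And>n x. (P n has_real_derivative P (Suc n) x) (at x)"
  shows "iter_partial js (\<lambda>x :: real ^ 'n::finite. of_real (P m (x $ i))) =
    (\<lambda>x. if set js \<subseteq> {i} then of_real (P (m + length js) (x $ i)) else 0)"
    and "(\<lambda>x :: real ^ 'n::finite. complex_of_real (P m (x $ i))) differentiable (at y)"
proof -
  have d: "((\<lambda>x :: real ^ 'n. complex_of_real (P n (x $ i))) has_derivative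
      (\<lambda>v. of_real (P (Suc n) (y $ i) * (v $ i)))) (at y)" for n y
  proof -
    have "((\<lambda>x :: real ^ 'n. x $ i) has_derivative (\<lambda>v. v $ i)) (at y)"
      by (rule bounded_linear_imp_has_derivative[OF bounded_linear_vec_nth])
    from has_derivative_compose[OF this P[unfolded has_field_derivative_def]]
    show ?thesis
      by (intro bounded_linear.has_derivative[OF bounded_linear_of_real])
  qed
  then show "(\<lambda>x :: real ^ 'n. complex_of_real (P m (x $ i))) differentiable (at y)"
    unfolding differentiable_def by blast
  have pd: "partial_d j (\<lambda>x :: real ^ 'n. complex_of_real (P n (x $ i))) =
      (\<lambda>x. if j = i then of_real (P (Suc n) (x $ i)) else 0)" for n j
    by (rule ext, subst has_derivative_imp_partial_d[OF d]) (auto simp: axis_def)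
  show "iter_partial js (\<lambda>x :: real ^ 'n. of_real (P m (x $ i))) =
    (\<lambda>x. if set js \<subseteq> {i} then of_real (P (m + length js) (x $ i)) else 0)"
  proof (induction js)
    case (Cons j js)
    show ?case
      by (cases "set js \<subseteq> {i}") (auto simp: Cons pd partial_d_const)
  qed simp
qed

lemma exists_plateau:
  assumes "1 < s"
  obtains \<kappa> :: "real ^ 'n::finite \<Rightarrow> complex" and B where "gevrey_bdd s \<kappa>" "B > 0"
    "\<And>x. norm x \<le> 1 \<Longrightarrow> \<kappa> x = 1" "\<And>x. norm x \<ge> B \<Longrightarrow> \<kappa> x = 0"
proof -
  obtain P :: "nat \<Rightarrow> real \<Rightarrow> real" where P: "\<And>n x. (P n has_real_derivative P (Suc n) x) (at x)"
    "\<And>x. \<bar>x\<bar> \<le> 1 \<Longrightarrow> P 0 x = 1" "\<And>x. \<bar>x\<bar> \<ge> 3 \<Longrightarrow> P 0 x = 0"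
    and Pb: "\<And>h. h > 0 \<Longrightarrow> \<exists>C. \<forall>n x. \<bar>P n x\<bar> \<le> C * h ^ n * fact n powr s"
    using exists_plateau1[OF assms] by metis
  define \<kappa> :: "real ^ 'n \<Rightarrow> complex" where "\<kappa> x = (\<Prod>i\<in>UNIV. of_real (P 0 (x $ i)))" for x
  have sm: "smooth_fun (\<lambda>x :: real ^ 'n. complex_of_real (P 0 (x $ i)))" for i
    unfolding smooth_fun_def
  proof (intro allI)
    fix js :: "'n list" and x
    show "iter_partial js (\<lambda>x :: real ^ 'n. complex_of_real (P 0 (x $ i))) differentiable (at x)"
      unfolding iter_partial_coord[of P, OF P(1)]
      by (cases "set js \<subseteq> {i}") (simp_all add: iter_partial_coord(2)[of P, OF P(1)])
  qed
  have "gevrey_bdd s (\<lambda>x :: real ^ 'n. complex_of_real (P 0 (x $ i)))" for i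
    unfolding gevrey_bdd_def
  proof (intro conjI allI impI sm)
    fix h :: real assume h: "h > 0"
    obtain C where C: "\<And>n x. \<bar>P n x\<bar> \<le> C * h ^ n * fact n powr s" using Pb[OF h] by blast
    have "0 \<le> C" using C[of 0 0] by simp
    then have "gevrey_le s h (\<lambda>_. C) (\<lambda>x :: real ^ 'n. complex_of_real (P 0 (x $ i)))"
      using C h by (auto simp: gevrey_le_def iter_partial_coord[of P, OF P(1)])
    then show "\<exists>C. gevrey_le s h (\<lambda>_. C) (\<lambda>x :: real ^ 'n. complex_of_real (P 0 (x $ i)))" by blast
  qed
  then have "gevrey_bdd s \<kappa>"
    unfolding \<kappa>_def using assms by (intro gevrey_bdd_prod) auto
  moreover have "\<kappa> x = 1" if "norm x \<le> 1" for x
    unfolding \<kappa>_def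
  proof (rule prod.neutral, intro ballI)
    fix i
    have "\<bar>x $ i\<bar> \<le> 1" using component_le_norm_cart[of x i] that by linarith
    then show "complex_of_real (P 0 (x $ i)) = 1" using P(2) by simp
  qed
  moreover have "\<kappa> x = 0" if "norm x \<ge> 3 * real CARD('n)" for x
  proof -
    obtain i where "norm x \<le> real CARD('n) * \<bar>x $ i\<bar>" using norm_le_card_component .
    with that have "3 * real CARD('n) \<le> \<bar>x $ i\<bar> * real CARD('n)" by (simp only: mult.commute)
    then have "\<bar>x $ i\<bar> \<ge> 3" using mult_right_le_imp_le zero_less_card_finite of_nat_0_less_iff by blast
    then have "P 0 (x $ i) = 0" by (rule P(3))
    then show ?thesis unfolding \<kappa>_def by (intro prod_zero) auto
  qed
  ultimately show ?thesis by (intro that[of \<kappa> "3 * real CARD('n)"]) auto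
qed

lemma exists_cutoff_ball:
  fixes a :: "real ^ 'n::finite"
  assumes "1 < s" "0 < r"
  obtains \<kappa> r' where "\<kappa> \<in> Gevrey_c s" "0 < r'" "\<And>x. x \<in> ball a r' \<Longrightarrow> \<kappa> x = 1"
    "fun_supp \<kappa> \<subseteq> cball a r"
proof -
  obtain \<kappa>0 :: "real ^ 'n \<Rightarrow> complex" and B where \<kappa>0: "gevrey_bdd s \<kappa>0" "B > 0"
    "\<And>x. norm x \<le> 1 \<Longrightarrow> \<kappa>0 x = 1" "\<And>x. norm x \<ge> B \<Longrightarrow> \<kappa>0 x = 0"
    using exists_plateau[OF assms(1)] by metis
  define c where "c = B / r"
  have c: "c > 0" using \<kappa>0 assms by (simp add: c_def)
  define \<kappa> where "\<kappa> x = \<kappa>0 (c *\<^sub>R x + (- c *\<^sub>R a))" for x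
  have n: "norm (c *\<^sub>R x + (- c *\<^sub>R a)) = c * dist a x" for x
    using c by (simp add: dist_norm norm_minus_commute flip: scaleR_diff_right)
  have supp: "fun_supp \<kappa> \<subseteq> cball a r"
  proof (rule fun_supp_subset_closed)
    fix x assume "\<kappa> x \<noteq> 0"
    then have "c * dist a x < B" using \<kappa>0(4) n unfolding \<kappa>_def by (metis not_less)
    then show "x \<in> cball a r" using \<kappa>0(2) assms by (simp add: c_def field_simps)
  qed simp
  show ?thesis
  proof (rule that[of \<kappa> "1 / c"])
    show "\<kappa> \<in> Gevrey_c s"
    proof (rule Gevrey_cI)
      show "gevrey_bdd s \<kappa>" unfolding \<kappa>_def by (rule gevrey_bdd_affine[OF \<kappa>0(1)])
      show "compact (fun_supp \<kappa>)" by (rule compact_fun_supp[OF compact_cball supp])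
    qed (use assms in simp)
    show "1 / c > 0" using c by simp
    show "\<kappa> x = 1" if "x \<in> ball a (1 / c)" for x
      unfolding \<kappa>_def using that c by (intro \<kappa>0(3), subst n) (simp add: field_simps)
  qed (rule supp)
qed

subsection \<open>Integrals and Fourier decay\<close>

lemma Basis_vec_axis: "(Basis :: (real ^ 'n::finite) set) = range (\<lambda>i. axis i 1)"
  by (auto simp: Basis_vec_def)

lemma lborel_vec_prod:
  fixes g :: "'n::finite \<Rightarrow> real \<Rightarrow> 'b::{real_normed_field,banach,second_countable_topology}"
  assumes g: "\<And>i. integrable lborel (g i)"
  shows "integrable lborel (\<lambda>x :: real ^ 'n. \<Prod>i\<in>UNIV. g i (x $ i))"
    and "(\<integral>x. (\<Prod>i\<in>UNIV. g i ((x :: real ^ 'n) $ i)) \<partial>lborel) = (\<Prod>i\<in>UNIV. (\<integral>y. g i y \<partial>lborel))"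
proof -
  interpret product_sigma_finite "\<lambda>_ :: real ^ 'n. lborel :: real measure" ..
  define ix :: "real ^ 'n \<Rightarrow> 'n" where "ix = inv (\<lambda>i. axis i (1::real))"
  have inj: "inj (\<lambda>i :: 'n. axis i (1::real))" by (auto simp: inj_def axis_eq_axis)
  have ix: "ix (axis i 1) = i" for i unfolding ix_def by (rule inv_f_f[OF inj])
  define T where "T f = (\<Sum>b\<in>Basis. f b *\<^sub>R b)" for f :: "real ^ 'n \<Rightarrow> real"
  have lb: "lborel = distr (\<Pi>\<^sub>M b\<in>(Basis :: (real ^ 'n) set). lborel) borel T"
    unfolding T_def by (rule lborel_eq)
  have T: "T f $ i = f (axis i 1)" for f i
  proof -
    have "T f $ i = T f \<bullet> axis i 1" by (simp add: inner_axis)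
    also have "\<dots> = f (axis i 1)" unfolding T_def
      by (rule inner_sum_left_Basis) (simp add: Basis_vec_axis)
    finally show ?thesis .
  qed
  have Tm: "T \<in> measurable (\<Pi>\<^sub>M b\<in>Basis. lborel) borel"
    unfolding T_def by measurable
  have [measurable]: "g i \<in> borel_measurable borel" for i using g[of i] by (simp add: borel_measurable_integrable)
  have m: "(\<lambda>x :: real ^ 'n. \<Prod>i\<in>UNIV. g i (x $ i)) \<in> borel_measurable borel"
    by measurable
  have eq: "(\<Prod>i\<in>UNIV. g i (T f $ i)) = (\<Prod>b\<in>Basis. g (ix b) (f b))" for f
    unfolding T Basis_vec_axis by (subst prod.reindex) (auto simp: ix inj)
  show "integrable lborel (\<lambda>x :: real ^ 'n. \<Prod>i\<in>UNIV. g i (x $ i))"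
    unfolding lb by (subst integrable_distr_eq[OF Tm m]) (unfold eq, rule product_integrable_prod, auto intro: g)
  have "(\<integral>x. (\<Prod>i\<in>UNIV. g i ((x :: real ^ 'n) $ i)) \<partial>lborel) =
      (\<integral>f. (\<Prod>b\<in>Basis. g (ix b) (f b)) \<partial>(\<Pi>\<^sub>M b\<in>Basis. lborel))"
    unfolding lb by (subst integral_distr[OF Tm m]) (simp add: eq)
  also have "\<dots> = (\<Prod>b\<in>Basis. (\<integral>y. g (ix b) y \<partial>lborel))"
    by (rule product_integral_prod) (auto intro: g)
  also have "\<dots> = (\<Prod>i\<in>UNIV. (\<integral>y. g i y \<partial>lborel))"
    unfolding Basis_vec_axis by (subst prod.reindex) (auto simp: ix inj)
  finally show "(\<integral>x. (\<Prod>i\<in>UNIV. g i ((x :: real ^ 'n) $ i)) \<partial>lborel) = (\<Prod>i\<in>UNIV. (\<integral>y. g i y \<partial>lborel))" .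
qed

lemma gs_weight_le_prod:
  assumes "0 < t" "0 < r"
  obtains C where "C > 0" "\<And>x :: real ^ 'n::finite. gs_weight t r x * (\<Prod>i\<in>UNIV. 1 + (x $ i)\<^sup>2) \<le> C"
proof -
  define d where "d = CARD('n)"
  define h where "h = (t / r) powr t"
  have h: "h > 0" using assms by (simp add: h_def)
  have hr: "t * (1 / h) powr (1 / t) = r"
    using assms by (simp add: h_def powr_divide powr_powr)
  define K where "K = h ^ (2 * d) * fact (2 * d) powr t"
  have K: "K > 0" using h by (simp add: K_def)
  have "gs_weight t r x * (\<Prod>i\<in>UNIV. 1 + (x $ i)\<^sup>2) \<le> 2 ^ d * (1 + K)" for x :: "real ^ 'n"
  proof -
    define y where "y = norm x"
    have y: "y \<ge> 0" by (simp add: y_def)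
    have "(\<Prod>i\<in>UNIV. 1 + (x $ i)\<^sup>2) \<le> (\<Prod>i\<in>(UNIV :: 'n set). 1 + y\<^sup>2)"
    proof (intro prod_mono conjI add_left_mono)
      fix i
      show "(x $ i)\<^sup>2 \<le> y\<^sup>2"
        using component_le_norm_cart[of x i] unfolding y_def by (metis abs_ge_zero power2_abs power_mono)
      show "0 \<le> 1 + (x $ i)\<^sup>2" by (simp add: add_nonneg_nonneg)
    qed
    also have "\<dots> = (1 + y\<^sup>2) ^ d" by (simp add: d_def)
    also have "\<dots> \<le> 2 ^ d * (1 + y ^ (2 * d))"
    proof (cases "y \<le> 1")
      case True
      then have "(1 + y\<^sup>2) ^ d \<le> 2 ^ d" using y by (intro power_mono) (auto simp: power_le_one)
      also have "\<dots> \<le> 2 ^ d * (1 + y ^ (2 * d))" using y by simp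
      finally show ?thesis .
    next
      case False
      then have "(1 + y\<^sup>2) ^ d \<le> (2 * y\<^sup>2) ^ d" using one_le_power[of y 2] by (intro power_mono) auto
      also have "\<dots> = 2 ^ d * y ^ (2 * d)" by (simp add: power_mult_distrib power_mult)
      also have "\<dots> \<le> 2 ^ d * (1 + y ^ (2 * d))" by simp
      finally show ?thesis .
    qed
    finally have 1: "(\<Prod>i\<in>UNIV. 1 + (x $ i)\<^sup>2) \<le> 2 ^ d * (1 + y ^ (2 * d))" .
    have "y ^ (2 * d) \<le> K * exp (r * y powr (1 / t))"
      using norm_power_le_fact_powr_exp[OF assms(1) h y, of "2 * d"] by (simp add: hr K_def)
    moreover have "1 \<le> exp (r * y powr (1 / t))" using assms by simp
    ultimately have "1 + y ^ (2 * d) \<le> (1 + K) * exp (r * y powr (1 / t))"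
      unfolding distrib_right mult_1 by linarith
    with 1 have 2: "(\<Prod>i\<in>UNIV. 1 + (x $ i)\<^sup>2) \<le> 2 ^ d * ((1 + K) * exp (r * y powr (1 / t)))"
      by (meson mult_left_mono order_trans zero_le_numeral zero_le_power)
    then have "gs_weight t r x * (\<Prod>i\<in>UNIV. 1 + (x $ i)\<^sup>2) \<le>
       gs_weight t r x * (2 ^ d * ((1 + K) * exp (r * y powr (1 / t))))"
      by (intro mult_left_mono) auto
    also have "\<dots> = 2 ^ d * (1 + K)"
      by (simp add: gs_weight_def y_def exp_add[symmetric] mult_ac)
    finally show ?thesis .
  qed
  then show ?thesis using K by (intro that[of "2 ^ d * (1 + K)"]) auto
qed

lemma gs_weight_measurable [measurable]: "gs_weight t r \<in> borel_measurable borel"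
  unfolding gs_weight_def by measurable

lemma integrable_gs_weight:
  assumes "0 < t" "0 < r"
  shows "integrable lborel (gs_weight t r :: real ^ 'n::finite \<Rightarrow> real)"
proof -
  obtain C where C: "C > 0" "\<And>x :: real ^ 'n. gs_weight t r x * (\<Prod>i\<in>UNIV. 1 + (x $ i)\<^sup>2) \<le> C"
    using gs_weight_le_prod[OF assms] by metis
  have 1: "integrable lborel (\<lambda>y :: real. inverse (1 + y\<^sup>2))"
    using integrable_inverse_1_plus_square by (simp add: set_integrable_def)
  show ?thesis
  proof (rule Bochner_Integration.integrable_bound)
    show "integrable lborel (\<lambda>x :: real ^ 'n. C * (\<Prod>i\<in>UNIV. inverse (1 + (x $ i)\<^sup>2)))"
      by (intro integrable_mult_right lborel_vec_prod 1)
    show "AE x in lborel. norm (gs_weight t r x) \<le> norm (C * (\<Prod>i\<in>UNIV. inverse (1 + ((x :: real ^ 'n) $ i)\<^sup>2)))"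
    proof (rule AE_I2)
      fix x :: "real ^ 'n"
      have p: "(\<Prod>i\<in>UNIV. 1 + (x $ i)\<^sup>2) > 0" by (intro prod_pos) (auto simp: add_pos_nonneg)
      have "gs_weight t r x \<le> C * inverse (\<Prod>i\<in>UNIV. 1 + (x $ i)\<^sup>2)"
        using C(2)[of x] p by (simp add: field_simps)
      moreover have "inverse (\<Prod>i\<in>UNIV. 1 + (x $ i)\<^sup>2) = (\<Prod>i\<in>UNIV. inverse (1 + (x $ i)\<^sup>2))"
        by (simp add: prod_inversef[symmetric] comp_def)
      ultimately show "norm (gs_weight t r x) \<le> norm (C * (\<Prod>i\<in>UNIV. inverse (1 + (x $ i)\<^sup>2)))"
        by simp
    qed
  qed simp
qed

lemma smooth_fun_measurable: "smooth_fun f \<Longrightarrow> f \<in> borel_measurable borel"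
  by (intro borel_measurable_continuous_onI smooth_fun_continuous)

lemma integrable_weight_bound:
  fixes F :: "real ^ 'n::finite \<Rightarrow> complex"
  assumes "0 < t" "0 < r" "F \<in> borel_measurable borel" "\<And>x. cmod (F x) \<le> C * gs_weight t r x"
  shows "integrable lborel F"
    and "cmod (\<integral>x. F x \<partial>lborel) \<le> C * (\<integral>x. gs_weight t r (x :: real ^ 'n) \<partial>lborel)"
proof -
  have i: "integrable lborel (\<lambda>x :: real ^ 'n. C * gs_weight t r x)"
    by (intro integrable_mult_right integrable_gs_weight assms)
  show F: "integrable lborel F"
    by (rule Bochner_Integration.integrable_bound[OF i]) (use assms in \<open>auto intro!: AE_I2 intro: order_trans[OF _ abs_ge_self]\<close>)
  have "cmod (\<integral>x. F x \<partial>lborel) \<le> (\<integral>x. cmod (F x) \<partial>lborel)" by simp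
  also have "\<dots> \<le> (\<integral>x. C * gs_weight t r (x :: real ^ 'n) \<partial>lborel)"
    by (rule integral_mono[OF integrable_norm[OF F] i]) (use assms in simp)
  finally show "cmod (\<integral>x. F x \<partial>lborel) \<le> C * (\<integral>x. gs_weight t r (x :: real ^ 'n) \<partial>lborel)" by simp
qed

lemma integral_translate:
  fixes F :: "real ^ 'n::finite \<Rightarrow> complex"
  assumes "F \<in> borel_measurable borel"
  shows "(\<integral>x. F (x + c) \<partial>lborel) = (\<integral>x. F x \<partial>lborel)"
proof -
  have "(\<integral>x. F x \<partial>lborel) = (\<integral>x. F x \<partial>distr lborel borel ((+) c))"
    by (simp add: lborel_distr_plus)
  also have "\<dots> = (\<integral>x. F (c + x) \<partial>lborel)"
    using assms by (subst integral_distr) auto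
  finally show ?thesis by (simp add: add.commute)
qed

lemma integrable_translate:
  fixes F :: "real ^ 'n::finite \<Rightarrow> complex"
  assumes "integrable lborel F"
  shows "integrable lborel (\<lambda>x. F (x + c))"
proof -
  have "integrable (distr lborel borel ((+) c)) F" using assms by (simp add: lborel_distr_plus)
  then have "integrable lborel (\<lambda>x. F (c + x))"
    by (subst (asm) integrable_distr_eq) (use assms in auto)
  then show ?thesis by (simp add: add.commute)
qed

lemma norm_difference_le_partial:
  fixes F :: "real ^ 'n::finite \<Rightarrow> complex"
  assumes "\<And>x. F differentiable (at x)" "0 \<le> h"
    and "\<And>\<tau>. 0 \<le> \<tau> \<Longrightarrow> \<tau> \<le> h \<Longrightarrow> cmod (partial_d i F (x + \<tau> *\<^sub>R axis i 1)) \<le> B"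
  shows "cmod (F (x + h *\<^sub>R axis i 1) - F x) \<le> B * h"
proof -
  have "norm (F (x + h *\<^sub>R axis i 1) - F (x + 0 *\<^sub>R axis i 1)) \<le> B * norm (h - 0)"
  proof (rule differentiable_bound[where S = "{0..h}" and f' = "\<lambda>\<tau> c. c *\<^sub>R partial_d i F (x + \<tau> *\<^sub>R axis i 1)"])
    fix \<tau> assume "\<tau> \<in> {0..h}"
    have l: "((\<lambda>\<tau>. x + \<tau> *\<^sub>R axis i 1) has_derivative (\<lambda>c. c *\<^sub>R axis i (1::real))) (at \<tau>)"
      by (auto intro!: derivative_eq_intros)
    from has_derivative_compose[OF this differentiable_has_derivative[OF assms(1)]]
    have "((\<lambda>\<tau>. F (x + \<tau> *\<^sub>R axis i 1)) has_derivative (\<lambda>c. c *\<^sub>R partial_d i F (x + \<tau> *\<^sub>R axis i 1))) (at \<tau>)"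
      by (simp add: partial_d_def linear_scale[OF linear_frechet_derivative[OF assms(1)]])
    then show "((\<lambda>\<tau>. F (x + \<tau> *\<^sub>R axis i 1)) has_derivative (\<lambda>c. c *\<^sub>R partial_d i F (x + \<tau> *\<^sub>R axis i 1))) (at \<tau> within {0..h})"
      by (rule has_derivative_at_withinI)
    have "cmod (partial_d i F (x + \<tau> *\<^sub>R axis i 1)) \<le> B" using assms(3) \<open>\<tau> \<in> {0..h}\<close> by auto
    then show "onorm (\<lambda>c. c *\<^sub>R partial_d i F (x + \<tau> *\<^sub>R axis i 1)) \<le> B"
      by (intro onorm_le) (simp add: mult.commute[of B] mult_left_mono)
  qed (use assms in auto)
  then show ?thesis using assms(2) by simp
qed

lemma integral_partial_d_eq_0:
  fixes F :: "real ^ 'n::finite \<Rightarrow> complex"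
  assumes F: "smooth_fun F" and t: "0 < t" "0 < r" "0 \<le> C"
    and b0: "\<And>x. cmod (F x) \<le> C * gs_weight t r x" and b1: "\<And>x. cmod (partial_d i F x) \<le> C * gs_weight t r x"
  shows "(\<integral>x. partial_d i F x \<partial>lborel) = 0"
proof -
  define e :: "real ^ 'n" where "e = axis i 1"
  define h where "h n = 1 / real (Suc n)" for n
  have h: "h n > 0" "h n \<le> 1" for n by (auto simp: h_def divide_le_eq)
  define S where "S n x = (F (x + h n *\<^sub>R e) - F x) / of_real (h n)" for n x
  define W where "W x = C * exp r * gs_weight t (r / 2 powr (1 / t)) x" for x :: "real ^ 'n"
  have Fm: "F \<in> borel_measurable borel" and pm: "partial_d i F \<in> borel_measurable borel"
    using smooth_fun_measurable[OF F] smooth_fun_measurable[OF smooth_fun_partial[OF F]] .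
  have Fi: "integrable lborel F" by (rule integrable_weight_bound[OF t(1,2) Fm b0])
  have S0: "(\<integral>x. S n x \<partial>lborel) = 0" for n
    unfolding S_def using Fi integrable_translate[OF Fi] integral_translate[OF Fm]
    by (simp add: Bochner_Integration.integral_diff)
  have "(\<lambda>n. \<integral>x. S n x \<partial>lborel) \<longlonglongrightarrow> (\<integral>x. partial_d i F x \<partial>lborel)"
  proof (rule integral_dominated_convergence[where w = W])
    show "partial_d i F \<in> borel_measurable lborel" using pm by simp
    have [measurable]: "F \<in> borel_measurable borel" by (rule Fm)
    show "S n \<in> borel_measurable lborel" for n unfolding S_def by measurable
    show "integrable lborel W"
      unfolding W_def by (intro integrable_mult_right integrable_gs_weight) (use t in auto)
    show "AE x in lborel. (\<lambda>n. S n x) \<longlonglongrightarrow> partial_d i F x"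
    proof (rule AE_I2)
      fix x
      define D where "D = frechet_derivative F (at x)"
      have "(F has_derivative D) (at x)"
        unfolding D_def by (intro differentiable_has_derivative smooth_fun_differentiable F)
      then have D: "bounded_linear D" "(\<lambda>h. norm (F (x + h) - F x - D h) / norm h) \<midarrow>0\<rightarrow> 0"
        by (simp_all add: has_derivative_at)
      have "filterlim (\<lambda>n. h n *\<^sub>R e) (at 0) sequentially"
      proof (rule filterlim_atI)
        have "h \<longlonglongrightarrow> 0" unfolding h_def by (rule LIMSEQ_Suc[OF lim_1_over_n])
        then show "(\<lambda>n. h n *\<^sub>R e) \<longlonglongrightarrow> 0" using tendsto_scaleR[OF _ tendsto_const] by force
        show "\<forall>\<^sub>F n in sequentially. h n *\<^sub>R e \<noteq> 0"
          using h by (intro always_eventually allI) (simp add: e_def axis_eq_0_iff less_imp_neq[symmetric])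
      qed
      from filterlim_compose[OF D(2) this]
      have "(\<lambda>n. norm (F (x + h n *\<^sub>R e) - F x - D (h n *\<^sub>R e)) / norm (h n *\<^sub>R e)) \<longlonglongrightarrow> 0" .
      moreover have "norm (F (x + h n *\<^sub>R e) - F x - D (h n *\<^sub>R e)) / norm (h n *\<^sub>R e) = norm (S n x - partial_d i F x)" for n
      proof -
        have "D (h n *\<^sub>R e) = of_real (h n) * partial_d i F x"
          using linear_scale[OF bounded_linear.linear[OF D(1)], of "h n" e]
          unfolding scaleR_conv_of_real[where 'a=complex] by (simp add: partial_d_def D_def e_def)
        then have "F (x + h n *\<^sub>R e) - F x - D (h n *\<^sub>R e) = of_real (h n) * (S n x - partial_d i F x)"
        proof -
          have "of_real (h n) * S n x = F (x + h n *\<^sub>R e) - F x" using h[of n] by (simp add: S_def)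
          then show ?thesis unfolding right_diff_distrib
            using \<open>D (h n *\<^sub>R e) = of_real (h n) * partial_d i F x\<close> by simp
        qed
        moreover have "norm (h n *\<^sub>R e) = h n" using h[of n] by (simp add: e_def)
        ultimately show ?thesis using h[of n] by (simp add: norm_mult)
      qed
      ultimately have "(\<lambda>n. norm (S n x - partial_d i F x)) \<longlonglongrightarrow> 0" by simp
      then show "(\<lambda>n. S n x) \<longlonglongrightarrow> partial_d i F x"
        by (rule LIM_zero_cancel[OF tendsto_norm_zero_cancel])
    qed
    show "AE x in lborel. norm (S n x) \<le> W x" for n
    proof (rule AE_I2)
      fix x
      have "cmod (F (x + h n *\<^sub>R axis i 1) - F x) \<le> W x * h n"
      proof (rule norm_difference_le_partial)
        fix \<tau> assume \<tau>: "0 \<le> \<tau>" "\<tau> \<le> h n"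
        have "cmod (partial_d i F (x + \<tau> *\<^sub>R axis i 1)) \<le> C * gs_weight t r (x - (- \<tau> *\<^sub>R axis i 1))"
          using b1[of "x + \<tau> *\<^sub>R axis i 1"] by simp
        also have "\<dots> \<le> C * (exp (r * norm (- \<tau> *\<^sub>R axis i (1::real) :: real ^ 'n) powr (1 / t)) * gs_weight t (r / 2 powr (1 / t)) x)"
          using t by (intro mult_left_mono gs_weight_diff_le) auto
        also have "\<dots> \<le> C * (exp (r * 1) * gs_weight t (r / 2 powr (1 / t)) x)"
        proof -
          have "norm (- \<tau> *\<^sub>R axis i (1::real) :: real ^ 'n) powr (1 / t) \<le> 1"
            using \<tau> h[of n] t by (simp add: powr_le1)
          then show ?thesis using t by (intro mult_left_mono mult_right_mono) auto
        qed
        finally show "cmod (partial_d i F (x + \<tau> *\<^sub>R axis i 1)) \<le> W x" by (simp add: W_def)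
      qed (use h[of n] F smooth_fun_differentiable in auto)
      then show "norm (S n x) \<le> W x" using h[of n] by (simp add: S_def norm_divide divide_le_eq e_def)
    qed
  qed
  then have "(\<lambda>n. 0) \<longlonglongrightarrow> (\<integral>x. partial_d i F x \<partial>lborel)" by (simp add: S0)
  then show ?thesis by (simp add: LIMSEQ_const_iff)
qed

definition fint :: "(real ^ 'n::finite \<Rightarrow> complex) \<Rightarrow> real ^ 'n \<Rightarrow> complex" where
  "fint F \<xi> = (\<integral>x. F x * expi (- \<xi>) x \<partial>lborel)"

lemma fint_bound:
  fixes F :: "real ^ 'n::finite \<Rightarrow> complex"
  assumes "0 < t" "0 < r" "F \<in> borel_measurable borel" "\<And>x. cmod (F x) \<le> C * gs_weight t r x"
  shows "cmod (fint F \<xi>) \<le> C * (\<integral>x. gs_weight t r (x :: real ^ 'n) \<partial>lborel)"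
  unfolding fint_def
proof (rule integrable_weight_bound[OF assms(1,2)])
  have [measurable]: "expi (- \<xi>) \<in> borel_measurable borel" using smooth_fun_measurable[OF smooth_expi] .
  have [measurable]: "F \<in> borel_measurable borel" by (rule assms)
  show "(\<lambda>x. F x * expi (- \<xi>) x) \<in> borel_measurable borel" by measurable
qed (use assms in \<open>simp add: norm_mult\<close>)

lemma fint_iter_partial:
  fixes F :: "real ^ 'n::finite \<Rightarrow> complex"
  assumes F: "smooth_fun F" "gevrey_le s h (\<lambda>x. B * gs_weight t r x) F" and t: "0 < t" "0 < r" "0 < h"
  shows "fint (iter_partial js F) \<xi> = (\<Prod>j\<leftarrow>js. \<i> * of_real (\<xi> $ j)) * fint F \<xi>"
proof (induction js)
  case (Cons i js)
  define G where "G = iter_partial js F"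
  have B: "B \<ge> 0" using gevrey_le_nonneg[OF F(2), of 0] gs_weight_pos[of t r "0 :: real ^ 'n"]
    by (simp add: zero_le_mult_iff)
  have G: "smooth_fun G" unfolding G_def by (rule smooth_fun_iter[OF F(1)])
  have c: "\<exists>C\<ge>0. \<forall>x. cmod (iter_partial ks F x) \<le> C * gs_weight t r x" for ks
    using gevrey_leD[OF F(2), of ks] B t
    by (intro exI[of _ "B * h ^ length ks * fact (length ks) powr s"]) (auto simp: mult_ac)
  obtain C0 where C0: "C0 \<ge> 0" "\<And>x. cmod (G x) \<le> C0 * gs_weight t r x"
    using c[of js] by (auto simp: G_def)
  obtain C1 where C1: "C1 \<ge> 0" "\<And>x. cmod (partial_d i G x) \<le> C1 * gs_weight t r x"
    using c[of "i # js"] by (auto simp: G_def)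
  have e: "smooth_fun (expi (- \<xi>))" by (rule smooth_expi)
  have pd: "partial_d i (\<lambda>x. G x * expi (- \<xi>) x) =
    (\<lambda>x. partial_d i G x * expi (- \<xi>) x + (- \<i> * of_real (\<xi> $ i)) * (G x * expi (- \<xi>) x))"
    by (subst partial_d_mult) (auto simp: partial_d_expi smooth_fun_differentiable G e)
  define K where "K = C0 + C1 + \<bar>\<xi> $ i\<bar> * C0"
  have K: "C0 \<le> K" "C1 + \<bar>\<xi> $ i\<bar> * C0 \<le> K" "0 \<le> K" using C0(1) C1(1) by (auto simp: K_def)
  have "(\<integral>x. partial_d i (\<lambda>x. G x * expi (- \<xi>) x) x \<partial>lborel) = 0"
  proof (rule integral_partial_d_eq_0[OF smooth_mult[OF G e] t(1,2) K(3)])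
    fix x
    show "cmod (G x * expi (- \<xi>) x) \<le> K * gs_weight t r x"
      using order_trans[OF C0(2)[of x] mult_right_mono[OF K(1)]] by (simp add: norm_mult)
    have "cmod (partial_d i (\<lambda>x. G x * expi (- \<xi>) x) x) \<le> cmod (partial_d i G x) + \<bar>\<xi> $ i\<bar> * cmod (G x)"
      unfolding pd by (rule order_trans[OF norm_triangle_ineq]) (simp add: norm_mult)
    also have "\<dots> \<le> C1 * gs_weight t r x + \<bar>\<xi> $ i\<bar> * (C0 * gs_weight t r x)"
      by (intro add_mono mult_left_mono C0 C1) auto
    also have "\<dots> = (C1 + \<bar>\<xi> $ i\<bar> * C0) * gs_weight t r x" by (simp add: algebra_simps)
    also have "\<dots> \<le> K * gs_weight t r x" by (intro mult_right_mono K) auto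
    finally show "cmod (partial_d i (\<lambda>x. G x * expi (- \<xi>) x) x) \<le> K * gs_weight t r x" .
  qed
  moreover have "integrable lborel (\<lambda>x. partial_d i G x * expi (- \<xi>) x)"
    by (rule integrable_weight_bound(1)[OF t(1,2), where C = C1])
       (use C1 smooth_fun_measurable[OF smooth_mult[OF smooth_fun_partial[OF G] e]] in \<open>auto simp: norm_mult\<close>)
  moreover have "integrable lborel (\<lambda>x. G x * expi (- \<xi>) x)"
    by (rule integrable_weight_bound(1)[OF t(1,2), where C = C0])
       (use C0 smooth_fun_measurable[OF smooth_mult[OF G e]] in \<open>auto simp: norm_mult\<close>)
  ultimately have "fint (partial_d i G) \<xi> + (- \<i> * of_real (\<xi> $ i)) * fint G \<xi> = 0"
    unfolding pd fint_def by (subst (asm) Bochner_Integration.integral_add) auto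
  then have "fint (partial_d i G) \<xi> = \<i> * of_real (\<xi> $ i) * fint G \<xi>"
    by (simp add: add_eq_0_iff)
  then show ?case using Cons by (simp add: G_def mult_ac)
qed simp

lemma prod_list_replicate: "(\<Prod>j\<leftarrow>replicate n i. f j) = f i ^ n"
  by (induction n) auto

lemma fourier_decay:
  assumes "0 < s" "0 < t" "0 < q" "0 < r"
  obtains h C where "0 < h" "0 < C" "\<And>(F :: real ^ 'n::finite \<Rightarrow> complex) B \<xi>. smooth_fun F \<Longrightarrow>
    gevrey_le s h (\<lambda>x. B * gs_weight t q x) F \<Longrightarrow> cmod (fint F \<xi>) * exp (r * norm \<xi> powr (1 / s)) \<le> C * B"
proof -
  define d where "d = real CARD('n)"
  have d: "d \<ge> 1" using one_le_card_finite[where 'a='n] by (simp add: d_def)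
  define hE where "hE = (s / (2 * r)) powr s"
  have hE: "hE > 0" using assms by (simp add: hE_def)
  define h where "h = hE / d"
  have h: "h > 0" "d * h = hE" using hE d by (auto simp: h_def)
  define W where "W = (\<integral>x. gs_weight t q (x :: real ^ 'n) \<partial>lborel)"
  have W: "W \<ge> 0" unfolding W_def by (rule integral_nonneg_AE) auto
  have "cmod (fint F \<xi>) * exp (r * norm \<xi> powr (1 / s)) \<le> (2 powr s * (W + 1)) * B"
    if F: "smooth_fun F" "gevrey_le s h (\<lambda>x. B * gs_weight t q x) F" for F :: "real ^ 'n \<Rightarrow> complex" and B \<xi>
  proof -
    have B: "B \<ge> 0" using gevrey_le_nonneg[OF F(2), of 0] gs_weight_pos[of t q "0 :: real ^ 'n"]
      by (simp add: zero_le_mult_iff)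
    obtain i where i: "norm \<xi> \<le> d * \<bar>\<xi> $ i\<bar>" using norm_le_card_component d_def by metis
    have "cmod (fint F \<xi>) * exp (r * norm \<xi> powr (1 / s)) \<le> 2 powr s * (B * W)"
    proof (rule moments_imp_exp_decay)
      fix m
      have "norm \<xi> ^ m \<le> d ^ m * \<bar>\<xi> $ i\<bar> ^ m"
        using power_mono[OF i, of m] by (simp add: power_mult_distrib)
      then have "cmod (fint F \<xi>) * norm \<xi> ^ m \<le> cmod (fint F \<xi>) * (d ^ m * \<bar>\<xi> $ i\<bar> ^ m)"
        by (intro mult_left_mono) auto
      also have "\<dots> = d ^ m * cmod (fint (iter_partial (replicate m i) F) \<xi>)"
        by (simp add: fint_iter_partial[OF F assms(2,3) h(1)] prod_list_replicate norm_mult norm_power power_mult_distrib)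
      also have "\<dots> \<le> d ^ m * ((B * h ^ m * fact m powr s) * W)"
      proof (rule mult_left_mono)
        show "cmod (fint (iter_partial (replicate m i) F) \<xi>) \<le> (B * h ^ m * fact m powr s) * W"
          unfolding W_def
        proof (rule fint_bound[OF assms(2,3)])
          show "iter_partial (replicate m i) F \<in> borel_measurable borel"
            by (rule smooth_fun_measurable[OF smooth_fun_iter[OF F(1)]])
          show "cmod (iter_partial (replicate m i) F x) \<le> B * h ^ m * fact m powr s * gs_weight t q x" for x
            using gevrey_leD[OF F(2), of "replicate m i" x] by (simp add: mult_ac)
        qed
      qed (use d in simp)
      also have "\<dots> = (B * W) * (d * h) ^ m * fact m powr s" by (simp add: power_mult_distrib mult_ac)
      finally show "cmod (fint F \<xi>) * norm \<xi> ^ m \<le> (B * W) * ((s / (2 * r)) powr s) ^ m * fact m powr s"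
        by (simp add: h(2) hE_def)
    qed (use assms B W in auto)
    also have "\<dots> \<le> 2 powr s * (B * (W + 1))"
      using B by (intro mult_left_mono) auto
    finally show ?thesis by (simp add: mult_ac)
  qed
  then show ?thesis using h(1) W by (intro that[of h "2 powr s * (W + 1)"]) auto
qed

lemma L2_pairing_eq_fint: "L2_pairing f (\<lambda>x. a x * expi \<xi> x) = fint (\<lambda>x. f x * cnj (a x)) \<xi>"
  by (simp add: L2_pairing_def fint_def cnj_expi mult_ac)

subsection \<open>Continuous functionals\<close>

lemma GS_seminorm_antimono:
  assumes "0 < h" "h \<le> h'"
  shows "GS_seminorm t s h' f \<le> GS_seminorm t s h f"
  unfolding GS_seminorm_def
proof (intro SUP_mono' ennreal_leI divide_left_mono mult_right_mono power_mono)
  fix \<alpha> \<beta> :: "nat ^ 'a" and x :: "real ^ 'a"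
  show "0 < h' ^ mi_order (\<alpha> + \<beta>) * mi_fact \<alpha> powr t * mi_fact \<beta> powr s *
      (h ^ mi_order (\<alpha> + \<beta>) * mi_fact \<alpha> powr t * mi_fact \<beta> powr s)"
    using assms mi_fact_ge_1[of \<alpha>] mi_fact_ge_1[of \<beta>] by simp
qed (use assms in auto)

lemma mi_D_add:
  assumes "smooth_fun f" "smooth_fun g"
  shows "mi_D \<beta> (\<lambda>x. f x + g x) x = mi_D \<beta> f x + mi_D \<beta> g x"
  using iter_partial_lincomb[OF assms, of _ 1 1] by (simp add: mi_D_def mi_deriv_def distrib_left)

lemma GS_seminorm_triangle:
  fixes f g :: "real ^ 'n::finite \<Rightarrow> complex"
  assumes "smooth_fun f" "smooth_fun g" "0 < h"
  shows "GS_seminorm t s h (\<lambda>x. f x + g x) \<le> GS_seminorm t s h f + GS_seminorm t s h g"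
proof -
  have "ennreal (cmod (mi_monom x \<alpha> * mi_D \<beta> (\<lambda>x. f x + g x) x) / w) \<le>
      GS_seminorm t s h f + GS_seminorm t s h g"
    if w: "w = h ^ mi_order (\<alpha> + \<beta>) * mi_fact \<alpha> powr t * mi_fact \<beta> powr s" for \<alpha> \<beta> x w
  proof -
    have w0: "w \<ge> 0" using assms by (simp add: w)
    have "cmod (mi_monom x \<alpha> * mi_D \<beta> (\<lambda>x. f x + g x) x) / w \<le>
       cmod (mi_monom x \<alpha> * mi_D \<beta> f x) / w + cmod (mi_monom x \<alpha> * mi_D \<beta> g x) / w"
      unfolding mi_D_add[OF assms(1,2)] distrib_left add_divide_distrib[symmetric]
      by (intro divide_right_mono norm_triangle_ineq w0)
    then have "ennreal (cmod (mi_monom x \<alpha> * mi_D \<beta> (\<lambda>x. f x + g x) x) / w) \<le>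
       ennreal (cmod (mi_monom x \<alpha> * mi_D \<beta> f x) / w) + ennreal (cmod (mi_monom x \<alpha> * mi_D \<beta> g x) / w)"
      unfolding ennreal_plus[symmetric, OF divide_nonneg_nonneg[OF norm_ge_zero w0] divide_nonneg_nonneg[OF norm_ge_zero w0]]
      by (rule ennreal_leI)
    also have "\<dots> \<le> GS_seminorm t s h f + GS_seminorm t s h g"
      unfolding w GS_seminorm_def
      by (intro add_mono SUP_upper2[OF UNIV_I]) (rule order_refl)+
    finally show ?thesis .
  qed
  then show ?thesis unfolding GS_seminorm_def[of t s h "\<lambda>x. f x + g x"] by (intro SUP_least) simp
qed

lemma GS_seminorm_0: "GS_seminorm t s h (\<lambda>x. 0) = 0"
  by (simp add: GS_seminorm_def mi_D_def mi_deriv_def iter_partial_const if_distrib cong: if_cong)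

lemma GS_space_0: "0 < t \<Longrightarrow> 0 < s \<Longrightarrow> (\<lambda>x. 0) \<in> GS_space t s"
  by (simp add: GS_space_def GS_seminorm_0)

lemma GS_open_nhd_0:
  assumes "openin (GS_topology t s) V" "(\<lambda>x. 0) \<in> V"
  shows "\<exists>h>0. \<exists>e>0. \<forall>g\<in>GS_space t s. GS_seminorm t s h g < e \<longrightarrow> g \<in> V"
proof -
  have "generate_topology_on {{g \<in> GS_space t s. GS_seminorm t s h (\<lambda>x. g x - f x) < e} |
      f h e. f \<in> GS_space t s \<and> h \<in> {0<..} \<and> 0 < e} V"
    using assms(1) unfolding GS_topology_def seminorm_topology_def openin_topology_generated_by_iff .
  then show ?thesis using assms(2)
  proof (induction V rule: generate_topology_on.induct)
    case (Int a b)
    have "(\<lambda>x. 0) \<in> a" "(\<lambda>x. 0) \<in> b" using Int.prems by auto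
    from Int.IH(1)[OF this(1)] Int.IH(2)[OF this(2)]
    obtain h e h' e' where *: "h > 0" "e > 0" "\<forall>g\<in>GS_space t s. GS_seminorm t s h g < e \<longrightarrow> g \<in> a"
      "h' > 0" "e' > 0" "\<forall>g\<in>GS_space t s. GS_seminorm t s h' g < e' \<longrightarrow> g \<in> b"
      by auto
    have "\<forall>g\<in>GS_space t s. GS_seminorm t s (min h h') g < min e e' \<longrightarrow> g \<in> a \<inter> b"
    proof (intro ballI impI)
      fix g :: "real ^ 'a \<Rightarrow> complex"
      assume g: "g \<in> GS_space t s" "GS_seminorm t s (min h h') g < min e e'"
      have "GS_seminorm t s h g \<le> GS_seminorm t s (min h h') g" "GS_seminorm t s h' g \<le> GS_seminorm t s (min h h') g"
        using * by (auto intro: GS_seminorm_antimono)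
      with g(2) have "GS_seminorm t s h g < e" "GS_seminorm t s h' g < e'"
        by (auto intro: order_le_less_trans)
      with * g(1) show "g \<in> a \<inter> b" by blast
    qed
    moreover have "min h h' > 0" "min e e' > 0" using * by auto
    ultimately show ?case by blast
  next
    case (UN K)
    then obtain k where "k \<in> K" "(\<lambda>x. 0) \<in> k" by auto
    from UN.IH[OF this] \<open>k \<in> K\<close> show ?case by (meson UnionI)
  next
    case (Basis V)
    then obtain f h e where V: "V = {g \<in> GS_space t s. GS_seminorm t s h (\<lambda>x. g x - f x) < e}"
      and f: "f \<in> GS_space t s" "h > 0" by auto
    define p where "p = GS_seminorm t s h (\<lambda>x. 0 - f x)"
    have p: "p < e" using Basis(2) by (simp add: V p_def)
    have sm: "smooth_fun (\<lambda>x. 0 - f x)"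
      using smooth_lincomb[OF GS_space_smooth[OF f(1)] smooth_const, of "-1" 0 0] by simp
    have "\<forall>g\<in>GS_space t s. GS_seminorm t s h g < e - p \<longrightarrow> g \<in> V"
    proof (intro ballI impI)
      fix g :: "real ^ 'a \<Rightarrow> complex" assume g: "g \<in> GS_space t s" "GS_seminorm t s h g < e - p"
      have "GS_seminorm t s h (\<lambda>x. g x + (0 - f x)) \<le> GS_seminorm t s h g + p"
        unfolding p_def by (rule GS_seminorm_triangle[OF GS_space_smooth[OF g(1)] sm f(2)])
      also have "\<dots> < e" using g(2) p by (subst (asm) less_diff_eq_ennreal) (auto simp: less_top[symmetric])
      finally show "g \<in> V" using g by (simp add: V)
    qed
    moreover have "e - p > 0" using p by (simp add: diff_gr0_ennreal)
    ultimately show ?case using f(2) by blast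
  qed auto
qed

lemma antilinear_onD:
  "antilinear_on V u \<Longrightarrow> f \<in> V \<Longrightarrow> g \<in> V \<Longrightarrow> u (\<lambda>x. a * f x + b * g x) = cnj a * u f + cnj b * u g"
  by (simp add: antilinear_on_def)

lemma antilinear_on_0:
  assumes "antilinear_on V u" "f \<in> V" shows "u (\<lambda>x. 0) = 0"
  using antilinear_onD[OF assms(1,2,2), of 0 0] by simp

lemma antilinear_on_scale:
  assumes "antilinear_on V u" "f \<in> V" shows "u (\<lambda>x. a * f x) = cnj a * u f"
  using antilinear_onD[OF assms(1,2,2), of a 0] by simp

lemma GS_dual_bound:
  fixes u :: "(real ^ 'n::finite \<Rightarrow> complex) \<Rightarrow> complex"
  assumes u: "u \<in> GS_dual t s" and ts: "0 < t" "0 < s"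
  obtains h r M where "0 < h" "0 < r" "0 < M" "\<And>\<phi> C. \<phi> \<in> GS_space t s \<Longrightarrow>
    gevrey_le s h (\<lambda>x. C * gs_weight t r x) \<phi> \<Longrightarrow> cmod (u \<phi>) \<le> M * C"
proof -
  have al: "antilinear_on (GS_space t s) u" and cont: "continuous_map (GS_topology t s) euclidean u"
    using u by (auto simp: GS_dual_def)
  have u0: "u (\<lambda>x. 0) = 0" using antilinear_on_0[OF al GS_space_0[OF ts]] .
  define V where "V = {g \<in> topspace (GS_topology t s). u g \<in> ball 0 1}"
  have "openin (GS_topology t s) V"
    unfolding V_def by (rule openin_continuous_map_preimage[OF cont]) simp
  moreover have "(\<lambda>x. 0) \<in> V"
  proof -
    have "(\<lambda>x. 0) \<in> {g \<in> GS_space t s. GS_seminorm t s 1 (\<lambda>x. g x - 0) < 1}"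
      using GS_space_0[OF ts] by (simp add: GS_seminorm_0)
    then have "(\<lambda>x. 0) \<in> topspace (GS_topology t s)"
      unfolding GS_topology_def seminorm_topology_def topology_generated_by_topspace
      using GS_space_0[OF ts, where 'a='n] by (intro UnionI[of "{g \<in> GS_space t s. GS_seminorm t s 1 (\<lambda>x. g x - 0) < 1}"] CollectI exI conjI) auto
    then show ?thesis by (simp add: V_def u0)
  qed
  ultimately have "\<exists>h>0. \<exists>e>0. \<forall>g\<in>GS_space t s. GS_seminorm t s h g < e \<longrightarrow> g \<in> V"
    by (rule GS_open_nhd_0)
  then obtain k e where k: "k > 0" and e: "e > 0" and
    V: "\<And>g. g \<in> GS_space t s \<Longrightarrow> GS_seminorm t s k g < e \<Longrightarrow> g \<in> V"
    by auto
  obtain \<delta> :: real where \<delta>: "\<delta> > 0" "ennreal \<delta> < e"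
  proof -
    obtain y where y: "0 < y" "y < e" using dense[OF e] by blast
    then have "y < top" using order_less_le_trans[OF y(2) top_greatest] by simp
    then obtain z where "y = ennreal z" "z \<ge> 0" by (cases y) auto
    with y show ?thesis by (intro that[of z]) auto
  qed
  obtain h r where hr: "0 < h" "0 < r" and le: "\<And>(f :: real ^ 'n \<Rightarrow> complex) C. smooth_fun f \<Longrightarrow>
     gevrey_le s h (\<lambda>x. C * gs_weight t r x) f \<Longrightarrow> GS_seminorm t s k f \<le> ennreal C"
    using GS_seminorm_le[OF ts k] by blast
  have bound: "cmod (u \<phi>) \<le> (1 / \<delta>) * C"
    if \<phi>: "\<phi> \<in> GS_space t s" "gevrey_le s h (\<lambda>x. C * gs_weight t r x) \<phi>" for \<phi> C
  proof -
    have C: "C \<ge> 0" using gevrey_le_nonneg[OF \<phi>(2), of 0] gs_weight_pos[of t r "0 :: real ^ 'n"]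
      by (simp add: zero_le_mult_iff)
    have sm: "smooth_fun \<phi>" by (rule GS_space_smooth[OF \<phi>(1)])
    have main: "cmod (u \<phi>) \<le> (1 / \<delta>) * D" if D: "D > 0" "C \<le> D" for D
    proof -
      define c where "c = \<delta> / D"
      have c: "c > 0" using D \<delta> by (simp add: c_def)
      define g where "g = (\<lambda>x. of_real c * \<phi> x)"
      have g: "g \<in> GS_space t s"
        using GS_space_lincomb[OF \<phi>(1) \<phi>(1) ts, of "of_real c" 0] by (simp add: g_def)
      have "gevrey_le s h (\<lambda>x. cmod (of_real c) * (C * gs_weight t r x) + cmod 0 * (C * gs_weight t r x))
          (\<lambda>x. of_real c * \<phi> x + 0 * \<phi> x)"
        by (rule gevrey_le_lincomb[OF sm sm \<phi>(2) \<phi>(2)])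
      then have "gevrey_le s h (\<lambda>x. (c * C) * gs_weight t r x) g"
        using c by (simp add: g_def mult_ac)
      from le[OF GS_space_smooth[OF g] this] have "GS_seminorm t s k g \<le> ennreal (c * C)" .
      also have "\<dots> \<le> ennreal \<delta>"
        using D C \<delta> by (intro ennreal_leI) (simp add: c_def field_simps)
      also have "\<dots> < e" by (rule \<delta>)
      finally have "g \<in> V" by (rule V[OF g])
      then have "cmod (u g) < 1" by (simp add: V_def)
      moreover have "u g = of_real c * u \<phi>"
        using antilinear_on_scale[OF al \<phi>(1), of "of_real c"] by (simp add: g_def)
      ultimately have "c * cmod (u \<phi>) < 1" using c by (simp add: norm_mult)
      then show ?thesis using D \<delta> by (simp add: c_def field_simps)
    qed
    have "cmod (u \<phi>) \<le> (1 / \<delta>) * C + \<epsilon>" if "\<epsilon> > 0" for \<epsilon>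
    proof -
      have "cmod (u \<phi>) \<le> (1 / \<delta>) * (C + \<delta> * \<epsilon>)" using C \<delta> that by (intro main) (auto simp: add_nonneg_pos)
      then show ?thesis using \<delta> by (simp add: field_simps)
    qed
    then show ?thesis by (rule field_le_epsilon)
  qed
  show ?thesis by (rule that[OF hr _ bound]) (use \<delta> in simp)
qed

lemma L2_pairing_bound:
  fixes f :: "real ^ 'n::finite \<Rightarrow> complex"
  assumes f: "f \<in> GS_space t s" and ts: "0 < t" "0 < s"
  obtains M where "0 < M" "\<And>\<phi> C. \<phi> \<in> borel_measurable borel \<Longrightarrow> (\<And>x. cmod (\<phi> x) \<le> C) \<Longrightarrow>
    integrable lborel (\<lambda>x. f x * cnj (\<phi> x)) \<and> cmod (L2_pairing f \<phi>) \<le> M * C"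
proof -
  obtain A where A: "A > 0" "gevrey_le s 1 (\<lambda>x. A * gs_weight t 1 x) f"
    using GS_space_weightE[OF f ts, of 1 1] by auto
  define W where "W = (\<integral>x. gs_weight t 1 (x :: real ^ 'n) \<partial>lborel)"
  have W: "W \<ge> 0" unfolding W_def by (rule integral_nonneg_AE) auto
  have [measurable]: "f \<in> borel_measurable borel" by (rule smooth_fun_measurable[OF GS_space_smooth[OF f]])
  show ?thesis
  proof (rule that[of "A * (W + 1)"])
    fix \<phi> :: "real ^ 'n \<Rightarrow> complex" and C
    assume [measurable]: "\<phi> \<in> borel_measurable borel" and C: "\<And>x. cmod (\<phi> x) \<le> C"
    have C0: "C \<ge> 0" using C[of 0] norm_ge_zero order_trans by blast
    have [measurable]: "cnj \<in> borel_measurable borel"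
      by (intro borel_measurable_continuous_onI continuous_intros)
    have m: "(\<lambda>x. f x * cnj (\<phi> x)) \<in> borel_measurable borel" by measurable
    have b: "cmod (f x * cnj (\<phi> x)) \<le> (A * C) * gs_weight t 1 x" for x
    proof -
      have "cmod (f x) * cmod (\<phi> x) \<le> (A * gs_weight t 1 x) * C"
        by (intro mult_mono gevrey_le_cmod[OF A(2)] C) (use A in auto)
      then show ?thesis by (simp add: norm_mult mult_ac)
    qed
    have "cmod (L2_pairing f \<phi>) \<le> (A * C) * W"
      unfolding L2_pairing_def W_def by (rule integrable_weight_bound(2)[OF ts(1) zero_less_one m b])
    also have "\<dots> \<le> A * (W + 1) * C" using A C0 by (simp add: algebra_simps)
    finally show "integrable lborel (\<lambda>x. f x * cnj (\<phi> x)) \<and> cmod (L2_pairing f \<phi>) \<le> A * (W + 1) * C"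
      using integrable_weight_bound(1)[OF ts(1) zero_less_one m b] by blast
  qed (use A W in simp)
qed

lemma L2_pairing_lincomb:
  assumes "f \<in> GS_space t s" "0 < t" "0 < s" "gevrey_bdd s \<phi>" "gevrey_bdd s \<psi>"
  shows "L2_pairing f (\<lambda>x. a * \<phi> x + b * \<psi> x) = cnj a * L2_pairing f \<phi> + cnj b * L2_pairing f \<psi>"
proof -
  have int: "integrable lborel (\<lambda>x. f x * cnj (\<phi> x))" if \<phi>: "gevrey_bdd s \<phi>" for \<phi>
  proof -
    obtain M where "0 < M" and M: "\<And>\<phi> C. \<phi> \<in> borel_measurable borel \<Longrightarrow> (\<And>x. cmod (\<phi> x) \<le> C) \<Longrightarrow>
      integrable lborel (\<lambda>x. f x * cnj (\<phi> x)) \<and> cmod (L2_pairing f \<phi>) \<le> M * C"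
      by (rule L2_pairing_bound[OF assms(1-3)]) blast
    obtain C where "gevrey_le s 1 (\<lambda>_. C) \<phi>" using gevrey_bddD[OF \<phi>, of 1] by auto
    then show ?thesis
      using M[OF smooth_fun_measurable[OF gevrey_bdd_smooth[OF \<phi>]]] gevrey_le_cmod by blast
  qed
  have "L2_pairing f (\<lambda>x. a * \<phi> x + b * \<psi> x) =
      (\<integral>x. cnj a * (f x * cnj (\<phi> x)) + cnj b * (f x * cnj (\<psi> x)) \<partial>lborel)"
    unfolding L2_pairing_def by (intro Bochner_Integration.integral_cong) (auto simp: algebra_simps)
  also have "\<dots> = cnj a * L2_pairing f \<phi> + cnj b * L2_pairing f \<psi>"
    unfolding L2_pairing_def
    by (subst Bochner_Integration.integral_add) (auto intro!: integrable_mult_right int assms)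
  finally show ?thesis .
qed

subsection \<open>Supports and cutoffs\<close>

text \<open>Instead of a partition of unity: splitting off the cutoffs one after the other leaves the
  product of all \<open>1 - \<kappa>\<close> times \<open>\<phi>\<close>, which vanishes.\<close>

lemma ultra_supp_vanish:
  fixes v :: "(real ^ 'n::finite \<Rightarrow> complex) \<Rightarrow> complex"
  assumes s: "1 < s" and v: "antilinear_on (Gevrey_c s) v"
    and \<phi>: "\<phi> \<in> Gevrey_c s" "fun_supp \<phi> \<inter> ultra_supp s v = {}"
  shows "v \<phi> = 0"
proof -
  have "\<exists>\<kappa> r'. \<kappa> \<in> Gevrey_c s \<and> r' > 0 \<and> (\<forall>x\<in>ball y r'. \<kappa> x = 1) \<and>
      (\<forall>\<psi>\<in>Gevrey_c s. fun_supp \<psi> \<subseteq> fun_supp \<kappa> \<longrightarrow> v \<psi> = 0)" if "y \<in> fun_supp \<phi>" for y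
  proof -
    have "y \<notin> ultra_supp s v" using that \<phi>(2) by blast
    then obtain \<Omega> where \<Omega>: "open \<Omega>" "y \<in> \<Omega>" "\<forall>\<phi>\<in>Gevrey_c s. fun_supp \<phi> \<subseteq> \<Omega> \<longrightarrow> v \<phi> = 0"
      unfolding ultra_supp_def by blast
    obtain r where r: "r > 0" "cball y r \<subseteq> \<Omega>" using \<Omega> open_contains_cball by blast
    obtain \<kappa> r' where "\<kappa> \<in> Gevrey_c s" "0 < r'" "\<And>x. x \<in> ball y r' \<Longrightarrow> \<kappa> x = 1" "fun_supp \<kappa> \<subseteq> cball y r"
      using exists_cutoff_ball[OF s r(1)] by metis
    moreover then have "\<forall>\<psi>\<in>Gevrey_c s. fun_supp \<psi> \<subseteq> fun_supp \<kappa> \<longrightarrow> v \<psi> = 0"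
      using \<Omega>(3) r(2) by (meson order_trans)
    ultimately show ?thesis by blast
  qed
  then obtain \<kappa> \<rho> where \<kappa>: "\<And>y. y \<in> fun_supp \<phi> \<Longrightarrow> \<kappa> y \<in> Gevrey_c s \<and> \<rho> y > 0 \<and>
      (\<forall>x\<in>ball y (\<rho> y). \<kappa> y x = 1) \<and> (\<forall>\<psi>\<in>Gevrey_c s. fun_supp \<psi> \<subseteq> fun_supp (\<kappa> y) \<longrightarrow> v \<psi> = 0)"
    by metis
  have "fun_supp \<phi> \<subseteq> (\<Union>y\<in>fun_supp \<phi>. ball y (\<rho> y))"
    using \<kappa> by (auto intro!: centre_in_ball[THEN iffD2])
  then obtain Y where Y: "Y \<subseteq> fun_supp \<phi>" "finite Y" "fun_supp \<phi> \<subseteq> (\<Union>y\<in>Y. ball y (\<rho> y))"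
    using compactE_image[OF Gevrey_c_supp[OF \<phi>(1)], of "fun_supp \<phi>" "\<lambda>y. ball y (\<rho> y)"] by blast
  have "v \<psi> = 0" if "Z \<subseteq> Y" "\<psi> \<in> Gevrey_c s" "fun_supp \<psi> \<subseteq> (\<Union>y\<in>Z. ball y (\<rho> y))" for Z \<psi>
  proof -
    have "finite Z" using that Y finite_subset by blast
    then show ?thesis using that
    proof (induction Z arbitrary: \<psi> rule: finite_induct)
      case empty
      then have "\<psi> = (\<lambda>x. 0)" using in_fun_supp by fastforce
      then show ?case using antilinear_on_0[OF v empty(2)] by simp
    next
      case (insert y Z)
      have y: "\<kappa> y \<in> Gevrey_c s" "\<And>x. x \<in> ball y (\<rho> y) \<Longrightarrow> \<kappa> y x = 1"
        "\<And>\<psi>. \<psi> \<in> Gevrey_c s \<Longrightarrow> fun_supp \<psi> \<subseteq> fun_supp (\<kappa> y) \<Longrightarrow> v \<psi> = 0"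
        using \<kappa>[of y] insert.prems(1) Y(1) by auto
      define \<psi>1 \<psi>2 where "\<psi>1 x = \<psi> x * \<kappa> y x" and "\<psi>2 x = \<psi> x * (1 * 1 + (-1) * \<kappa> y x)" for x
      have b: "gevrey_bdd s (\<kappa> y)" using Gevrey_c_gevrey_bdd[OF y(1)] s by simp
      have m: "\<psi>1 \<in> Gevrey_c s" "\<psi>2 \<in> Gevrey_c s"
        unfolding \<psi>1_def \<psi>2_def using s
        by (intro Gevrey_c_mult insert.prems b gevrey_bdd_lincomb gevrey_bdd_const; simp)+
      have "\<psi> = (\<lambda>x. 1 * \<psi>1 x + 1 * \<psi>2 x)" by (auto simp: \<psi>1_def \<psi>2_def algebra_simps)
      then have "v \<psi> = v \<psi>1 + v \<psi>2" using antilinear_onD[OF v m, of 1 1] by simp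
      moreover have "v \<psi>1 = 0"
        by (rule y(3)[OF m(1)]) (auto simp: \<psi>1_def intro: fun_supp_mono[THEN subsetD, rotated])
      moreover have "v \<psi>2 = 0"
      proof (rule insert.IH[OF _ m(2)])
        have "fun_supp \<psi>2 \<subseteq> fun_supp \<psi> - ball y (\<rho> y)"
        proof (rule fun_supp_subset_closed)
          show "closed (fun_supp \<psi> - ball y (\<rho> y))" by (intro closed_Diff closed_fun_supp open_ball)
          fix x assume "\<psi>2 x \<noteq> 0"
          then have "\<psi> x \<noteq> 0" "\<kappa> y x \<noteq> 1" by (auto simp: \<psi>2_def)
          then show "x \<in> fun_supp \<psi> - ball y (\<rho> y)" using in_fun_supp y(2) by blast
        qed
        then show "fun_supp \<psi>2 \<subseteq> (\<Union>y\<in>Z. ball y (\<rho> y))" using insert.prems(3) by blast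
      qed (use insert.prems in auto)
      ultimately show ?case by simp
    qed
  qed
  from this[OF order_refl \<phi>(1) Y(3)] show ?thesis .
qed

text \<open>Both sides are continuous on \<open>GS_space t s\<close>, and \<open>Gevrey_c s\<close> is dense there: the
  error committed by a cutoff at radius \<open>R\<close> is of size \<open>exp (- R powr (1 / t))\<close>.\<close>

lemma cutoff_identity:
  fixes u :: "(real ^ 'n::finite \<Rightarrow> complex) \<Rightarrow> complex"
  assumes s: "1 < s" and t: "0 < t" and u: "u \<in> GS_dual t s" and v: "antilinear_on (Gevrey_c s) v"
    and f: "f \<in> GS_space t s" and uv: "\<And>\<phi>. \<phi> \<in> Gevrey_c s \<Longrightarrow> u \<phi> = v \<phi> + L2_pairing f \<phi>"
    and \<kappa>: "\<kappa> \<in> Gevrey_c s" and N: "open N" "ultra_supp s v \<subseteq> N" "\<And>x. x \<in> N \<Longrightarrow> \<kappa> x = 1"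
    and g: "g \<in> GS_space t s"
  shows "u g = u (\<lambda>x. \<kappa> x * g x) - L2_pairing f (\<lambda>x. \<kappa> x * g x) + L2_pairing f g"
proof -
  have s0: "0 < s" "1 \<le> s" using s by auto
  define w where "w \<phi> = u \<phi> - L2_pairing f \<phi>" for \<phi>
  have al: "antilinear_on (GS_space t s) u" using u by (auto simp: GS_dual_def)
  have w_lin: "w (\<lambda>x. a * \<phi> x + b * \<psi> x) = cnj a * w \<phi> + cnj b * w \<psi>"
    if "\<phi> \<in> GS_space t s" "\<psi> \<in> GS_space t s" for a b \<phi> \<psi>
    unfolding w_def antilinear_onD[OF al that]
    using L2_pairing_lincomb[OF f t s0(1) GS_space_gevrey_bdd[OF that(1) t s0(1)] GS_space_gevrey_bdd[OF that(2) t s0(1)]]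
    by (simp add: algebra_simps)
  have wv: "w \<phi> = v \<phi>" if "\<phi> \<in> Gevrey_c s" for \<phi> using uv[OF that] by (simp add: w_def)
  obtain h r M1 where h: "0 < h" and r: "0 < r" and M1: "0 < M1" "\<And>\<phi> C. \<phi> \<in> GS_space t s \<Longrightarrow>
    gevrey_le s h (\<lambda>x. C * gs_weight t r x) \<phi> \<Longrightarrow> cmod (u \<phi>) \<le> M1 * C"
    using GS_dual_bound[OF u t s0(1)] by metis
  obtain M2 where M2: "0 < M2" "\<And>\<phi> C. \<phi> \<in> borel_measurable borel \<Longrightarrow> (\<And>x. cmod (\<phi> x) \<le> C) \<Longrightarrow>
    integrable lborel (\<lambda>x. f x * cnj (\<phi> x)) \<and> cmod (L2_pairing f \<phi>) \<le> M2 * C"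
    using L2_pairing_bound[OF f t s0(1)] by blast
  have wb: "cmod (w \<phi>) \<le> (M1 + M2) * C"
    if \<phi>: "\<phi> \<in> GS_space t s" "gevrey_le s h (\<lambda>x. C * gs_weight t r x) \<phi>" for \<phi> C
  proof -
    have C: "C \<ge> 0" using gevrey_le_nonneg[OF \<phi>(2), of 0] gs_weight_pos[of t r "0 :: real ^ 'n"]
      by (simp add: zero_le_mult_iff)
    have "cmod (\<phi> x) \<le> C" for x
      using gevrey_le_cmod[OF \<phi>(2), of x] mult_left_mono[OF gs_weight_le_1[of r t x] C] r by simp
    with M2(2)[OF smooth_fun_measurable[OF GS_space_smooth[OF \<phi>(1)]]]
    have "cmod (L2_pairing f \<phi>) \<le> M2 * C" by blast
    with M1(2)[OF \<phi>] show ?thesis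
      unfolding w_def by (intro order_trans[OF norm_triangle_ineq4]) (simp add: algebra_simps)
  qed
  obtain \<kappa>0 :: "real ^ 'n \<Rightarrow> complex" and B where \<kappa>0: "gevrey_bdd s \<kappa>0" "B > 0"
    "\<And>x. norm x \<le> 1 \<Longrightarrow> \<kappa>0 x = 1" "\<And>x. norm x \<ge> B \<Longrightarrow> \<kappa>0 x = 0"
    using exists_plateau[OF s] by metis
  have sm0: "smooth_fun \<kappa>0" by (rule gevrey_bdd_smooth[OF \<kappa>0(1)])
  obtain K where K: "K > 0" "gevrey_le s (h/2) (\<lambda>_. K) \<kappa>0" using gevrey_bddD[OF \<kappa>0(1), of "h/2"] h by auto
  obtain A where A: "A > 0" "gevrey_le s (h/2) (\<lambda>x. A * gs_weight t (r + 1) x) g"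
    using GS_space_weightE[OF g t s0(1), of "h/2" "r + 1"] h r by auto
  have smg: "smooth_fun g" by (rule GS_space_smooth[OF g])
  obtain R0 where R0: "R0 > 0" "fun_supp \<kappa> \<subseteq> cball 0 R0" using Gevrey_c_ball[OF \<kappa>] .
  have kg: "(\<lambda>x. \<kappa> x * g x) \<in> Gevrey_c s"
    by (rule Gevrey_c_mult[OF \<kappa> GS_space_gevrey_bdd[OF g t s0(1)] s0(2)])
  have main: "cmod (w g - w (\<lambda>x. \<kappa> x * g x)) \<le> (M1 + M2) * (A * (1 + K) * exp (- (R powr (1 / t))))"
    if R: "R \<ge> 1" "R \<ge> R0" for R
  proof -
    define \<kappa>R where "\<kappa>R x = \<kappa>0 ((1 / R) *\<^sub>R x + 0)" for x
    have smR: "smooth_fun \<kappa>R" unfolding \<kappa>R_def by (rule smooth_affine[OF sm0])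
    have R1: "\<kappa>R x = 1" if "norm x \<le> R" for x
      unfolding \<kappa>R_def using that R by (intro \<kappa>0(3)) simp
    have bR: "gevrey_bdd s \<kappa>R" unfolding \<kappa>R_def by (rule gevrey_bdd_affine[OF \<kappa>0(1)])
    have cR: "\<kappa>R \<in> Gevrey_c s"
    proof (rule Gevrey_cI[OF bR _ s0(1)])
      have "fun_supp \<kappa>R \<subseteq> cball 0 (R * B)"
      proof (rule fun_supp_subset_closed)
        fix x assume "\<kappa>R x \<noteq> 0"
        then have "norm ((1 / R) *\<^sub>R x) < B" using \<kappa>0(4)[of "(1 / R) *\<^sub>R x"] unfolding \<kappa>R_def by force
        then show "x \<in> cball 0 (R * B)" using R by (simp add: field_simps)
      qed simp
      then show "compact (fun_supp \<kappa>R)" by (rule compact_fun_supp[OF compact_cball])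
    qed
    have kR: "gevrey_le s (h/2) (\<lambda>_. K) \<kappa>R"
      unfolding \<kappa>R_def using gevrey_le_affine[OF sm0 K(2), of "1/R" "h/2" 0] R h by (simp add: field_simps)
    define gR where "gR = (\<lambda>x. \<kappa>R x * g x)"
    have gR: "gR \<in> Gevrey_c s" "gR \<in> GS_space t s"
    proof -
      show "gR \<in> Gevrey_c s" unfolding gR_def
        by (rule Gevrey_c_mult[OF cR GS_space_gevrey_bdd[OF g t s0(1)] s0(2)])
      then show "gR \<in> GS_space t s" by (rule Gevrey_c_subset_GS[OF _ s0(1) t])
    qed
    have "w gR = w (\<lambda>x. \<kappa> x * g x)"
    proof -
      define \<psi> where "\<psi> = (\<lambda>x. 1 * gR x + (-1) * (\<kappa> x * g x))"
      have \<psi>: "\<psi> \<in> Gevrey_c s" unfolding \<psi>_def by (rule Gevrey_c_lincomb[OF gR(1) kg s0(1)])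
      have "fun_supp \<psi> \<subseteq> - N"
      proof (rule fun_supp_subset_closed)
        show "closed (- N)" using N(1) by (simp add: closed_def)
        fix x assume "\<psi> x \<noteq> 0"
        show "x \<in> - N"
        proof
          assume "x \<in> N"
          then have "\<kappa> x = 1" by (rule N(3))
          then have "x \<in> fun_supp \<kappa>" by (intro in_fun_supp) simp
          then have "norm x \<le> R" using R0 R by auto
          then have "\<psi> x = 0" using \<open>\<kappa> x = 1\<close> R1 by (simp add: \<psi>_def gR_def)
          with \<open>\<psi> x \<noteq> 0\<close> show False by simp
        qed
      qed
      then have "v \<psi> = 0" using N(2) by (intro ultra_supp_vanish[OF s v \<psi>]) blast
      moreover have "v \<psi> = v gR - v (\<lambda>x. \<kappa> x * g x)"
        unfolding \<psi>_def using antilinear_onD[OF v gR(1) kg, of 1 "-1"] by simp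
      ultimately show ?thesis using wv[OF gR(1)] wv[OF kg] by simp
    qed
    moreover have "cmod (w g - w gR) \<le> (M1 + M2) * (A * (1 + K) * exp (- (R powr (1 / t))))"
    proof -
      define \<psi> where "\<psi> = (\<lambda>x. 1 * g x + (-1) * gR x)"
      have \<psi>: "\<psi> \<in> GS_space t s" unfolding \<psi>_def by (rule GS_space_lincomb[OF g gR(2) t s0(1)])
      have w\<psi>: "w \<psi> = w g - w gR" unfolding \<psi>_def using w_lin[OF g gR(2), of 1 "-1"] by simp
      have eq: "\<psi> = (\<lambda>x. (1 * 1 + (-1) * \<kappa>R x) * g x)"
        by (auto simp: \<psi>_def gR_def algebra_simps)
      have "gevrey_le s (h/2) (\<lambda>x. cmod 1 * cmod 1 + cmod (-1) * K) (\<lambda>x. 1 * 1 + (-1) * \<kappa>R x)"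
        by (rule gevrey_le_lincomb[OF smooth_const smR gevrey_le_const kR]) (use h in simp)
      from gevrey_le_mult[OF smooth_lincomb[OF smooth_const smR] smg this A(2) s0(2)] h
      have gl: "gevrey_le s h (\<lambda>x. (1 + K) * (A * gs_weight t (r + 1) x)) \<psi>"
        by (simp add: eq)
      have "gevrey_le s h (\<lambda>x. (A * (1 + K) * exp (- (R powr (1 / t)))) * gs_weight t r x) \<psi>"
        unfolding gevrey_le_def
      proof (intro allI)
        fix js x
        show "cmod (iter_partial js \<psi> x) \<le>
          (A * (1 + K) * exp (- (R powr (1 / t)))) * gs_weight t r x * h ^ length js * fact (length js) powr s"
        proof (cases "norm x < R")
          case True
          have "iter_partial js \<psi> x = iter_partial js (\<lambda>x. 0) x"
          proof (rule iter_partial_cong_open[of "ball 0 R"])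
            fix y :: "real ^ 'n" assume "y \<in> ball 0 R"
            then show "\<psi> y = 0" using R1[of y] by (simp add: \<psi>_def gR_def)
          qed (use True in auto)
          then show ?thesis using A K h by (simp add: iter_partial_const)
        next
          case False
          have "gs_weight t (r + 1) x = gs_weight t r x * exp (- (norm x powr (1 / t)))"
            by (simp add: gs_weight_def exp_add[symmetric] algebra_simps)
          also have "\<dots> \<le> gs_weight t r x * exp (- (R powr (1 / t)))"
            using False R t by (intro mult_left_mono) (auto intro!: powr_mono2)
          finally have "(1 + K) * A * gs_weight t (r + 1) x * (h ^ length js * fact (length js) powr s) \<le>
             (1 + K) * A * (gs_weight t r x * exp (- (R powr (1 / t)))) * (h ^ length js * fact (length js) powr s)"
            using A K h by (intro mult_right_mono mult_left_mono) auto
          with gevrey_leD[OF gl, of js x] show ?thesis by (simp add: mult_ac)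
        qed
      qed
      from wb[OF \<psi> this] show ?thesis by (simp add: w\<psi>)
    qed
    ultimately show ?thesis by simp
  qed
  have "w g = w (\<lambda>x. \<kappa> x * g x)"
  proof (rule ccontr)
    assume "w g \<noteq> w (\<lambda>x. \<kappa> x * g x)"
    define \<delta> D where "\<delta> = cmod (w g - w (\<lambda>x. \<kappa> x * g x))" and "D = (M1 + M2) * (A * (1 + K))"
    have \<delta>: "\<delta> > 0" using \<open>w g \<noteq> w (\<lambda>x. \<kappa> x * g x)\<close> by (simp add: \<delta>_def)
    have D: "D > 0" using M1(1) M2(1) A(1) K(1) by (simp add: D_def)
    define L where "L = max 0 (ln (D / \<delta>) + 1)"
    define R where "R = max (max 1 R0) (L powr t)"
    have "L = (L powr t) powr (1 / t)" using t by (simp add: powr_powr L_def)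
    also have "\<dots> \<le> R powr (1 / t)" using t by (intro powr_mono2) (auto simp: R_def)
    finally have L: "L \<le> R powr (1 / t)" .
    have "\<delta> \<le> D * exp (- (R powr (1 / t)))"
      using main[of R] by (simp add: \<delta>_def D_def R_def mult.assoc)
    also have "\<dots> < D * exp (- ln (D / \<delta>))"
      using L D by (intro mult_strict_left_mono) (auto simp: L_def)
    also have "\<dots> = \<delta>" using D \<delta> by (simp add: exp_minus)
    finally show False by simp
  qed
  then show ?thesis by (simp add: w_def diff_eq_eq)
qed

subsection \<open>Fourier series\<close>

definition freq :: "real \<Rightarrow> ('n::finite \<Rightarrow> int) \<Rightarrow> real ^ 'n" where
  "freq L k = (\<chi> i. pi / L * of_int (k i))"

lemma freq_add: "freq L (\<lambda>i. k i + l i) = freq L k + freq L l"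
  by (simp add: freq_def vec_eq_iff algebra_simps)

lemma freq_minus: "freq L (\<lambda>i. - k i) = - freq L k"
  by (simp add: freq_def vec_eq_iff)

lemma summable_on_int_inverse_square: "(\<lambda>k :: int. inverse (1 + (real_of_int k)\<^sup>2)) summable_on UNIV"
proof -
  have "summable (\<lambda>n. inverse (1 + (real n)\<^sup>2))"
  proof (rule summable_comparison_test)
    show "summable (\<lambda>n. inverse (real n ^ 2))" by (rule inverse_power_summable) simp
    show "\<exists>N. \<forall>n\<ge>N. norm (inverse (1 + (real n)\<^sup>2)) \<le> inverse (real n ^ 2)"
      by (intro exI[of _ 1]) (auto intro!: le_imp_inverse_le)
  qed
  then have nat: "(\<lambda>n. inverse (1 + (real n)\<^sup>2)) summable_on UNIV"
    by (subst summable_on_UNIV_nonneg_real_iff) auto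
  have "(\<lambda>k :: int. inverse (1 + (real_of_int k)\<^sup>2)) summable_on (range int)"
    using nat by (subst summable_on_reindex) (auto simp: comp_def inj_def)
  moreover have "(\<lambda>k :: int. inverse (1 + (real_of_int k)\<^sup>2)) summable_on (range (\<lambda>n. - int n))"
    using nat by (subst summable_on_reindex) (auto simp: comp_def inj_def)
  ultimately have "(\<lambda>k :: int. inverse (1 + (real_of_int k)\<^sup>2)) summable_on (range int \<union> range (\<lambda>n. - int n))"
    by (rule summable_on_union)
  moreover have "range int \<union> range (\<lambda>n. - int n) = UNIV"
  proof (intro equalityI subset_UNIV subsetI)
    fix k :: int
    show "k \<in> range int \<union> range (\<lambda>n. - int n)" by (cases k rule: int_cases2) auto
  qed
  ultimately show ?thesis by simp
qed

lemma summable_on_lattice: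
  "(\<lambda>k :: 'n::finite \<Rightarrow> int. \<Prod>i\<in>UNIV. inverse (1 + (real_of_int (k i))\<^sup>2)) summable_on UNIV"
proof -
  have "Infinite_Sum.abs_summable_on (\<lambda>k :: int. inverse (1 + (real_of_int k)\<^sup>2)) UNIV"
    using summable_on_int_inverse_square by simp
  then have "Infinite_Set_Sum.abs_summable_on (\<lambda>k :: int. inverse (1 + (real_of_int k)\<^sup>2)) UNIV"
    by (simp only: abs_summable_equivalent)
  then have "Infinite_Set_Sum.abs_summable_on (\<lambda>k :: 'n \<Rightarrow> int. \<Prod>i\<in>UNIV. inverse (1 + (real_of_int (k i))\<^sup>2)) (PiE UNIV (\<lambda>_. UNIV))"
    by (intro abs_summable_on_prod_PiE) auto
  then have "Infinite_Sum.abs_summable_on (\<lambda>k :: 'n \<Rightarrow> int. \<Prod>i\<in>UNIV. inverse (1 + (real_of_int (k i))\<^sup>2)) UNIV"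
    by (simp only: abs_summable_equivalent PiE_UNIV_domain Pi_UNIV)
  then show ?thesis by (rule abs_summable_summable)
qed

lemma summable_on_gs_weight_freq:
  assumes "0 < t" "0 < r" "0 < L"
  shows "(\<lambda>k :: 'n::finite \<Rightarrow> int. gs_weight t r (freq L k)) summable_on UNIV"
proof -
  obtain C where C: "C > 0" "\<And>x :: real ^ 'n. gs_weight t r x * (\<Prod>i\<in>UNIV. 1 + (x $ i)\<^sup>2) \<le> C"
    using gs_weight_le_prod[OF assms(1,2)] by metis
  define c where "c = min 1 ((pi / L)\<^sup>2)"
  have c: "c > 0" using assms by (simp add: c_def)
  have le: "gs_weight t r (freq L k) \<le> (C / c ^ CARD('n)) * (\<Prod>i\<in>UNIV. inverse (1 + (real_of_int (k i))\<^sup>2))" for k :: "'n \<Rightarrow> int"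
  proof -
    define P where "P = (\<Prod>i\<in>UNIV. 1 + (real_of_int (k i))\<^sup>2)"
    have P: "P > 0" unfolding P_def by (intro prod_pos) (auto simp: add_pos_nonneg)
    have "c ^ CARD('n) * P = (\<Prod>i\<in>(UNIV :: 'n set). c * (1 + (real_of_int (k i))\<^sup>2))"
      by (simp add: prod.distrib P_def)
    also have "\<dots> \<le> (\<Prod>i\<in>UNIV. 1 + (freq L k $ i)\<^sup>2)"
    proof (intro prod_mono conjI)
      fix i
      show "0 \<le> c * (1 + (real_of_int (k i))\<^sup>2)" using c by (simp add: add_nonneg_nonneg)
      have "c * 1 + c * (real_of_int (k i))\<^sup>2 \<le> 1 + (pi / L)\<^sup>2 * (real_of_int (k i))\<^sup>2"
        unfolding c_def by (intro add_mono mult_right_mono) auto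
      then show "c * (1 + (real_of_int (k i))\<^sup>2) \<le> 1 + (freq L k $ i)\<^sup>2"
        by (simp add: freq_def power_mult_distrib power_divide algebra_simps)
    qed
    finally have "gs_weight t r (freq L k) * (c ^ CARD('n) * P) \<le> gs_weight t r (freq L k) * (\<Prod>i\<in>UNIV. 1 + (freq L k $ i)\<^sup>2)"
      by (intro mult_left_mono) auto
    also have "\<dots> \<le> C" by (rule C)
    finally have "gs_weight t r (freq L k) \<le> C / (c ^ CARD('n) * P)"
      using c P by (simp add: pos_le_divide_eq)
    moreover have "(\<Prod>i\<in>UNIV. inverse (1 + (real_of_int (k i))\<^sup>2)) = inverse P"
      unfolding P_def by (simp add: prod_inversef[symmetric] comp_def)
    ultimately show ?thesis by (simp add: field_simps)
  qed
  show ?thesis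
  proof (rule summable_on_comparison_test)
    show "(\<lambda>k :: 'n \<Rightarrow> int. (C / c ^ CARD('n)) * (\<Prod>i\<in>UNIV. inverse (1 + (real_of_int (k i))\<^sup>2))) summable_on UNIV"
      by (intro summable_on_cmult_right summable_on_lattice)
  qed (use le in auto)
qed

definition cube :: "real \<Rightarrow> (real ^ 'n::finite) set" where
  "cube L = cbox (\<chi> i. - L) (\<chi> i. L)"

lemma in_cube: "x \<in> cube L \<longleftrightarrow> (\<forall>i. - L \<le> x $ i \<and> x $ i \<le> L)"
  by (simp add: cube_def mem_box_cart)

lemma integral_cube_eq_lborel:
  fixes g :: "real ^ 'n::finite \<Rightarrow> complex"
  assumes "integrable lborel g" "\<And>x. x \<notin> cube L \<Longrightarrow> g x = 0"
  shows "integral (cube L) g = (\<integral>x. g x \<partial>lborel)"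
proof -
  have "(g has_integral (\<integral>x. g x \<partial>lborel)) UNIV"
    using has_integral_integral_lborel[OF assms(1)] by simp
  then have "((\<lambda>x. if x \<in> cube L then g x else 0) has_integral (\<integral>x. g x \<partial>lborel)) UNIV"
    by (rule has_integral_eq[rotated]) (use assms(2) in auto)
  then show ?thesis by (simp add: has_integral_restrict_UNIV integral_unique)
qed

lemma integral_exp_period:
  fixes k :: int
  assumes "0 < L"
  defines "g \<equiv> \<lambda>y :: real. indicator {-L..L} y *\<^sub>R exp (\<i> * of_real (y * (pi / L * of_int k)))"
  shows "integrable lborel g" "(\<integral>y. g y \<partial>lborel) = (if k = 0 then of_real (2 * L) else 0)"
proof -
  define f where "f y = exp (\<i> * of_real (y * (pi / L * of_int k)))" for y :: real
  have cont: "continuous_on {-L..L} f" unfolding f_def by (intro continuous_intros)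
  have gf: "g = (\<lambda>y. indicator {-L..L} y *\<^sub>R f y)" by (simp add: g_def f_def)
  show "integrable lborel g"
    unfolding gf using borel_integrable_atLeastAtMost'[OF cont] by (simp add: set_integrable_def)
  show "(\<integral>y. g y \<partial>lborel) = (if k = 0 then of_real (2 * L) else 0)"
  proof (cases "k = 0")
    case True
    then have "f = (\<lambda>y. 1)" by (auto simp: f_def)
    then have "(\<integral>y. g y \<partial>lborel) = (\<integral>y. of_real (indicator {-L..L} y) \<partial>lborel)"
      unfolding gf by (intro Bochner_Integration.integral_cong) (auto simp: scaleR_conv_of_real)
    also have "\<dots> = of_real (2 * L)" using assms by simp
    finally show ?thesis using True by simp
  next
    case False
    define a where "a = \<i> * complex_of_real (pi / L * of_int k)"
    have a: "a \<noteq> 0" using False assms by (simp add: a_def)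
    have "(\<integral>y. indicator {-L..L} y *\<^sub>R f y \<partial>lborel) = exp (a * of_real L) / a - exp (a * of_real (-L)) / a"
    proof (rule integral_FTC_atLeastAtMost[OF _ _ cont])
      show "- L \<le> L" using assms by simp
      fix y
      have "((\<lambda>z. exp (a * z) / a) has_field_derivative exp (a * of_real y)) (at (of_real y))"
        using a by (auto intro!: derivative_eq_intros)
      then have "((\<lambda>y. exp (a * of_real y) / a) has_vector_derivative exp (a * of_real y)) (at y within {-L..L})"
        by (rule has_vector_derivative_real_field)
      moreover have "exp (a * of_real y) = f y" by (simp add: a_def f_def mult_ac)
      ultimately show "((\<lambda>y. exp (a * of_real y) / a) has_vector_derivative f y) (at y within {-L..L})"
        by simp
    qed
    also have "exp (a * of_real L) = exp (a * of_real (-L))"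
    proof -
      have e: "a * of_real L = \<i> * of_real (pi * of_int k)" "a * of_real (- L) = - (\<i> * of_real (pi * of_int k))"
        using assms by (auto simp: a_def)
      have "exp (\<i> * of_real (pi * of_int k)) = exp (- (\<i> * of_real (pi * of_int k)))"
        unfolding exp_eq by (intro exI[of _ k]) (simp add: algebra_simps)
      then show ?thesis unfolding e .
    qed
    finally show ?thesis using False by (simp add: gf)
  qed
qed

lemma integral_cube_expi:
  fixes k :: "'n::finite \<Rightarrow> int"
  assumes L: "0 < L"
  shows "integral (cube L) (expi (freq L k)) = (if k = (\<lambda>_. 0) then of_real ((2 * L) ^ CARD('n)) else 0)"
proof -
  define g where "g i y = indicator {-L..L} y *\<^sub>R exp (\<i> * of_real (y * (pi / L * of_int (k i))))" for i :: 'n and y :: real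
  have eq: "(\<Prod>i\<in>UNIV. g i (x $ i)) = (if x \<in> cube L then expi (freq L k) x else 0)" for x :: "real ^ 'n"
  proof (cases "x \<in> cube L")
    case True
    then have "(\<Prod>i\<in>UNIV. g i (x $ i)) = (\<Prod>i\<in>UNIV. exp (\<i> * of_real (x $ i * (pi / L * of_int (k i)))))"
      by (intro prod.cong) (auto simp: g_def in_cube)
    also have "\<dots> = exp (\<Sum>i\<in>UNIV. \<i> * of_real (x $ i * (pi / L * of_int (k i))))"
      by (simp add: exp_sum)
    also have "\<dots> = expi (freq L k) x"
      by (simp add: expi_def inner_vec_def freq_def sum_distrib_left)
    finally show ?thesis using True by simp
  next
    case False
    then obtain i where "x $ i \<notin> {-L..L}" by (auto simp: in_cube)
    then have "g i (x $ i) = 0" by (simp add: g_def)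
    then have "(\<Prod>i\<in>UNIV. g i (x $ i)) = 0" by (intro prod_zero) auto
    then show ?thesis using False by simp
  qed
  have int: "integrable lborel (g i)" "(\<integral>y. g i y \<partial>lborel) = (if k i = 0 then of_real (2 * L) else 0)" for i
    unfolding g_def using integral_exp_period[OF L, of "k i"] by auto
  note vp = lborel_vec_prod[where g = g, OF int(1), unfolded eq]
  have "integral (cube L) (expi (freq L k)) = integral (cube L) (\<lambda>x. if x \<in> cube L then expi (freq L k) x else 0)"
    by (rule Henstock_Kurzweil_Integration.integral_cong) simp
  also have "\<dots> = (\<Prod>i\<in>UNIV. (if k i = 0 then of_real (2 * L) else 0))"
    by (subst integral_cube_eq_lborel[OF vp(1)]) (simp_all add: vp(2) int(2))
  also have "\<dots> = (if k = (\<lambda>_. 0) then of_real ((2 * L) ^ CARD('n)) else 0)"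
  proof (cases "k = (\<lambda>_. 0)")
    case False
    then obtain i where "k i \<noteq> 0" by auto
    then have "(\<Prod>i\<in>UNIV. (if k i = 0 then complex_of_real (2 * L) else 0)) = 0"
      by (intro prod_zero) auto
    then show ?thesis using False by simp
  qed simp
  finally show ?thesis .
qed

definition torus_map :: "real \<Rightarrow> real ^ 'n::finite \<Rightarrow> complex ^ 'n" where
  "torus_map L x = (\<chi> i. exp (\<i> * of_real (pi / L * x $ i)))"

lemma continuous_on_torus_map: "continuous_on A (torus_map L)"
  unfolding torus_map_def by (intro continuous_intros)

lemma continuous_on_expi: "continuous_on A (expi \<xi>)"
  unfolding expi_def by (intro continuous_intros)

lemma integral_cube_trig_polynomial:
  fixes p :: "complex ^ 'n::finite \<Rightarrow> real"
  assumes "real_polynomial_function p" "0 < L" "continuous_on UNIV g"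
    and "\<And>k. integral (cube L) (\<lambda>x. g x * expi (freq L k) x) = 0"
  shows "integral (cube L) (\<lambda>x. (g x * of_real (p (torus_map L x))) * expi (freq L k) x) = 0"
  using assms
proof (induction p arbitrary: g k rule: real_polynomial_function.induct)
  case (linear p)
  interpret p: bounded_linear p by (rule linear)
  define \<delta> where "\<delta> i = (\<lambda>j. if j = i then 1 else 0 :: int)" for i :: 'n
  define a b where "a i = complex_of_real (p (axis i 1))" and "b i = complex_of_real (p (axis i \<i>))" for i
  have e: "torus_map L x $ i = expi (freq L (\<delta> i)) x" for x i
  proof -
    have "x \<bullet> freq L (\<delta> i) = pi / L * x $ i"
      by (simp add: inner_vec_def freq_def \<delta>_def if_distrib sum.delta cong: if_cong)
    then show ?thesis by (simp add: torus_map_def expi_def)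
  qed
  have dec: "p z = (\<Sum>i\<in>UNIV. Re (z $ i) * p (axis i 1) + Im (z $ i) * p (axis i \<i>))" for z
  proof -
    have "z = (\<Sum>i\<in>UNIV. Re (z $ i) *\<^sub>R axis i 1 + Im (z $ i) *\<^sub>R axis i \<i>)"
      by (auto simp: vec_eq_iff axis_def complex_eq_iff if_distrib sum.delta cong: if_cong)
    then have "p z = p (\<Sum>i\<in>UNIV. Re (z $ i) *\<^sub>R axis i 1 + Im (z $ i) *\<^sub>R axis i \<i>)" by simp
    also have "\<dots> = (\<Sum>i\<in>UNIV. Re (z $ i) * p (axis i 1) + Im (z $ i) * p (axis i \<i>))"
      by (simp add: p.sum p.add p.scaleR)
    finally show ?thesis .
  qed
  have trig: "of_real (p (torus_map L x)) =
    (\<Sum>i\<in>UNIV. ((a i - \<i> * b i) / 2) * expi (freq L (\<delta> i)) x + ((a i + \<i> * b i) / 2) * expi (freq L (\<lambda>j. - \<delta> i j)) x)" for x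
  proof -
    have "of_real (p (torus_map L x)) = (\<Sum>i\<in>UNIV. of_real (Re (torus_map L x $ i)) * a i + of_real (Im (torus_map L x $ i)) * b i)"
      by (subst dec) (simp add: a_def b_def)
    also have "\<dots> = (\<Sum>i\<in>UNIV. ((a i - \<i> * b i) / 2) * expi (freq L (\<delta> i)) x + ((a i + \<i> * b i) / 2) * expi (freq L (\<lambda>j. - \<delta> i j)) x)"
    proof (rule sum.cong[OF refl])
      fix i
      define z where "z = expi (freq L (\<delta> i)) x"
      have z': "expi (freq L (\<lambda>j. - \<delta> i j)) x = cnj z" by (simp add: z_def freq_minus cnj_expi)
      show "of_real (Re (torus_map L x $ i)) * a i + of_real (Im (torus_map L x $ i)) * b i =
        ((a i - \<i> * b i) / 2) * expi (freq L (\<delta> i)) x + ((a i + \<i> * b i) / 2) * expi (freq L (\<lambda>j. - \<delta> i j)) x"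
        unfolding z' e z_def[symmetric] by (simp add: complex_eq_iff a_def b_def add_divide_distrib diff_divide_distrib algebra_simps)
    qed
    finally show ?thesis .
  qed
  have eq: "(g x * of_real (p (torus_map L x))) * expi (freq L k) x =
    (\<Sum>i\<in>UNIV. ((a i - \<i> * b i) / 2) * (g x * expi (freq L (\<lambda>j. \<delta> i j + k j)) x)
       + ((a i + \<i> * b i) / 2) * (g x * expi (freq L (\<lambda>j. - \<delta> i j + k j)) x))" for x
    unfolding trig sum_distrib_left sum_distrib_right freq_add expi_add
    by (rule sum.cong) (simp_all add: algebra_simps)
  have int: "(\<lambda>x. c * (g x * expi (freq L l) x)) integrable_on cube L" for c l
    unfolding cube_def
    by (intro integrable_continuous continuous_intros continuous_on_expi continuous_on_subset[OF linear(3)]) auto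
  show ?case
    unfolding eq
    by (subst integral_sum) (auto intro!: integrable_add int simp: integral_add int linear(4))
next
  case (const c)
  have "(\<lambda>x. (g x * of_real c) * expi (freq L k) x) = (\<lambda>x. of_real c * (g x * expi (freq L k) x))"
    by (auto simp: mult_ac)
  then show ?case using const by simp
next
  case (add p q)
  have c: "continuous_on (cube L) (\<lambda>x. (g x * of_real (f (torus_map L x))) * expi (freq L k) x)"
    if "real_polynomial_function f" for f
    by (intro continuous_intros continuous_on_expi continuous_on_subset[OF add.prems(2)]
        continuous_on_compose2[OF continuous_on_polymonial_function continuous_on_torus_map])
       (use that in \<open>auto simp: real_polynomial_function_eq\<close>)
  have "integral (cube L) (\<lambda>x. (g x * of_real (p (torus_map L x) + q (torus_map L x))) * expi (freq L k) x) =
    integral (cube L) (\<lambda>x. (g x * of_real (p (torus_map L x))) * expi (freq L k) x + (g x * of_real (q (torus_map L x))) * expi (freq L k) x)"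
    by (simp add: algebra_simps)
  also have "\<dots> = 0"
    using add c[unfolded cube_def] by (subst integral_add) (auto simp: cube_def intro!: integrable_continuous)
  finally show ?case .
next
  case (mult p q)
  have "continuous_on UNIV (\<lambda>x. g x * of_real (p (torus_map L x)))"
    by (intro continuous_intros mult.prems(2)
        continuous_on_compose2[OF continuous_on_polymonial_function continuous_on_torus_map])
       (use mult.hyps in \<open>auto simp: real_polynomial_function_eq\<close>)
  from mult.IH(2)[OF mult.prems(1) this mult.IH(1)[OF mult.prems]]
  show ?case by (simp add: mult_ac)
qed

text \<open>A function supported strictly inside the cube descends to a continuous function on the
  torus, because it vanishes near the branch cut of \<open>Arg\<close>.\<close>

lemma torus_approximation:
  fixes b :: "real ^ 'n::finite \<Rightarrow> real"
  assumes b: "continuous_on UNIV b" and R: "0 < R" "R < L" "\<And>x. norm x \<ge> R \<Longrightarrow> b x = 0" and "0 < e"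
  obtains p :: "complex ^ 'n \<Rightarrow> real" where "real_polynomial_function p"
    "\<And>x. x \<in> cube L \<Longrightarrow> \<bar>b x - p (torus_map L x)\<bar> < e"
proof -
  define T :: "(complex ^ 'n) set" where "T = {z. \<forall>i. norm (z $ i) = 1}"
  define A where "A z = (\<chi> i. L / pi * Arg (z $ i))" for z :: "complex ^ 'n"
  have L: "L > 0" using R by simp
  have "compact T"
  proof (rule compact_eq_bounded_closed[THEN iffD2], intro conjI)
    show "bounded T"
    proof (rule boundedI)
      fix z assume "z \<in> T"
      then show "norm z \<le> real CARD('n)"
        using L2_set_le_sum[of UNIV "\<lambda>i. norm (z $ i)"] by (simp add: norm_vec_def T_def)
    qed
    show "closed T" unfolding T_def
      by (intro closed_Collect_all closed_Collect_eq continuous_intros)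
  qed
  moreover have "continuous_on T (\<lambda>z. b (A z))"
  proof (unfold continuous_on_eq_continuous_within, intro ballI)
    fix z assume z: "z \<in> T"
    show "continuous (at z within T) (\<lambda>z. b (A z))"
    proof (cases "\<forall>i. z $ i \<notin> \<real>\<^sub>\<le>\<^sub>0")
      case True
      have "isCont (\<lambda>z. L / pi * Arg (z $ i)) z" for i
      proof (intro continuous_intros)
        have "isCont (\<lambda>z. z $ i) z" by (intro continuous_intros)
        from isCont_o2[OF this continuous_at_Arg] show "isCont (\<lambda>z. Arg (z $ i)) z" using True by blast
      qed
      then have "isCont A z" unfolding A_def isCont_def by (intro vec_tendstoI) simp
      moreover have "isCont b (A z)" using b by (simp add: continuous_on_eq_continuous_at)
      ultimately have "isCont (\<lambda>z. b (A z)) z" by (rule isCont_o2)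
      then show ?thesis by (rule continuous_at_imp_continuous_at_within)
    next
      case False
      then obtain j where j: "z $ j \<in> \<real>\<^sub>\<le>\<^sub>0" by auto
      then have "Im (z $ j) = 0" "Re (z $ j) \<le> 0" by (auto simp: complex_nonpos_Reals_iff)
      moreover have "norm (z $ j) = 1" using z by (simp add: T_def)
      ultimately have re: "Re (z $ j) = - 1" by (simp add: cmod_def)
      define c where "c = cos (pi * R / L)"
      have angle: "0 < pi * R / L" "pi * R / L < pi" using R L by (auto simp: field_simps)
      have c: "- 1 < c" unfolding c_def using cos_monotone_0_pi[of "pi * R / L" pi] angle by simp
      have zero: "b (A w) = 0" if w: "w \<in> T" "Re (w $ j) < c" for w
      proof -
        have w0: "norm (w $ j) = 1" using w by (simp add: T_def)
        then have "cis (Arg (w $ j)) = w $ j" by (subst cis_Arg) (auto simp: sgn_div_norm)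
        then have "Re (w $ j) = cos \<bar>Arg (w $ j)\<bar>" by (metis cis.sel(1) cos_abs_real)
        then have "cos \<bar>Arg (w $ j)\<bar> < cos (pi * R / L)" using w by (simp add: c_def)
        moreover have "\<bar>Arg (w $ j)\<bar> \<le> pi" using Arg_bounded[of "w $ j"] by auto
        ultimately have "pi * R / L < \<bar>Arg (w $ j)\<bar>"
          using cos_monotone_0_pi_le[of "\<bar>Arg (w $ j)\<bar>" "pi * R / L"] angle by fastforce
        then have "R < \<bar>A w $ j\<bar>" using L by (simp add: A_def abs_mult field_simps)
        also have "\<dots> \<le> norm (A w)" by (rule component_le_norm_cart)
        finally show ?thesis by (intro R(3)) simp
      qed
      have "eventually (\<lambda>w. b (A w) = 0) (at z within T)"
      proof -
        have "open {w :: complex ^ 'n. Re (w $ j) < c}"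
          by (intro open_Collect_less continuous_intros)
        then have "eventually (\<lambda>w. w \<in> {w. Re (w $ j) < c}) (at z within T)"
          using re c by (intro eventually_at_topological[THEN iffD2]) (auto intro!: exI[of _ "{w. Re (w $ j) < c}"])
        moreover have "eventually (\<lambda>w. w \<in> T) (at z within T)"
          by (simp add: eventually_at_filter)
        ultimately show ?thesis by eventually_elim (use zero in auto)
      qed
      moreover have "b (A z) = 0" using zero[OF z] re c by simp
      ultimately show ?thesis
        unfolding continuous_within by (simp add: tendsto_eventually)
    qed
  qed
  ultimately obtain p where p: "real_polynomial_function p" "\<And>z. z \<in> T \<Longrightarrow> \<bar>b (A z) - p z\<bar> < e"
    using Stone_Weierstrass_real_polynomial_function[of T "\<lambda>z. b (A z)" e] \<open>0 < e\<close> by metis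
  have "\<bar>b x - p (torus_map L x)\<bar> < e" if x: "x \<in> cube L" for x
  proof -
    have T: "torus_map L x \<in> T" by (simp add: T_def torus_map_def)
    have comp: "A (torus_map L x) $ i = (if x $ i = - L then L else x $ i)" for i
    proof (cases "x $ i = - L")
      case True
      have "torus_map L x $ i = exp (- (\<i> * of_real pi))" using True L by (simp add: torus_map_def)
      also have "\<dots> = -1" by (simp add: exp_minus)
      finally have "Arg (torus_map L x $ i) = pi" using Arg_cis[of pi] by simp
      then show ?thesis using True by (simp add: A_def)
    next
      case False
      have "- L < x $ i" "x $ i \<le> L" using x False by (auto simp: in_cube less_le)
      then have "pi / L * (- L) < pi / L * x $ i" "pi / L * x $ i \<le> pi / L * L"
        using L by (intro mult_strict_left_mono mult_left_mono; simp)+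
      then have "- pi < pi / L * x $ i" "pi / L * x $ i \<le> pi" using L by simp_all
      then have "Arg (torus_map L x $ i) = pi / L * x $ i"
        unfolding torus_map_def by (simp add: Arg_exp)
      then show ?thesis using False L by (simp add: A_def)
    qed
    have "b (A (torus_map L x)) = b x"
    proof (cases "\<exists>i. x $ i = - L")
      case True
      then obtain i where i: "x $ i = - L" by auto
      have "norm x \<ge> R" using component_le_norm_cart[of x i] i R by simp
      moreover have "norm (A (torus_map L x)) \<ge> R"
        using component_le_norm_cart[of "A (torus_map L x)" i] comp[of i] i R by simp
      ultimately show ?thesis using R(3) by simp
    next
      case False
      then have "A (torus_map L x) = x" by (simp add: vec_eq_iff comp)
      then show ?thesis by simp
    qed
    with p(2)[OF T] show ?thesis by simp
  qed
  with p(1) show ?thesis using that by blast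
qed

lemma integral_uniform_limit_eq:
  fixes f :: "'a \<Rightarrow> real ^ 'n::finite \<Rightarrow> complex"
  assumes "uniform_limit (cube L) f g F" "\<And>n. continuous_on (cube L) (f n)" "F \<noteq> bot"
    and "((\<lambda>n. integral (cube L) (f n)) \<longlongrightarrow> J) F"
  shows "integral (cube L) g = J"
proof -
  obtain I J' where I: "\<And>n. (f n has_integral I n) (cube L)" "(g has_integral J') (cube L)" "(I \<longlongrightarrow> J') F"
    using uniform_limit_integral_cbox[OF assms(1-3)[unfolded cube_def]] unfolding cube_def by metis
  then have "integral (cube L) g = J'" "((\<lambda>n. integral (cube L) (f n)) \<longlongrightarrow> J') F"
    by (simp_all add: integral_unique[OF I(1)] integral_unique[OF I(2)])
  then show ?thesis using tendsto_unique[OF assms(3,4)] by blast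
qed

lemma fourier_series:
  fixes b :: "real ^ 'n::finite \<Rightarrow> complex"
  assumes b: "continuous_on UNIV b" and R: "0 < R" "R < L" "\<And>x. norm x \<ge> R \<Longrightarrow> b x = 0"
    and c: "\<And>k. c k = integral (cube L) (\<lambda>x. b x * expi (- freq L k) x) / of_real ((2 * L) ^ CARD('n))"
    and summ: "(\<lambda>k. cmod (c k)) summable_on UNIV"
    and x: "norm x < L"
  shows "((\<lambda>k. c k * expi (freq L k) x) has_sum b x) UNIV"
proof -
  have L: "L > 0" using R by simp
  define S where "S x = (\<Sum>\<^sub>\<infinity>k. c k * expi (freq L k) x)" for x
  have ul: "uniform_limit Y (\<lambda>F x. \<Sum>k\<in>F. c k * expi (freq L k) x) S (finite_subsets_at_top UNIV)" for Y
    unfolding S_def by (rule Weierstrass_m_test_general[OF _ summ]) (simp add: norm_mult)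
  have contF: "continuous_on Y (\<lambda>x. \<Sum>k\<in>F. c k * expi (freq L k) x)" for F Y
    by (intro continuous_intros continuous_on_expi)
  have contS: "continuous_on UNIV S"
    by (rule uniform_limit_theorem[OF always_eventually ul]) (auto intro: contF)
  have iexp: "(\<lambda>x. a * expi \<xi> x) integrable_on cube L" for a :: complex and \<xi> :: "real ^ 'n"
    unfolding cube_def by (intro integrable_continuous continuous_intros continuous_on_expi)
  have bdd: "bounded (f ` cube L)" if "continuous_on UNIV f" for f :: "real ^ 'n \<Rightarrow> complex"
    unfolding cube_def
    by (intro compact_imp_bounded compact_continuous_image continuous_on_subset[OF that] compact_cbox) auto
  have int: "f integrable_on cube L" if "continuous_on UNIV f" for f :: "real ^ 'n \<Rightarrow> complex"
    unfolding cube_def by (rule integrable_continuous[OF continuous_on_subset[OF that]]) simp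
  have coefS: "integral (cube L) (\<lambda>x. S x * expi (- freq L l) x) = c l * of_real ((2 * L) ^ CARD('n))" for l
  proof (rule integral_uniform_limit_eq)
    show "uniform_limit (cube L) (\<lambda>F x. (\<Sum>k\<in>F. c k * expi (freq L k) x) * expi (- freq L l) x)
        (\<lambda>x. S x * expi (- freq L l) x) (finite_subsets_at_top UNIV)"
      by (intro uniform_lim_mult ul bdd contS continuous_on_expi uniform_limit_const)
    show "continuous_on (cube L) (\<lambda>x. (\<Sum>k\<in>F. c k * expi (freq L k) x) * expi (- freq L l) x)" for F
      by (intro continuous_intros contF continuous_on_expi)
    have "integral (cube L) (\<lambda>x. (\<Sum>k\<in>F. c k * expi (freq L k) x) * expi (- freq L l) x) =
        (if l \<in> F then c l * of_real ((2 * L) ^ CARD('n)) else 0)" if F: "finite F" for F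
    proof -
      have "(\<lambda>x. (\<Sum>k\<in>F. c k * expi (freq L k) x) * expi (- freq L l) x) =
        (\<lambda>x. \<Sum>k\<in>F. c k * expi (freq L (\<lambda>i. k i + - l i)) x)"
        by (simp only: sum_distrib_right freq_add freq_minus expi_add mult.assoc)
      then have "integral (cube L) (\<lambda>x. (\<Sum>k\<in>F. c k * expi (freq L k) x) * expi (- freq L l) x) =
        (\<Sum>k\<in>F. integral (cube L) (\<lambda>x. c k * expi (freq L (\<lambda>i. k i + - l i)) x))"
        using F by (simp add: integral_sum iexp)
      also have "\<dots> = (\<Sum>k\<in>F. if k = l then c l * of_real ((2 * L) ^ CARD('n)) else 0)"
      proof (rule sum.cong[OF refl])
        fix k
        have "integral (cube L) (\<lambda>x. c k * expi (freq L (\<lambda>i. k i + - l i)) x) =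
          c k * (if (\<lambda>i. k i + - l i) = (\<lambda>_. 0) then of_real ((2 * L) ^ CARD('n)) else 0)"
          unfolding integral_mult_right by (simp only: integral_cube_expi[OF L])
        moreover have "(\<lambda>i. k i + - l i) = (\<lambda>_. 0) \<longleftrightarrow> k = l" by (auto simp: fun_eq_iff)
        ultimately show "integral (cube L) (\<lambda>x. c k * expi (freq L (\<lambda>i. k i + - l i)) x) =
          (if k = l then c l * of_real ((2 * L) ^ CARD('n)) else 0)" by (simp only:) simp
      qed
      also have "\<dots> = (if l \<in> F then c l * of_real ((2 * L) ^ CARD('n)) else 0)" using F by simp
      finally show ?thesis .
    qed
    then have "eventually (\<lambda>F. integral (cube L) (\<lambda>x. (\<Sum>k\<in>F. c k * expi (freq L k) x) * expi (- freq L l) x) =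
        c l * of_real ((2 * L) ^ CARD('n))) (finite_subsets_at_top UNIV)"
      unfolding eventually_finite_subsets_at_top by (intro exI[of _ "{l}"]) auto
    then show "((\<lambda>F. integral (cube L) (\<lambda>x. (\<Sum>k\<in>F. c k * expi (freq L k) x) * expi (- freq L l) x))
        \<longlongrightarrow> c l * of_real ((2 * L) ^ CARD('n))) (finite_subsets_at_top UNIV)"
      by (rule tendsto_eventually)
  qed simp
  define d where "d x = b x - S x" for x
  have contd: "continuous_on UNIV d" unfolding d_def by (intro continuous_intros b contS)
  have ortho: "integral (cube L) (\<lambda>x. d x * expi (freq L k) x) = 0" for k
  proof -
    have "integral (cube L) (\<lambda>x. d x * expi (- freq L (\<lambda>i. - k i)) x) =
      integral (cube L) (\<lambda>x. b x * expi (- freq L (\<lambda>i. - k i)) x - S x * expi (- freq L (\<lambda>i. - k i)) x)"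
      by (simp add: d_def left_diff_distrib)
    also have "\<dots> = 0"
      by (subst integral_diff) (auto intro!: int continuous_intros b contS continuous_on_expi simp: coefS c L less_imp_neq[OF L, symmetric])
    finally show ?thesis by (simp add: freq_minus)
  qed
  have dS: "integral (cube L) (\<lambda>x. d x * cnj (S x)) = 0"
  proof (rule integral_uniform_limit_eq)
    have "uniform_limit (cube L) (\<lambda>F x. cnj (\<Sum>k\<in>F. c k * expi (freq L k) x)) (\<lambda>x. cnj (S x)) (finite_subsets_at_top UNIV)"
      using ul[of "cube L"] unfolding uniform_limit_iff dist_norm complex_cnj_diff[symmetric] complex_mod_cnj .
    then show "uniform_limit (cube L) (\<lambda>F x. d x * cnj (\<Sum>k\<in>F. c k * expi (freq L k) x))
        (\<lambda>x. d x * cnj (S x)) (finite_subsets_at_top UNIV)"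
      by (intro uniform_lim_mult bdd contd continuous_on_cnj contS uniform_limit_const)
    show "continuous_on (cube L) (\<lambda>x. d x * cnj (\<Sum>k\<in>F. c k * expi (freq L k) x))" for F
      by (intro continuous_intros contF continuous_on_subset[OF contd]) auto
    have "integral (cube L) (\<lambda>x. d x * cnj (\<Sum>k\<in>F. c k * expi (freq L k) x)) = 0" if F: "finite F" for F
    proof -
      have eq: "(\<lambda>x. d x * cnj (\<Sum>k\<in>F. c k * expi (freq L k) x)) =
          (\<lambda>x. \<Sum>k\<in>F. cnj (c k) * (d x * expi (freq L (\<lambda>i. - k i)) x))"
        by (simp add: cnj_expi freq_minus sum_distrib_left mult_ac)
      show ?thesis unfolding eq using F
        by (subst integral_sum) (auto intro!: int continuous_intros contd continuous_on_expi simp: ortho)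
    qed
    then show "((\<lambda>F. integral (cube L) (\<lambda>x. d x * cnj (\<Sum>k\<in>F. c k * expi (freq L k) x))) \<longlongrightarrow> 0) (finite_subsets_at_top UNIV)"
      by (intro tendsto_eventually eventually_finite_subsets_at_top_weakI) auto
  qed simp
  obtain D where D: "D > 0" "\<And>x. x \<in> cube L \<Longrightarrow> cmod (d x) \<le> D"
    using bounded_normE[OF bdd[OF contd]] by (metis image_eqI bounded_pos bdd contd)
  have real: "integral (cube L) (\<lambda>x. d x * of_real (\<beta> x)) = 0"
    if \<beta>: "continuous_on UNIV \<beta>" "\<And>x. norm x \<ge> R \<Longrightarrow> \<beta> x = 0" for \<beta> :: "real ^ 'n \<Rightarrow> real"
  proof -
    have "cmod (integral (cube L) (\<lambda>x. d x * of_real (\<beta> x))) \<le> 0 + \<epsilon>" if \<epsilon>: "\<epsilon> > 0" for \<epsilon>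
    proof -
      define K where "K = D * measure lborel (cube L :: (real ^ 'n) set) + 1"
      have K: "K > 0" using D by (simp add: K_def add_nonneg_pos)
      obtain p :: "complex ^ 'n \<Rightarrow> real" where p: "real_polynomial_function p"
        "\<And>x. x \<in> cube L \<Longrightarrow> \<bar>\<beta> x - p (torus_map L x)\<bar> < \<epsilon> / K"
        using torus_approximation[OF \<beta>(1) R(1,2) \<beta>(2), of "\<epsilon> / K"] \<epsilon> K by auto
      have cp: "continuous_on UNIV (\<lambda>x. p (torus_map L x))"
        by (rule continuous_on_compose2[OF continuous_on_polymonial_function continuous_on_torus_map])
           (use p(1) in \<open>auto simp: real_polynomial_function_eq\<close>)
      have "integral (cube L) (\<lambda>x. d x * of_real (p (torus_map L x))) = 0"
        using integral_cube_trig_polynomial[OF p(1) L contd ortho, of "\<lambda>_. 0"]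
        by (simp add: freq_def zero_vec_def[symmetric])
      then have "integral (cube L) (\<lambda>x. d x * of_real (\<beta> x)) =
         integral (cube L) (\<lambda>x. d x * of_real (\<beta> x)) - integral (cube L) (\<lambda>x. d x * of_real (p (torus_map L x)))"
        by simp
      also have "\<dots> = integral (cube L) (\<lambda>x. d x * of_real (\<beta> x) - d x * of_real (p (torus_map L x)))"
        by (subst integral_diff) (auto intro!: int continuous_intros contd \<beta> cp)
      finally have eq: "integral (cube L) (\<lambda>x. d x * of_real (\<beta> x)) =
        integral (cube L) (\<lambda>x. d x * of_real (\<beta> x) - d x * of_real (p (torus_map L x)))" .
      have "cmod (integral (cube L) (\<lambda>x. d x * of_real (\<beta> x) - d x * of_real (p (torus_map L x)))) \<le>
         (D * (\<epsilon> / K)) * measure lborel (cube L :: (real ^ 'n) set)"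
        unfolding cube_def
      proof (rule has_integral_bound)
        show "0 \<le> D * (\<epsilon> / K)" using D \<epsilon> K by simp
        show "((\<lambda>x. d x * of_real (\<beta> x) - d x * of_real (p (torus_map L x))) has_integral
          integral (cbox (\<chi> i. - L) (\<chi> i. L)) (\<lambda>x. d x * of_real (\<beta> x) - d x * of_real (p (torus_map L x)))) (cbox (\<chi> i. - L) (\<chi> i. L))"
          by (rule integrable_integral[OF int[unfolded cube_def]]) (intro continuous_intros contd \<beta> cp)
        fix x :: "real ^ 'n" assume "x \<in> cbox (\<chi> i. - L) (\<chi> i. L)"
        then have x: "x \<in> cube L" by (simp add: cube_def)
        have "cmod (d x * of_real (\<beta> x) - d x * of_real (p (torus_map L x))) = cmod (d x) * \<bar>\<beta> x - p (torus_map L x)\<bar>"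
          by (simp add: right_diff_distrib[symmetric] norm_mult flip: of_real_diff)
        also have "\<dots> \<le> D * (\<epsilon> / K)"
          using D(2)[OF x] p(2)[OF x] D(1) by (intro mult_mono) auto
        finally show "cmod (d x * of_real (\<beta> x) - d x * of_real (p (torus_map L x))) \<le> D * (\<epsilon> / K)" .
      qed
      also have "\<dots> = (D * measure lborel (cube L :: (real ^ 'n) set)) / K * \<epsilon>" by simp
      also have "\<dots> \<le> 1 * \<epsilon>" using K \<epsilon> by (intro mult_right_mono) (auto simp: K_def)
      finally show ?thesis by (simp add: eq)
    qed
    then have "cmod (integral (cube L) (\<lambda>x. d x * of_real (\<beta> x))) \<le> 0" by (rule field_le_epsilon)
    then show ?thesis by simp
  qed
  have db: "integral (cube L) (\<lambda>x. d x * cnj (b x)) = 0"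
  proof -
    have cb: "continuous_on UNIV (\<lambda>x. Re (b x))" "continuous_on UNIV (\<lambda>x. Im (b x))"
      by (intro continuous_intros b)+
    have *: "integral (cube L) (\<lambda>x. d x * of_real (Re (b x))) = 0" "integral (cube L) (\<lambda>x. d x * of_real (Im (b x))) = 0"
      using real[OF cb(1)] real[OF cb(2)] by (simp_all add: R(3))
    have **: "(\<lambda>x. d x * of_real (Re (b x))) integrable_on cube L" "(\<lambda>x. \<i> * (d x * of_real (Im (b x)))) integrable_on cube L"
      by (intro int continuous_intros contd b)+
    have "(\<lambda>x. d x * cnj (b x)) = (\<lambda>x. d x * of_real (Re (b x)) - \<i> * (d x * of_real (Im (b x))))"
      by (auto simp: complex_eq_iff)
    then show ?thesis using * ** by (simp add: integral_diff)
  qed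
  have "integral (cube L) (\<lambda>x. d x * cnj (d x)) = integral (cube L) (\<lambda>x. d x * cnj (b x) - d x * cnj (S x))"
    by (simp add: d_def right_diff_distrib)
  also have "\<dots> = 0"
    by (subst integral_diff) (auto intro!: int continuous_intros contd b contS simp: db dS)
  finally have "((\<lambda>x. d x * cnj (d x)) has_integral 0) (cube L)"
    using integrable_integral[OF int[OF continuous_on_mult[OF contd continuous_on_cnj[OF contd]]]] by simp
  from has_integral_linear[OF this bounded_linear_Re]
  have h0: "((\<lambda>x. (cmod (d x))\<^sup>2) has_integral 0) (cbox (\<chi> i. - L) (\<chi> i. L))"
    by (simp add: comp_def complex_norm_square[symmetric] cube_def del: of_real_power)
  have xc: "x \<in> cbox (\<chi> i. - L) (\<chi> i. L)"
  proof -
    have "\<bar>x $ i\<bar> < L" for i using component_le_norm_cart[of x i] x by linarith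
    then have "- L \<le> x $ i \<and> x $ i \<le> L" for i by (meson abs_le_D2 abs_less_iff less_imp_le minus_le_iff)
    then show ?thesis by (simp add: mem_box_cart)
  qed
  have "(cmod (d x))\<^sup>2 = 0"
  proof (rule has_integral_0_cbox_imp_0[OF _ _ h0 _ xc])
    show "continuous_on (cbox (\<chi> i. - L) (\<chi> i. L)) (\<lambda>x. (cmod (d x))\<^sup>2)"
      by (intro continuous_intros continuous_on_subset[OF contd]) auto
    have "(0 :: real ^ 'n) \<in> box (\<chi> i. - L) (\<chi> i. L)" using L by (simp add: mem_box_cart)
    then show "box (\<chi> i. - L) (\<chi> i. L) \<noteq> ({} :: (real ^ 'n) set)" by blast
  qed simp
  then have "S x = b x" by (simp add: d_def)
  moreover have "(\<lambda>k. c k * expi (freq L k) x) summable_on UNIV"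
    by (rule abs_summable_summable) (use summ in \<open>simp add: norm_mult\<close>)
  ultimately show ?thesis by (simp add: S_def has_sum_iff)
qed

subsection \<open>Microlocal multiplication by Gevrey functions\<close>

lemma smooth_sum:
  assumes "finite F" "\<And>k. k \<in> F \<Longrightarrow> smooth_fun (f k)"
  shows "smooth_fun (\<lambda>x. \<Sum>k\<in>F. a k * f k x)"
  using assms
proof (induction F rule: finite_induct)
  case (insert k F)
  then show ?case using smooth_lincomb[of "f k" "\<lambda>x. \<Sum>k\<in>F. a k * f k x" "a k" 1] by simp
qed simp

lemma iter_partial_sum:
  assumes "finite F" "\<And>k. k \<in> F \<Longrightarrow> smooth_fun (f k)"
  shows "iter_partial js (\<lambda>x. \<Sum>k\<in>F. a k * f k x) = (\<lambda>x. \<Sum>k\<in>F. a k * iter_partial js (f k) x)"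
  using assms
proof (induction F rule: finite_induct)
  case empty
  then show ?case by (auto simp: iter_partial_const)
next
  case (insert k F)
  then show ?case
    using iter_partial_lincomb[of "f k" "\<lambda>x. \<Sum>k\<in>F. a k * f k x" js "a k" 1] smooth_sum[of F f a]
    by simp
qed

lemma gevrey_fourier_tail:
  fixes b :: "real ^ 'n::finite \<Rightarrow> complex"
  assumes s: "0 < s" and b: "gevrey_bdd s b" and supp: "fun_supp b \<subseteq> cball 0 R0" and R: "0 < R0" "R0 + 1 < L"
    and h: "0 < h" and \<kappa>: "\<kappa> = s * (1 / h) powr (1 / s)"
    and c: "\<And>k. c k = fint b (freq L k) / of_real ((2 * L) ^ CARD('n))"
    and summ: "(\<lambda>k. cmod (c k) * exp (\<kappa> * norm (freq L k) powr (1 / s))) summable_on UNIV"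
    and F: "finite F" and x: "norm x < L"
  shows "cmod (iter_partial js (\<lambda>y. 1 * b y + (- 1) * (\<Sum>k\<in>F. c k * expi (freq L k) y)) x) \<le>
    infsum (\<lambda>k. cmod (c k) * exp (\<kappa> * norm (freq L k) powr (1 / s))) (UNIV - F) * h ^ length js * fact (length js) powr s"
proof -
  have L: "L > 0" using R by simp
  have sm: "smooth_fun b" by (rule gevrey_bdd_smooth[OF b])
  define a where "a k = cmod (c k) * exp (\<kappa> * norm (freq L k) powr (1 / s))" for k
  define e where "e k = c k * (\<Prod>j\<leftarrow>js. \<i> * of_real (freq L k $ j))" for k
  define N where "N = h ^ length js * fact (length js) powr s"
  have N: "N \<ge> 0" using h by (simp add: N_def)
  have ea: "cmod (e k) \<le> N * a k" for k
  proof -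
    have "cmod (e k) \<le> cmod (c k) * norm (freq L k) ^ length js"
      unfolding e_def norm_mult by (intro mult_left_mono cmod_prod_list_le) simp
    also have "\<dots> \<le> cmod (c k) * (h ^ length js * fact (length js) powr s * exp (\<kappa> * norm (freq L k) powr (1 / s)))"
      unfolding \<kappa> by (intro mult_left_mono norm_power_le_fact_powr_exp) (use s h in auto)
    finally show ?thesis by (simp add: a_def N_def mult_ac)
  qed
  have Na: "(\<lambda>k. N * a k) summable_on A" if "A \<subseteq> UNIV" for A
    using summ by (intro summable_on_cmult_right summable_on_subset_banach[OF _ that]) (simp add: a_def)
  have se: "(\<lambda>k. cmod (e k)) summable_on A" if "A \<subseteq> UNIV" for A
    by (rule summable_on_comparison_test[OF Na[OF that]]) (use ea in auto)
  define G where "G = iter_partial js b"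
  have smG: "smooth_fun G" unfolding G_def by (rule smooth_fun_iter[OF sm])
  obtain B where B: "gevrey_le s 1 (\<lambda>_. B) b" using gevrey_bddD[OF b, of 1] by auto
  have Bw: "gevrey_le s 1 (\<lambda>x. B * exp (1 * R0 powr (1 / 1)) * gs_weight 1 1 x) b"
    by (rule gevrey_le_weight_of_supp[OF B supp]) (use R in auto)
  have G0: "G y = 0" if "norm y \<ge> R0 + 1" for y
    unfolding G_def by (rule iter_partial_eq_0_outside_supp) (use that supp in auto)
  have eG: "e k = integral (cube L) (\<lambda>x. G x * expi (- freq L k) x) / of_real ((2 * L) ^ CARD('n))" for k
  proof -
    have "integral (cube L) (\<lambda>x. G x * expi (- freq L k) x) = (\<integral>x. G x * expi (- freq L k) x \<partial>lborel)"
    proof (rule integral_cube_eq_lborel)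
      show "integrable lborel (\<lambda>x. G x * expi (- freq L k) x)"
      proof (rule integrable_weight_bound(1)[of 1 1])
        show "(\<lambda>x. G x * expi (- freq L k) x) \<in> borel_measurable borel"
          by (intro smooth_fun_measurable smooth_mult smG smooth_expi)
        show "cmod (G x * expi (- freq L k) x) \<le> (B * exp (1 * R0 powr (1 / 1)) * 1 ^ length js * fact (length js) powr s) * gs_weight 1 1 x" for x
          using gevrey_leD[OF Bw, of js x] by (simp add: norm_mult G_def mult_ac)
      qed auto
      fix x :: "real ^ 'n" assume "x \<notin> cube L"
      then obtain i where "\<not> (- L \<le> x $ i \<and> x $ i \<le> L)" by (auto simp: in_cube)
      then have "\<bar>x $ i\<bar> > L" by linarith
      then have "norm x \<ge> R0 + 1" using component_le_norm_cart[of x i] R by linarith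
      then show "G x * expi (- freq L k) x = 0" by (simp add: G0)
    qed
    also have "\<dots> = (\<Prod>j\<leftarrow>js. \<i> * of_real (freq L k $ j)) * fint b (freq L k)"
      unfolding fint_def[symmetric] G_def by (rule fint_iter_partial[OF sm Bw]) auto
    finally show ?thesis by (simp add: e_def c)
  qed
  have "((\<lambda>k. e k * expi (freq L k) x) has_sum G x) UNIV"
    by (rule fourier_series[OF smooth_fun_continuous[OF smG] _ R(2) G0 eG se x]) (use R in auto)
  moreover have "((\<lambda>k. e k * expi (freq L k) x) has_sum (\<Sum>k\<in>F. e k * expi (freq L k) x)) F"
    using F by simp
  ultimately have hs: "((\<lambda>k. e k * expi (freq L k) x) has_sum (G x - (\<Sum>k\<in>F. e k * expi (freq L k) x))) (UNIV - F)"
    by (rule has_sum_Diff) simp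
  have "cmod (G x - (\<Sum>k\<in>F. e k * expi (freq L k) x)) \<le> infsum (\<lambda>k. cmod (e k)) (UNIV - F)"
  proof (rule norm_has_sum_bound[OF _ hs])
    show "((\<lambda>k. cmod (e k * expi (freq L k) x)) has_sum infsum (\<lambda>k. cmod (e k)) (UNIV - F)) (UNIV - F)"
      using se[of "UNIV - F"] by (simp add: norm_mult)
  qed
  also have "\<dots> \<le> infsum (\<lambda>k. N * a k) (UNIV - F)"
    by (rule infsum_mono[OF se Na]) (use ea in auto)
  also have "\<dots> = N * infsum a (UNIV - F)" by (simp add: infsum_cmult_right')
  finally have *: "cmod (G x - (\<Sum>k\<in>F. e k * expi (freq L k) x)) \<le> N * infsum a (UNIV - F)" .
  have "iter_partial js (\<lambda>y. 1 * b y + (- 1) * (\<Sum>k\<in>F. c k * expi (freq L k) y)) x =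
      G x - (\<Sum>k\<in>F. c k * iter_partial js (expi (freq L k)) x)"
    by (subst iter_partial_lincomb[OF sm smooth_sum[OF F smooth_expi]])
       (simp add: iter_partial_sum[OF F smooth_expi] G_def)
  also have "\<dots> = G x - (\<Sum>k\<in>F. e k * expi (freq L k) x)"
    by (simp add: iter_partial_expi e_def mult.assoc)
  finally show ?thesis using * by (simp add: N_def a_def[abs_def] mult_ac)
qed

lemma antilinear_on_sum:
  assumes al: "antilinear_on (GS_space t s) u" and ts: "0 < t" "0 < s"
    and "finite F" "\<And>k. k \<in> F \<Longrightarrow> f k \<in> GS_space t s"
  shows "(\<lambda>x. \<Sum>k\<in>F. a k * f k x) \<in> GS_space t s"
    and "u (\<lambda>x. \<Sum>k\<in>F. a k * f k x) = (\<Sum>k\<in>F. cnj (a k) * u (f k))"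
proof -
  have "(\<lambda>x. \<Sum>k\<in>F. a k * f k x) \<in> GS_space t s \<and> u (\<lambda>x. \<Sum>k\<in>F. a k * f k x) = (\<Sum>k\<in>F. cnj (a k) * u (f k))"
    using assms(4,5)
  proof (induction F rule: finite_induct)
    case empty
    show ?case using GS_space_0[OF ts] antilinear_on_0[OF al GS_space_0[OF ts]] by simp
  next
    case (insert k F)
    then have 1: "f k \<in> GS_space t s" and 2: "(\<lambda>x. \<Sum>k\<in>F. a k * f k x) \<in> GS_space t s"
      "u (\<lambda>x. \<Sum>k\<in>F. a k * f k x) = (\<Sum>k\<in>F. cnj (a k) * u (f k))" by auto
    have "(\<lambda>x. \<Sum>k\<in>insert k F. a k * f k x) = (\<lambda>x. a k * f k x + 1 * (\<Sum>k\<in>F. a k * f k x))"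
      using insert by simp
    then show ?case
      using GS_space_lincomb[OF 1 2(1) ts, of "a k" 1] antilinear_onD[OF al 1 2(1), of "a k" 1] 2(2) insert
      by simp
  qed
  then show "(\<lambda>x. \<Sum>k\<in>F. a k * f k x) \<in> GS_space t s"
    and "u (\<lambda>x. \<Sum>k\<in>F. a k * f k x) = (\<Sum>k\<in>F. cnj (a k) * u (f k))" by auto
qed

lemma gevrey_le_supp:
  assumes "gevrey_le s h (\<lambda>_. C) f"
  shows "gevrey_le s h (\<lambda>x. if x \<in> fun_supp f then C else 0) f"
  using assms unfolding gevrey_le_def by (auto simp: iter_partial_eq_0_outside_supp)

lemma GS_dual_localized_bound:
  fixes u :: "(real ^ 'n::finite \<Rightarrow> complex) \<Rightarrow> complex"
  assumes u: "u \<in> GS_dual t s" and ts: "0 < t" "1 < s" and \<phi>: "\<phi> \<in> Gevrey_c s"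
  obtains h \<kappa> C where "0 < h" "0 < \<kappa>" "0 < C" "\<forall>f w D \<xi>. gevrey_bdd s f \<longrightarrow> gevrey_le s h w f \<longrightarrow>
      (\<forall>x\<in>fun_supp \<phi>. w x \<le> D) \<longrightarrow> 0 \<le> D \<longrightarrow>
      cmod (u (\<lambda>x. f x * cnj (\<phi> x) * expi \<xi> x)) \<le> C * D * exp (\<kappa> * norm \<xi> powr (1 / s))"
proof -
  have s0: "0 < s" "1 \<le> s" using ts by auto
  obtain h0 r M where h0: "0 < h0" and r: "0 < r" and M: "0 < M" "\<And>\<phi> C. \<phi> \<in> GS_space t s \<Longrightarrow>
    gevrey_le s h0 (\<lambda>x. C * gs_weight t r x) \<phi> \<Longrightarrow> cmod (u \<phi>) \<le> M * C"
    using GS_dual_bound[OF u ts(1) s0(1)] by metis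
  define h where "h = h0 / 4"
  have h: "h > 0" using h0 by (simp add: h_def)
  have b\<phi>: "gevrey_bdd s (\<lambda>x. cnj (\<phi> x))" by (rule gevrey_bdd_cnj[OF Gevrey_c_gevrey_bdd[OF \<phi> s0(1)]])
  obtain K where K: "K > 0" "gevrey_le s h (\<lambda>_. K) (\<lambda>x. cnj (\<phi> x))" using gevrey_bddD[OF b\<phi> h] .
  have supp: "fun_supp (\<lambda>x. cnj (\<phi> x)) = fun_supp \<phi>" by (simp add: fun_supp_def)
  obtain R where R: "R > 0" "fun_supp \<phi> \<subseteq> cball 0 R" using Gevrey_c_ball[OF \<phi>] .
  define \<kappa> where "\<kappa> = s * (1 / (2 * h)) powr (1 / s)"
  define C where "C = M * (K * exp (r * R powr (1 / t)))"
  show ?thesis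
  proof (rule that[of h \<kappa> C])
    show "h > 0" by fact
    show "\<kappa> > 0" using s0 h by (simp add: \<kappa>_def)
    show "C > 0" using M K by (simp add: C_def)
  next
    show "\<forall>f w D \<xi>. gevrey_bdd s f \<longrightarrow> gevrey_le s h w f \<longrightarrow>
      (\<forall>x\<in>fun_supp \<phi>. w x \<le> D) \<longrightarrow> 0 \<le> D \<longrightarrow>
      cmod (u (\<lambda>x. f x * cnj (\<phi> x) * expi \<xi> x)) \<le> C * D * exp (\<kappa> * norm \<xi> powr (1 / s))"
    proof (intro allI impI)
      fix f w D \<xi>
      assume f: "gevrey_bdd s f" "gevrey_le s h w f" and w: "\<forall>x\<in>fun_supp \<phi>. w x \<le> D" and D: "0 \<le> D"
      define \<psi> where "\<psi> = (\<lambda>x. f x * cnj (\<phi> x) * expi \<xi> x)"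
      define E where "E = exp (\<kappa> * norm \<xi> powr (1 / s))"
      have "\<psi> = (\<lambda>x. cnj (\<phi> x) * (f x * expi \<xi> x))" by (auto simp: \<psi>_def mult_ac)
      then have \<psi>c: "\<psi> \<in> Gevrey_c s"
        using Gevrey_c_mult[OF Gevrey_c_cnj[OF \<phi> s0(1)] gevrey_bdd_mult[OF f(1) gevrey_bdd_expi[OF s0(1)] s0(2)] s0(2)] by simp
      have 1: "gevrey_le s (2 * h) (\<lambda>x. w x * (if x \<in> fun_supp \<phi> then K else 0)) (\<lambda>x. f x * cnj (\<phi> x))"
        using gevrey_le_mult[OF gevrey_bdd_smooth[OF f(1)] gevrey_bdd_smooth[OF b\<phi>] f(2) gevrey_le_supp[OF K(2)] s0(2) h]
        by (simp add: supp)
      have 2: "gevrey_le s (2 * (2 * h)) (\<lambda>x. (w x * (if x \<in> fun_supp \<phi> then K else 0)) * E) \<psi>"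
        unfolding \<psi>_def E_def \<kappa>_def
        by (rule gevrey_le_mult[OF _ smooth_expi 1 gevrey_le_expi s0(2)])
           (use smooth_mult[OF gevrey_bdd_smooth[OF f(1)] gevrey_bdd_smooth[OF b\<phi>]] h s0 in auto)
      have 3: "gevrey_le s h0 (\<lambda>_. D * K * E) \<psi>"
        by (rule gevrey_le_mono[OF 2]) (use h w D K in \<open>auto simp: h_def E_def intro!: mult_right_mono\<close>)
      have "fun_supp \<psi> \<subseteq> cball 0 R"
        using fun_supp_mono[of \<phi> \<psi>] R(2) by (auto simp: \<psi>_def)
      from gevrey_le_weight_of_supp[OF 3 this h0 ts(1) r] R(1)
      have "gevrey_le s h0 (\<lambda>x. (D * K * E * exp (r * R powr (1 / t))) * gs_weight t r x) \<psi>" by simp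
      from M(2)[OF Gevrey_c_subset_GS[OF \<psi>c s0(1) ts(1)] this]
      show "cmod (u (\<lambda>x. f x * cnj (\<phi> x) * expi \<xi> x)) \<le> C * D * exp (\<kappa> * norm \<xi> powr (1 / s))"
        by (simp add: \<psi>_def C_def E_def mult_ac)
    qed
  qed
qed

lemma le_exp_minusI: "exp X * g \<le> K \<Longrightarrow> g \<le> K * exp (- X)" for X g K :: real
  by (simp add: exp_minus inverse_eq_divide pos_le_divide_eq mult.commute)

lemma cone_neighbourhood:
  fixes \<Gamma> :: "'a::real_normed_vector set"
  assumes "open \<Gamma>" "\<xi>0 \<in> \<Gamma>" "\<And>\<xi> c. \<xi> \<in> \<Gamma> \<Longrightarrow> 0 < c \<Longrightarrow> c *\<^sub>R \<xi> \<in> \<Gamma>" "\<xi>0 \<noteq> 0"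
  obtains \<epsilon> \<mu> where "0 < \<epsilon>" "0 < \<mu>" "\<And>c \<xi> \<eta>. 0 < c \<Longrightarrow> dist \<xi> \<xi>0 < \<epsilon> \<Longrightarrow> norm \<eta> \<le> \<epsilon> * c \<Longrightarrow>
    c *\<^sub>R \<xi> + \<eta> \<in> \<Gamma> \<and> \<mu> * c \<le> norm (c *\<^sub>R \<xi> + \<eta>)"
proof -
  obtain d where d: "d > 0" "ball \<xi>0 d \<subseteq> \<Gamma>" using assms(1,2) open_contains_ball by blast
  define \<epsilon> where "\<epsilon> = min (d / 2) (norm \<xi>0 / 4)"
  have \<epsilon>: "\<epsilon> > 0" "2 * \<epsilon> \<le> d" "4 * \<epsilon> \<le> norm \<xi>0" using d assms(4) by (auto simp: \<epsilon>_def)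
  have "c *\<^sub>R \<xi> + \<eta> \<in> \<Gamma> \<and> \<epsilon> * c \<le> norm (c *\<^sub>R \<xi> + \<eta>)"
    if "0 < c" "dist \<xi> \<xi>0 < \<epsilon>" "norm \<eta> \<le> \<epsilon> * c" for c \<xi> \<eta>
  proof -
    define \<zeta> where "\<zeta> = \<xi> + (1 / c) *\<^sub>R \<eta>"
    have "norm ((1 / c) *\<^sub>R \<eta>) \<le> \<epsilon>" using that by (simp add: divide_le_eq)
    then have "dist \<zeta> \<xi>0 < 2 * \<epsilon>"
      using that(2) norm_triangle_ineq[of "\<xi> - \<xi>0" "(1 / c) *\<^sub>R \<eta>"] by (simp add: \<zeta>_def dist_norm algebra_simps)
    then have "dist \<xi>0 \<zeta> < d" "norm (\<xi>0 - \<zeta>) < 2 * \<epsilon>"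
      using \<epsilon> by (auto simp: dist_norm norm_minus_commute)
    then have "\<zeta> \<in> \<Gamma>" "norm \<zeta> \<ge> \<epsilon>"
      using d(2) \<epsilon> norm_triangle_ineq2[of \<xi>0 \<zeta>] by auto
    moreover have "c *\<^sub>R \<xi> + \<eta> = c *\<^sub>R \<zeta>" using that by (simp add: \<zeta>_def scaleR_add_right)
    ultimately show ?thesis using assms(3)[of \<zeta> c] that(1) by simp
  qed
  then show ?thesis using \<epsilon>(1) that[of \<epsilon> \<epsilon>] by blast
qed

text \<open>Expand \<open>b\<close> into a Fourier series on a large cube.  The frequencies \<open>\<eta>\<close> that are small
  compared with \<open>\<xi>\<close> keep \<open>\<xi> + \<eta>\<close> inside the cone; for the others the decay of the Fourier
  coefficients of \<open>b\<close> beats the growth of the localized Fourier transform.\<close>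

lemma microlocal_multiplication:
  fixes u :: "(real ^ 'n::finite \<Rightarrow> complex) \<Rightarrow> complex"
  assumes u: "u \<in> GS_dual t s" and ts: "0 < t" "1 < s" and \<phi>: "\<phi> \<in> Gevrey_c s"
    and \<Gamma>: "open \<Gamma>" "\<xi>0 \<in> \<Gamma>" "\<And>\<xi> c. \<xi> \<in> \<Gamma> \<Longrightarrow> 0 < c \<Longrightarrow> c *\<^sub>R \<xi> \<in> \<Gamma>" "\<xi>0 \<noteq> 0"
    and dec: "\<And>r. r > 0 \<Longrightarrow> bdd_above
                ((\<lambda>\<xi>. exp (r * norm \<xi> powr (1 / s)) * cmod (localized_fourier u \<phi> \<xi>)) ` \<Gamma>)"
  obtains \<epsilon> where "0 < \<epsilon>" "\<And>R0 r. 0 < R0 \<Longrightarrow> 0 < r \<Longrightarrow> \<exists>h>0. \<exists>C>0. \<forall>b B \<xi> \<tau>. gevrey_bdd s b \<longrightarrow>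
     fun_supp b \<subseteq> cball 0 R0 \<longrightarrow> gevrey_le s h (\<lambda>_. B) b \<longrightarrow> 0 < \<tau> \<longrightarrow> dist \<xi> \<xi>0 < \<epsilon> \<longrightarrow>
     exp (r * \<tau>) * cmod (u (\<lambda>x. b x * cnj (\<phi> x) * expi (\<tau> powr s *\<^sub>R \<xi>) x)) \<le> C * B"
proof -
  have s0: "0 < s" "1 \<le> s" using ts by auto
  have al: "antilinear_on (GS_space t s) u" using u by (auto simp: GS_dual_def)
  obtain \<epsilon> \<mu> where \<epsilon>: "0 < \<epsilon>" and \<mu>: "0 < \<mu>" and cone: "\<And>c \<xi> \<eta>. 0 < c \<Longrightarrow> dist \<xi> \<xi>0 < \<epsilon> \<Longrightarrow> norm \<eta> \<le> \<epsilon> * c \<Longrightarrow>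
    c *\<^sub>R \<xi> + \<eta> \<in> \<Gamma> \<and> \<mu> * c \<le> norm (c *\<^sub>R \<xi> + \<eta>)"
    using cone_neighbourhood[OF \<Gamma>] by metis
  obtain h1 \<kappa>1 C1 where h1: "0 < h1" and \<kappa>1: "0 < \<kappa>1" and C1: "0 < C1" and ub0: "\<forall>f w D \<xi>. gevrey_bdd s f \<longrightarrow> gevrey_le s h1 w f \<longrightarrow>
      (\<forall>x\<in>fun_supp \<phi>. w x \<le> D) \<longrightarrow> 0 \<le> D \<longrightarrow>
      cmod (u (\<lambda>x. f x * cnj (\<phi> x) * expi \<xi> x)) \<le> C1 * D * exp (\<kappa>1 * norm \<xi> powr (1 / s))"
    using GS_dual_localized_bound[OF u ts \<phi>] .
  note ub = ub0[rule_format]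
  define G where "G \<zeta> = u (\<lambda>x. cnj (\<phi> x) * expi \<zeta> x)" for \<zeta>
  have Gcrude: "cmod (G \<zeta>) \<le> C1 * exp (\<kappa>1 * norm \<zeta> powr (1 / s))" for \<zeta>
    using ub[OF gevrey_bdd_const gevrey_le_const[OF h1], of 1 1 \<zeta>] by (simp add: G_def)
  define c0 where "c0 = (2 * pi) powr (- real CARD('n) / 2)"
  have c0: "c0 > 0" by (simp add: c0_def)
  have locG: "localized_fourier u \<phi> \<zeta> = of_real c0 * G \<zeta>" for \<zeta>
    by (simp add: localized_fourier_def G_def expi_def c0_def)
  have Gdec: "\<exists>K>0. \<forall>\<zeta>\<in>\<Gamma>. cmod (G \<zeta>) \<le> K * exp (- r * norm \<zeta> powr (1 / s))" if rpos: "r > 0" for r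
  proof -
    obtain K where K: "\<And>\<xi>. \<xi> \<in> \<Gamma> \<Longrightarrow> exp (r * norm \<xi> powr (1 / s)) * cmod (localized_fourier u \<phi> \<xi>) \<le> K"
      using dec[OF rpos] by (auto simp: bdd_above_def)
    have "cmod (G \<zeta>) \<le> (\<bar>K\<bar> / c0 + 1) * exp (- r * norm \<zeta> powr (1 / s))" if "\<zeta> \<in> \<Gamma>" for \<zeta>
    proof -
      have "exp (r * norm \<zeta> powr (1 / s)) * (c0 * cmod (G \<zeta>)) \<le> \<bar>K\<bar>"
        using K[OF that] c0 by (simp add: locG norm_mult)
      then have "exp (r * norm \<zeta> powr (1 / s)) * cmod (G \<zeta>) \<le> \<bar>K\<bar> / c0 + 1"
        using c0 by (simp add: field_simps)
      from le_exp_minusI[OF this] show ?thesis by simp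
    qed
    moreover have "\<bar>K\<bar> / c0 + 1 > 0" using c0 by (simp add: add_nonneg_pos)
    ultimately show ?thesis by blast
  qed
  obtain R1 where R1: "R1 > 0" "fun_supp \<phi> \<subseteq> cball 0 R1" using Gevrey_c_ball[OF \<phi>] .
  show ?thesis
  proof (rule that[OF \<epsilon>])
    fix R0 r :: real assume R0: "0 < R0" and r: "0 < r"
    define L where "L = R0 + R1 + 2"
    have L: "R0 + 1 < L" "R1 < L" "0 < L" using R0 R1 by (auto simp: L_def)
    define \<kappa>2 where "\<kappa>2 = s * (1 / h1) powr (1 / s)"
    have \<kappa>2: "\<kappa>2 > 0" using s0 h1 by (simp add: \<kappa>2_def)
    define Q where "Q = (norm \<xi>0 + \<epsilon>) / \<epsilon> + 1"
    have Q: "Q > 0" using \<epsilon> by (simp add: Q_def add_nonneg_pos)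
    define r1 where "r1 = r / \<epsilon> powr (1 / s)"
    have r1: "r1 > 0" using r \<epsilon> by (simp add: r1_def)
    define \<rho> where "\<rho> = \<kappa>1 * Q powr (1 / s) + r1 + \<kappa>2 + 1"
    have "0 \<le> \<kappa>1 * Q powr (1 / s)" using \<kappa>1 by simp
    then have \<rho>: "\<rho> > 0" "1 \<le> \<rho>" "\<kappa>2 + 1 \<le> \<rho>" using r1 \<kappa>2 unfolding \<rho>_def by linarith+
    obtain h A0 where h: "0 < h" and A0: "0 < A0" "\<And>(F :: real ^ 'n \<Rightarrow> complex) B \<xi>. smooth_fun F \<Longrightarrow>
      gevrey_le s h (\<lambda>x. B * gs_weight t 1 x) F \<Longrightarrow> cmod (fint F \<xi>) * exp (\<rho> * norm \<xi> powr (1 / s)) \<le> A0 * B"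
      using fourier_decay[OF s0(1) ts(1) zero_less_one \<rho>(1), where 'n = 'n] by metis
    obtain K where K: "K > 0" "\<And>\<zeta>. \<zeta> \<in> \<Gamma> \<Longrightarrow> cmod (G \<zeta>) \<le> K * exp (- (r / \<mu> powr (1 / s)) * norm \<zeta> powr (1 / s))"
      using Gdec[of "r / \<mu> powr (1 / s)"] r \<mu> by auto
    define W where "W = infsum (\<lambda>k :: 'n \<Rightarrow> int. gs_weight s 1 (freq L k)) UNIV"
    have Ws: "(\<lambda>k :: 'n \<Rightarrow> int. gs_weight s 1 (freq L k)) summable_on UNIV"
      by (rule summable_on_gs_weight_freq) (use s0 L in auto)
    have W: "W \<ge> 0" unfolding W_def by (rule infsum_nonneg) simp
    define A where "A = A0 * exp (R0 powr (1 / t)) / (2 * L) ^ CARD('n)"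
    have A: "A > 0" using A0 L by (simp add: A_def)
    define C where "C = (K + C1) * A * (W + 1)"
    have "exp (r * \<tau>) * cmod (u (\<lambda>x. b x * cnj (\<phi> x) * expi (\<tau> powr s *\<^sub>R \<xi>) x)) \<le> C * B"
      if b: "gevrey_bdd s b" and supp: "fun_supp b \<subseteq> cball 0 R0" and B: "gevrey_le s h (\<lambda>_. B) b"
        and \<tau>: "0 < \<tau>" and \<xi>: "dist \<xi> \<xi>0 < \<epsilon>" for b B \<xi> \<tau>
    proof -
      have B0: "B \<ge> 0" using gevrey_le_nonneg[OF B] by blast
      define c where "c k = fint b (freq L k) / of_real ((2 * L) ^ CARD('n))" for k
      have cb: "cmod (c k) * exp (\<rho> * norm (freq L k) powr (1 / s)) \<le> A * B" for k
      proof -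
        have "gevrey_le s h (\<lambda>x. (B * exp (1 * R0 powr (1 / t))) * gs_weight t 1 x) b"
          by (rule gevrey_le_weight_of_supp[OF B supp h ts(1)]) (use R0 in auto)
        from A0(2)[OF gevrey_bdd_smooth[OF b] this, of "freq L k"]
        have "cmod (fint b (freq L k)) * exp (\<rho> * norm (freq L k) powr (1 / s)) / (2 * L) ^ CARD('n) \<le>
          A0 * (B * exp (1 * R0 powr (1 / t))) / (2 * L) ^ CARD('n)"
          using L by (intro divide_right_mono) auto
        moreover have "cmod (c k) = cmod (fint b (freq L k)) / (2 * L) ^ CARD('n)"
          using L by (simp add: c_def norm_divide norm_power norm_mult)
        ultimately show ?thesis by (simp add: A_def mult_ac)
      qed
      have cb': "cmod (c k) * exp (\<sigma> * norm (freq L k) powr (1 / s)) \<le> A * B * gs_weight s 1 (freq L k)"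
        if "\<sigma> + 1 \<le> \<rho>" for \<sigma> k
      proof -
        define X where "X = norm (freq L k) powr (1 / s)"
        have "(\<sigma> + 1) * X \<le> \<rho> * X" using that by (intro mult_right_mono) (auto simp: X_def)
        then have "exp (\<sigma> * X) \<le> exp (\<rho> * X) * exp (- X)"
          by (simp add: exp_add[symmetric] algebra_simps)
        then have "cmod (c k) * exp (\<sigma> * X) \<le> cmod (c k) * (exp (\<rho> * X) * exp (- X))"
          by (intro mult_left_mono) auto
        also have "\<dots> \<le> A * B * exp (- X)"
          using mult_right_mono[OF cb[of k], of "exp (- X)"] by (simp add: X_def mult_ac)
        finally show ?thesis by (simp add: X_def gs_weight_def)
      qed
      define a where "a k = cmod (c k) * exp (\<kappa>2 * norm (freq L k) powr (1 / s))" for k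
      have sa: "a summable_on UNIV"
        by (rule summable_on_comparison_test[OF summable_on_cmult_right[OF Ws, of "A * B"]])
           (use cb'[OF \<rho>(3)] in \<open>auto simp: a_def\<close>)
      define \<zeta> where "\<zeta> = \<tau> powr s *\<^sub>R \<xi>"
      have \<tau>s: "(\<tau> powr s) powr (1 / s) = \<tau>" using \<tau> s0 by (simp add: powr_powr)
      have term_bound: "exp (r * \<tau>) * (cmod (c k) * cmod (G (\<zeta> + freq L k))) \<le> (K + C1) * A * B * gs_weight s 1 (freq L k)" for k
      proof (cases "norm (freq L k) \<le> \<epsilon> * \<tau> powr s")
        case True
        have z: "\<zeta> + freq L k \<in> \<Gamma>" "\<mu> * \<tau> powr s \<le> norm (\<zeta> + freq L k)"
          using cone[OF _ \<xi> True] \<tau> by (auto simp: \<zeta>_def)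
        have "(\<mu> * \<tau> powr s) powr (1 / s) \<le> norm (\<zeta> + freq L k) powr (1 / s)"
          using z(2) \<mu> s0 by (intro powr_mono2) auto
        then have "\<mu> powr (1 / s) * \<tau> \<le> norm (\<zeta> + freq L k) powr (1 / s)"
          using \<mu> \<tau> by (simp add: powr_mult \<tau>s)
        then have "r * \<tau> \<le> (r / \<mu> powr (1 / s)) * norm (\<zeta> + freq L k) powr (1 / s)"
          using r \<mu> by (simp add: field_simps)
        then have "exp (r * \<tau>) * exp (- (r / \<mu> powr (1 / s)) * norm (\<zeta> + freq L k) powr (1 / s)) \<le> 1"
          by (simp add: exp_add[symmetric])
        then have Y: "K * (exp (r * \<tau>) * exp (- (r / \<mu> powr (1 / s)) * norm (\<zeta> + freq L k) powr (1 / s))) \<le> K * 1"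
          using K(1) by (intro mult_left_mono) auto
        have "exp (r * \<tau>) * cmod (G (\<zeta> + freq L k)) \<le>
            exp (r * \<tau>) * (K * exp (- (r / \<mu> powr (1 / s)) * norm (\<zeta> + freq L k) powr (1 / s)))"
          by (intro mult_left_mono K(2) z(1)) auto
        also have "\<dots> = K * (exp (r * \<tau>) * exp (- (r / \<mu> powr (1 / s)) * norm (\<zeta> + freq L k) powr (1 / s)))"
          by (simp only: mult_ac)
        also have "\<dots> \<le> K * 1" by (rule Y)
        finally have "exp (r * \<tau>) * cmod (G (\<zeta> + freq L k)) \<le> K" by simp
        then have "exp (r * \<tau>) * cmod (G (\<zeta> + freq L k)) \<le> K + C1" using C1 by simp
        then have "(exp (r * \<tau>) * cmod (G (\<zeta> + freq L k))) * cmod (c k) \<le> (K + C1) * (A * B * gs_weight s 1 (freq L k))"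
          using cb'[of 0 k] \<rho>(2) K(1) C1 by (intro mult_mono) auto
        then show ?thesis by (simp add: mult_ac)
      next
        case False
        define y where "y = norm (freq L k)"
        define X where "X = y powr (1 / s)"
        have y: "\<epsilon> * \<tau> powr s < y" using False by (simp add: y_def)
        have y0: "y > 0" using y \<epsilon> \<tau> by (smt (verit) mult_nonneg_nonneg powr_ge_zero)
        have "(\<epsilon> * \<tau> powr s) powr (1 / s) \<le> X"
          unfolding X_def using y \<epsilon> s0 by (intro powr_mono2) auto
        then have "\<tau> \<le> X / \<epsilon> powr (1 / s)" using \<epsilon> \<tau> by (simp add: powr_mult \<tau>s field_simps)
        then have rt: "r * \<tau> \<le> r1 * X" using r mult_left_mono[of \<tau> "X / \<epsilon> powr (1 / s)" r] by (simp add: r1_def)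
        have "norm \<xi> \<le> norm \<xi>0 + \<epsilon>"
          using \<xi> norm_triangle_ineq2[of \<xi> \<xi>0] by (simp add: dist_norm)
        then have "norm \<zeta> \<le> \<tau> powr s * (norm \<xi>0 + \<epsilon>)" by (simp add: \<zeta>_def mult_left_mono)
        also have "\<dots> \<le> (y / \<epsilon>) * (norm \<xi>0 + \<epsilon>)"
          using y \<epsilon> by (intro mult_right_mono) (auto simp: field_simps)
        finally have "norm \<zeta> \<le> (y / \<epsilon>) * (norm \<xi>0 + \<epsilon>)" .
        moreover have "(y / \<epsilon>) * (norm \<xi>0 + \<epsilon>) + y = Q * y"
          using \<epsilon> by (simp add: Q_def add_divide_distrib algebra_simps)
        ultimately have "norm (\<zeta> + freq L k) \<le> Q * y"
          using norm_triangle_ineq[of \<zeta> "freq L k"] unfolding y_def by linarith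
        then have "norm (\<zeta> + freq L k) powr (1 / s) \<le> (Q * y) powr (1 / s)"
          using s0 by (intro powr_mono2) auto
        also have "\<dots> = Q powr (1 / s) * X" using Q y0 by (simp add: powr_mult X_def)
        finally have "\<kappa>1 * norm (\<zeta> + freq L k) powr (1 / s) \<le> \<kappa>1 * (Q powr (1 / s) * X)"
          using \<kappa>1 by (intro mult_left_mono) auto
        then have "r * \<tau> + \<kappa>1 * norm (\<zeta> + freq L k) powr (1 / s) \<le> (\<kappa>1 * Q powr (1 / s) + r1) * X"
          using rt by (simp add: algebra_simps)
        then have "exp (r * \<tau>) * exp (\<kappa>1 * norm (\<zeta> + freq L k) powr (1 / s)) \<le> exp ((\<kappa>1 * Q powr (1 / s) + r1) * X)"
          by (simp add: exp_add[symmetric])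
        then have "cmod (c k) * C1 * (exp (r * \<tau>) * exp (\<kappa>1 * norm (\<zeta> + freq L k) powr (1 / s))) \<le>
            cmod (c k) * C1 * exp ((\<kappa>1 * Q powr (1 / s) + r1) * X)"
          using C1 by (intro mult_left_mono) auto
        also have "\<dots> = C1 * (cmod (c k) * exp ((\<kappa>1 * Q powr (1 / s) + r1) * norm (freq L k) powr (1 / s)))"
          by (simp add: X_def y_def mult_ac)
        also have "\<dots> \<le> C1 * (A * B * gs_weight s 1 (freq L k))"
          using C1 \<kappa>2 by (intro mult_left_mono cb') (auto simp: \<rho>_def)
        also have "\<dots> \<le> (K + C1) * (A * B * gs_weight s 1 (freq L k))"
          using K(1) A B0 by (intro mult_right_mono) auto
        finally have 1: "cmod (c k) * C1 * (exp (r * \<tau>) * exp (\<kappa>1 * norm (\<zeta> + freq L k) powr (1 / s))) \<le>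
           (K + C1) * (A * B * gs_weight s 1 (freq L k))" .
        have "exp (r * \<tau>) * (cmod (c k) * cmod (G (\<zeta> + freq L k))) \<le>
          exp (r * \<tau>) * (cmod (c k) * (C1 * exp (\<kappa>1 * norm (\<zeta> + freq L k) powr (1 / s))))"
          by (intro mult_left_mono Gcrude) auto
        also have "\<dots> = cmod (c k) * C1 * (exp (r * \<tau>) * exp (\<kappa>1 * norm (\<zeta> + freq L k) powr (1 / s)))"
          by (simp only: mult_ac)
        also note 1
        finally show ?thesis by (simp only: mult.assoc)
      qed
      define u0 where "u0 = cmod (u (\<lambda>x. b x * cnj (\<phi> x) * expi \<zeta> x))"
      define E where "E = C1 * exp (\<kappa>1 * norm \<zeta> powr (1 / s))"
      have E: "E > 0" using C1 by (simp add: E_def)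
      have main: "u0 \<le> E * infsum a (UNIV - F) + (\<Sum>k\<in>F. cmod (c k) * cmod (G (\<zeta> + freq L k)))" if F: "finite F" for F
      proof -
        define d where "d = (\<lambda>y. 1 * b y + (- 1) * (\<Sum>k\<in>F. c k * expi (freq L k) y))"
        have bs: "gevrey_bdd s (\<lambda>y. \<Sum>k\<in>F. c k * expi (freq L k) y)"
        proof (rule gevrey_bdd_sum[OF F])
          fix k show "gevrey_bdd s (\<lambda>y. c k * expi (freq L k) y)"
            by (intro gevrey_bdd_mult gevrey_bdd_const gevrey_bdd_expi s0)
        qed
        have bd: "gevrey_bdd s d" unfolding d_def by (intro gevrey_bdd_lincomb b bs)
        obtain Kd where Kd: "gevrey_le s h1 (\<lambda>_. Kd) d" using gevrey_bddD[OF bd h1] by metis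
        have "gevrey_le s h1 (\<lambda>x. if norm x < L then infsum a (UNIV - F) else Kd) d"
          unfolding gevrey_le_def
        proof (intro allI)
          fix js x
          show "cmod (iter_partial js d x) \<le> (if norm x < L then infsum a (UNIV - F) else Kd) * h1 ^ length js * fact (length js) powr s"
          proof (cases "norm x < L")
            case True
            have "cmod (iter_partial js d x) \<le> infsum a (UNIV - F) * h1 ^ length js * fact (length js) powr s"
              unfolding d_def a_def
              by (rule gevrey_fourier_tail[OF s0(1) b supp R0 L(1) h1 \<kappa>2_def c_def sa[unfolded a_def] F True])
            then show ?thesis using True by simp
          qed (use gevrey_leD[OF Kd] in auto)
        qed
        then have "cmod (u (\<lambda>x. d x * cnj (\<phi> x) * expi \<zeta> x)) \<le> C1 * infsum a (UNIV - F) * exp (\<kappa>1 * norm \<zeta> powr (1 / s))"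
        proof (rule ub[OF bd])
          show "0 \<le> infsum a (UNIV - F)" by (rule infsum_nonneg) (simp add: a_def)
          fix x assume "x \<in> fun_supp \<phi>"
          then have "norm x < L" using R1 L by force
          then show "(if norm x < L then infsum a (UNIV - F) else Kd) \<le> infsum a (UNIV - F)" by simp
        qed
        then have ud: "cmod (u (\<lambda>x. d x * cnj (\<phi> x) * expi \<zeta> x)) \<le> E * infsum a (UNIV - F)"
          by (simp add: E_def mult_ac)
        have fk: "(\<lambda>x. cnj (\<phi> x) * expi (\<zeta> + freq L k) x) \<in> GS_space t s" for k
          by (intro Gevrey_c_subset_GS Gevrey_c_mult Gevrey_c_cnj \<phi> gevrey_bdd_expi s0 ts)
        note sumF = antilinear_on_sum[OF al ts(1) s0(1) F fk, of c]
        have dG: "(\<lambda>x. d x * cnj (\<phi> x) * expi \<zeta> x) \<in> GS_space t s"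
        proof -
          have "(\<lambda>x. cnj (\<phi> x) * (d x * expi \<zeta> x)) \<in> GS_space t s"
            by (intro Gevrey_c_subset_GS Gevrey_c_mult Gevrey_c_cnj \<phi> gevrey_bdd_expi gevrey_bdd_mult bd s0 ts)
          then show ?thesis by (simp add: mult_ac)
        qed
        have "(\<lambda>x. b x * cnj (\<phi> x) * expi \<zeta> x) =
          (\<lambda>x. 1 * (d x * cnj (\<phi> x) * expi \<zeta> x) + 1 * (\<Sum>k\<in>F. c k * (cnj (\<phi> x) * expi (\<zeta> + freq L k) x)))"
          by (rule ext) (simp add: d_def expi_add sum_distrib_left sum_distrib_right sum_negf algebra_simps)
        then have "u (\<lambda>x. b x * cnj (\<phi> x) * expi \<zeta> x) =
           u (\<lambda>x. d x * cnj (\<phi> x) * expi \<zeta> x) + (\<Sum>k\<in>F. cnj (c k) * G (\<zeta> + freq L k))"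
          using antilinear_onD[OF al dG sumF(1), of 1 1] sumF(2) by (simp add: G_def)
        then have "u0 \<le> cmod (u (\<lambda>x. d x * cnj (\<phi> x) * expi \<zeta> x)) + cmod (\<Sum>k\<in>F. cnj (c k) * G (\<zeta> + freq L k))"
          unfolding u0_def by (simp add: norm_triangle_ineq)
        also have "cmod (\<Sum>k\<in>F. cnj (c k) * G (\<zeta> + freq L k)) \<le> (\<Sum>k\<in>F. cmod (c k) * cmod (G (\<zeta> + freq L k)))"
          by (rule order_trans[OF norm_sum]) (simp add: norm_mult)
        finally show ?thesis using ud by linarith
      qed
      have "exp (r * \<tau>) * u0 \<le> C * B + \<delta>" if \<delta>: "\<delta> > 0" for \<delta>
      proof -
        define \<delta>' where "\<delta>' = \<delta> / (exp (r * \<tau>) * E)"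
        have \<delta>': "\<delta>' > 0" using \<delta> E by (simp add: \<delta>'_def)
        obtain F where F: "finite F" "dist (sum a F) (infsum a UNIV) \<le> \<delta>'"
          using has_sum_finite_approximation[OF has_sum_infsum[OF sa] \<delta>'] by auto
        have "infsum a (UNIV - F) = infsum a UNIV - sum a F"
          using infsum_Diff[OF sa, of F] F(1) by simp
        then have tail: "infsum a (UNIV - F) \<le> \<delta>'" using F(2) by (simp add: dist_real_def)
        have "exp (r * \<tau>) * (\<Sum>k\<in>F. cmod (c k) * cmod (G (\<zeta> + freq L k))) \<le>
           (\<Sum>k\<in>F. (K + C1) * A * B * gs_weight s 1 (freq L k))"
          unfolding sum_distrib_left by (intro sum_mono term_bound)
        also have "\<dots> = (K + C1) * A * B * (\<Sum>k\<in>F. gs_weight s 1 (freq L k))"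
          by (simp add: sum_distrib_left)
        also have "\<dots> \<le> (K + C1) * A * B * (W + 1)"
        proof (rule mult_left_mono)
          have "(\<Sum>k\<in>F. gs_weight s 1 (freq L k)) \<le> W"
            unfolding W_def by (rule finite_sum_le_infsum[OF Ws F(1)]) auto
          then show "(\<Sum>k\<in>F. gs_weight s 1 (freq L k)) \<le> W + 1" by simp
        qed (use K C1 A B0 in auto)
        also have "\<dots> = C * B" by (simp add: C_def mult_ac)
        finally have 1: "exp (r * \<tau>) * (\<Sum>k\<in>F. cmod (c k) * cmod (G (\<zeta> + freq L k))) \<le> C * B" .
        have "exp (r * \<tau>) * (E * infsum a (UNIV - F)) \<le> exp (r * \<tau>) * (E * \<delta>')"
          using E tail by (intro mult_left_mono) auto
        also have "\<dots> = \<delta>" using E by (simp add: \<delta>'_def)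
        finally have 2: "exp (r * \<tau>) * (E * infsum a (UNIV - F)) \<le> \<delta>" .
        have "exp (r * \<tau>) * u0 \<le> exp (r * \<tau>) * (E * infsum a (UNIV - F) + (\<Sum>k\<in>F. cmod (c k) * cmod (G (\<zeta> + freq L k))))"
          by (intro mult_left_mono main[OF F(1)]) auto
        then show ?thesis using 1 2 by (simp add: distrib_left)
      qed
      then have "exp (r * \<tau>) * u0 \<le> C * B" by (rule field_le_epsilon)
      then show ?thesis by (simp add: u0_def \<zeta>_def)
    qed
    moreover have "C > 0" using K(1) C1 A W by (simp add: C_def add_nonneg_pos add_pos_pos)
    ultimately show "\<exists>h>0. \<exists>C>0. \<forall>b B \<xi> \<tau>. gevrey_bdd s b \<longrightarrow>
      fun_supp b \<subseteq> cball 0 R0 \<longrightarrow> gevrey_le s h (\<lambda>_. B) b \<longrightarrow> 0 < \<tau> \<longrightarrow> dist \<xi> \<xi>0 < \<epsilon> \<longrightarrow>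
      exp (r * \<tau>) * cmod (u (\<lambda>x. b x * cnj (\<phi> x) * expi (\<tau> powr s *\<^sub>R \<xi>) x)) \<le> C * B"
      using h by blast
  qed
qed

subsection \<open>Decay of the short-time Fourier transform\<close>

lemma exists_cutoff_large:
  assumes "1 < s" "0 < R"
  obtains \<kappa> :: "real ^ 'n::finite \<Rightarrow> complex" where "\<kappa> \<in> Gevrey_c s" "\<And>x. norm x \<le> R \<Longrightarrow> \<kappa> x = 1"
proof -
  obtain \<kappa>0 :: "real ^ 'n \<Rightarrow> complex" and B where \<kappa>0: "gevrey_bdd s \<kappa>0" "B > 0"
    "\<And>x. norm x \<le> 1 \<Longrightarrow> \<kappa>0 x = 1" "\<And>x. norm x \<ge> B \<Longrightarrow> \<kappa>0 x = 0"
    using exists_plateau[OF assms(1)] by metis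
  define \<kappa> where "\<kappa> x = \<kappa>0 ((1 / R) *\<^sub>R x + 0)" for x
  show ?thesis
  proof (rule that[of \<kappa>])
    show "\<kappa> \<in> Gevrey_c s"
    proof (rule Gevrey_cI)
      show "gevrey_bdd s \<kappa>" unfolding \<kappa>_def by (rule gevrey_bdd_affine[OF \<kappa>0(1)])
      have "fun_supp \<kappa> \<subseteq> cball 0 (R * B)"
      proof (rule fun_supp_subset_closed)
        fix x assume "\<kappa> x \<noteq> 0"
        then have "norm ((1 / R) *\<^sub>R x) < B" using \<kappa>0(4)[of "(1 / R) *\<^sub>R x"] unfolding \<kappa>_def by force
        then show "x \<in> cball 0 (R * B)" using assms by (simp add: field_simps)
      qed simp
      then show "compact (fun_supp \<kappa>)" by (rule compact_fun_supp[OF compact_cball])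
    qed (use assms in simp)
    show "\<kappa> x = 1" if "norm x \<le> R" for x
      unfolding \<kappa>_def using that assms by (intro \<kappa>0(3)) simp
  qed
qed

lemma gs_weight_product_le:
  assumes "0 < t" "0 \<le> \<rho>"
  shows "gs_weight t (\<rho> * 2 powr (1 / t)) y * gs_weight t (\<rho> * 2 powr (1 / t)) (y - x) \<le> gs_weight t \<rho> x"
proof -
  define r where "r = \<rho> * 2 powr (1 / t)"
  have r: "r \<ge> 0" "r / 2 powr (1 / t) = \<rho>" using assms by (auto simp: r_def)
  have "gs_weight t r (y - x) = gs_weight t r (x - y)" by (simp add: gs_weight_def norm_minus_commute)
  also have "\<dots> \<le> exp (r * norm y powr (1 / t)) * gs_weight t \<rho> x"
    using gs_weight_diff_le[OF assms(1) r(1), of x y] by (simp only: r(2))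
  finally have "gs_weight t r y * gs_weight t r (y - x) \<le> gs_weight t r y * (exp (r * norm y powr (1 / t)) * gs_weight t \<rho> x)"
    by (rule mult_left_mono) simp
  also have "\<dots> = gs_weight t \<rho> x" by (simp add: gs_weight_def exp_add[symmetric])
  finally show ?thesis by (simp only: r_def)
qed

lemma translate_fun_affine: "translate_fun x f = (\<lambda>y. f (1 *\<^sub>R y + (- x)))"
  by (simp add: translate_fun_def)

lemma L2_pairing_spatial_decay:
  fixes f \<psi> :: "real ^ 'n::finite \<Rightarrow> complex"
  assumes f: "f \<in> GS_space t s" and \<psi>: "\<psi> \<in> GS_space t s" and ts: "0 < t" "0 < s" and \<rho>: "0 < \<rho>"
  obtains C where "0 < C" "\<And>a K x \<xi>. a \<in> borel_measurable borel \<Longrightarrow> (\<And>y. cmod (a y) \<le> K) \<Longrightarrow>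
    cmod (L2_pairing f (\<lambda>y. a y * (translate_fun x \<psi> y * expi \<xi> y))) \<le> C * K * gs_weight t \<rho> x"
proof -
  define r where "r = \<rho> * 2 powr (1 / t)"
  have r: "r > 0" using \<rho> by (simp add: r_def)
  obtain A where A: "A > 0" "gevrey_le s 1 (\<lambda>x. A * gs_weight t (r + 1) x) f"
    using GS_space_weightE[OF f ts, of 1 "r + 1"] r by auto
  obtain B where B: "B > 0" "gevrey_le s 1 (\<lambda>x. B * gs_weight t r x) \<psi>"
    using GS_space_weightE[OF \<psi> ts, of 1 r] r by auto
  define W where "W = (\<integral>x. gs_weight t 1 (x :: real ^ 'n) \<partial>lborel)"
  have W: "W \<ge> 0" unfolding W_def by (rule integral_nonneg_AE) auto
  show ?thesis
  proof (rule that[of "A * B * (W + 1)"])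
    show "A * B * (W + 1) > 0" using A B W by simp
    fix a :: "real ^ 'n \<Rightarrow> complex" and K and x \<xi> :: "real ^ 'n"
    assume [measurable]: "a \<in> borel_measurable borel" and K: "\<And>y. cmod (a y) \<le> K"
    have K0: "K \<ge> 0" using K[of 0] norm_ge_zero order_trans by blast
    have [measurable]: "f \<in> borel_measurable borel" "\<psi> \<in> borel_measurable borel" "expi \<xi> \<in> borel_measurable borel"
      by (intro smooth_fun_measurable GS_space_smooth[OF f] GS_space_smooth[OF \<psi>] smooth_expi)+
    have [measurable]: "translate_fun x \<psi> \<in> borel_measurable borel"
      unfolding translate_fun_def by measurable
    have [measurable]: "cnj \<in> borel_measurable borel"
      by (intro borel_measurable_continuous_onI continuous_intros)
    have "cmod (L2_pairing f (\<lambda>y. a y * (translate_fun x \<psi> y * expi \<xi> y))) \<le> (A * B * K * gs_weight t \<rho> x) * W"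
      unfolding L2_pairing_def W_def
    proof (rule integrable_weight_bound(2)[OF ts(1) zero_less_one])
      show "(\<lambda>y. f y * cnj (a y * (translate_fun x \<psi> y * expi \<xi> y))) \<in> borel_measurable borel" by measurable
      fix y
      have "cmod (f y) \<le> A * (gs_weight t r y * gs_weight t 1 y)"
        using gevrey_le_cmod[OF A(2), of y] by (simp add: gs_weight_def exp_add[symmetric] algebra_simps)
      moreover have "cmod (translate_fun x \<psi> y) \<le> B * gs_weight t r (y - x)"
        using gevrey_le_cmod[OF B(2), of "y - x"] by (simp add: translate_fun_def)
      ultimately have "cmod (f y) * (cmod (a y) * cmod (translate_fun x \<psi> y)) \<le>
         (A * (gs_weight t r y * gs_weight t 1 y)) * (K * (B * gs_weight t r (y - x)))"
        using A(1) B(1) K0 by (intro mult_mono K) auto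
      also have "\<dots> = A * B * K * gs_weight t 1 y * (gs_weight t r y * gs_weight t r (y - x))" by (simp add: mult_ac)
      also have "\<dots> \<le> A * B * K * gs_weight t 1 y * gs_weight t \<rho> x"
        unfolding r_def using A(1) B(1) K0 \<rho> ts by (intro mult_left_mono gs_weight_product_le) auto
      finally show "cmod (f y * cnj (a y * (translate_fun x \<psi> y * expi \<xi> y))) \<le> A * B * K * gs_weight t \<rho> x * gs_weight t 1 y"
        by (simp add: norm_mult mult_ac)
    qed
    also have "\<dots> \<le> (A * B * K * gs_weight t \<rho> x) * (W + 1)"
      using A(1) B(1) K0 by (intro mult_left_mono) auto
    finally show "cmod (L2_pairing f (\<lambda>y. a y * (translate_fun x \<psi> y * expi \<xi> y))) \<le> A * B * (W + 1) * K * gs_weight t \<rho> x"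
      by (simp add: mult_ac)
  qed
qed

lemma L2_pairing_frequency_decay:
  fixes f :: "real ^ 'n::finite \<Rightarrow> complex"
  assumes f: "f \<in> GS_space t s" and ts: "0 < t" "1 \<le> s" and r: "0 < r"
  obtains h C where "0 < h" "0 < C" "\<And>a D \<xi>. smooth_fun a \<Longrightarrow> gevrey_le s h (\<lambda>_. D) a \<Longrightarrow>
    cmod (L2_pairing f (\<lambda>y. a y * expi \<xi> y)) * exp (r * norm \<xi> powr (1 / s)) \<le> C * D"
proof -
  have s0: "0 < s" using ts by simp
  obtain h C where h: "0 < h" and C: "0 < C" "\<And>(F :: real ^ 'n \<Rightarrow> complex) B \<xi>. smooth_fun F \<Longrightarrow>
    gevrey_le s h (\<lambda>x. B * gs_weight t 1 x) F \<Longrightarrow> cmod (fint F \<xi>) * exp (r * norm \<xi> powr (1 / s)) \<le> C * B"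
    using fourier_decay[OF s0 ts(1) zero_less_one r, where 'n = 'n] by metis
  obtain A where A: "A > 0" "gevrey_le s (h/2) (\<lambda>x. A * gs_weight t 1 x) f"
    using GS_space_weightE[OF f ts(1) s0, of "h/2" 1] h by auto
  have sf: "smooth_fun f" by (rule GS_space_smooth[OF f])
  show ?thesis
  proof (rule that[of "h/2" "C * A"])
    fix a :: "real ^ 'n \<Rightarrow> complex" and D and \<xi> :: "real ^ 'n"
    assume a: "smooth_fun a" "gevrey_le s (h/2) (\<lambda>_. D) a"
    have "gevrey_le s (2 * (h/2)) (\<lambda>x. (A * gs_weight t 1 x) * D) (\<lambda>x. f x * cnj (a x))"
      by (rule gevrey_le_mult[OF sf smooth_cnj[OF a(1)] A(2) gevrey_le_cnj[OF a]]) (use ts h in auto)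
    then have "gevrey_le s h (\<lambda>x. (A * D) * gs_weight t 1 x) (\<lambda>x. f x * cnj (a x))"
      by (simp add: mult_ac)
    from C(2)[OF smooth_mult[OF sf smooth_cnj[OF a(1)]] this, of \<xi>]
    show "cmod (L2_pairing f (\<lambda>y. a y * expi \<xi> y)) * exp (r * norm \<xi> powr (1 / s)) \<le> C * A * D"
      by (simp add: L2_pairing_eq_fint mult_ac)
  qed (use h C A in auto)
qed

lemma STFT_eq_expi:
  "STFT \<psi> u x \<xi> = of_real ((2 * pi) powr (- real CARD('n) / 2)) * u (\<lambda>y. translate_fun x \<psi> y * expi \<xi> y)"
  for \<psi> :: "real ^ 'n::finite \<Rightarrow> complex"
  by (simp add: STFT_def modulate_fun_eq)

lemma compact_plus_GS_cutoff:
  fixes u :: "(real ^ 'n::finite \<Rightarrow> complex) \<Rightarrow> complex"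
  assumes "u \<in> compact_plus_GS t s" "1 < s" "0 < t"
  obtains f \<kappa> R where "u \<in> GS_dual t s" "f \<in> GS_space t s" "\<kappa> \<in> Gevrey_c s" "0 < R" "fun_supp \<kappa> \<subseteq> cball 0 R"
    "\<forall>g\<in>GS_space t s. u g = u (\<lambda>x. \<kappa> x * g x) - L2_pairing f (\<lambda>x. \<kappa> x * g x) + L2_pairing f g"
proof -
  obtain v f where u: "u \<in> GS_dual t s" and v: "v \<in> compact_ultradistributions s" and f: "f \<in> GS_space t s"
    and uv: "\<And>\<phi>. \<phi> \<in> Gevrey_c s \<Longrightarrow> u \<phi> = v \<phi> + L2_pairing f \<phi>"
    using assms(1) by (auto simp: compact_plus_GS_def)
  have al: "antilinear_on (Gevrey_c s) v" and cv: "compact (ultra_supp s v)"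
    using v by (auto simp: compact_ultradistributions_def ultradistributions_def)
  obtain b where b: "\<forall>x\<in>ultra_supp s v. norm x \<le> b" using compact_imp_bounded[OF cv] bounded_iff by blast
  define R2 where "R2 = max b 0 + 1"
  have R2: "R2 > 0" by (simp add: R2_def add_nonneg_pos)
  obtain \<kappa> :: "real ^ 'n \<Rightarrow> complex" where \<kappa>: "\<kappa> \<in> Gevrey_c s" "\<And>x. norm x \<le> R2 \<Longrightarrow> \<kappa> x = 1"
    using exists_cutoff_large[OF assms(2) R2] by metis
  obtain R where R: "R > 0" "fun_supp \<kappa> \<subseteq> cball 0 R" using Gevrey_c_ball[OF \<kappa>(1)] .
  have "u g = u (\<lambda>x. \<kappa> x * g x) - L2_pairing f (\<lambda>x. \<kappa> x * g x) + L2_pairing f g" if "g \<in> GS_space t s" for g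
  proof (rule cutoff_identity[OF assms(2,3) u al f uv \<kappa>(1) open_ball _ _ that])
    show "ultra_supp s v \<subseteq> ball 0 R2" using b by (force simp: R2_def)
  qed (use \<kappa>(2) in auto)
  then show ?thesis by (intro that[OF u f \<kappa>(1) R]) blast
qed

lemma STFT_spatial_decay:
  fixes u :: "(real ^ 'n::finite \<Rightarrow> complex) \<Rightarrow> complex"
  assumes s: "1 < s" and t: "0 < t" and \<psi>: "\<psi> \<in> GS_space t s" and u: "u \<in> compact_plus_GS t s"
  obtains q where "0 < q" "\<And>\<rho>. 0 < \<rho> \<Longrightarrow> \<exists>C>0. \<forall>x \<xi>. cmod (STFT \<psi> u x \<xi>) \<le>
    C * (exp (- \<rho> * norm x powr (1 / t)) * exp (q * norm \<xi> powr (1 / s)))"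
proof -
  have s0: "0 < s" "1 \<le> s" using s by auto
  obtain f \<kappa> R where ud: "u \<in> GS_dual t s" and f: "f \<in> GS_space t s" and \<kappa>: "\<kappa> \<in> Gevrey_c s"
    and R: "0 < R" "fun_supp \<kappa> \<subseteq> cball 0 R"
    and cut0: "\<forall>g\<in>GS_space t s. u g = u (\<lambda>x. \<kappa> x * g x) - L2_pairing f (\<lambda>x. \<kappa> x * g x) + L2_pairing f g"
    using compact_plus_GS_cutoff[OF u s t] .
  note cut = cut0[rule_format]
  have \<kappa>': "(\<lambda>x. cnj (\<kappa> x)) \<in> Gevrey_c s" by (rule Gevrey_c_cnj[OF \<kappa> s0(1)])
  obtain h q C1 where h: "0 < h" and q: "0 < q" and C1: "0 < C1" and ub0: "\<forall>f w D \<xi>. gevrey_bdd s f \<longrightarrow>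
      gevrey_le s h w f \<longrightarrow> (\<forall>x\<in>fun_supp (\<lambda>x. cnj (\<kappa> x)). w x \<le> D) \<longrightarrow> 0 \<le> D \<longrightarrow>
      cmod (u (\<lambda>x. f x * cnj (cnj (\<kappa> x)) * expi \<xi> x)) \<le> C1 * D * exp (q * norm \<xi> powr (1 / s))"
    using GS_dual_localized_bound[OF ud t s \<kappa>'] .
  have supp: "fun_supp (\<lambda>x. cnj (\<kappa> x)) = fun_supp \<kappa>" by (simp add: fun_supp_def)
  have smk: "smooth_fun \<kappa>" and sm\<psi>: "smooth_fun \<psi>"
    using gevrey_bdd_smooth[OF Gevrey_c_gevrey_bdd[OF \<kappa> s0(1)]] GS_space_smooth[OF \<psi>] .
  obtain K where K: "K > 0" "gevrey_le s 1 (\<lambda>_. K) \<kappa>"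
    using gevrey_bddD[OF Gevrey_c_gevrey_bdd[OF \<kappa> s0(1)], of 1] by auto
  define c0 where "c0 = (2 * pi) powr (- real CARD('n) / 2)"
  have c0: "c0 > 0" by (simp add: c0_def)
  show ?thesis
  proof (rule that[OF q])
    fix \<rho> :: real assume \<rho>: "0 < \<rho>"
    define r where "r = \<rho> * 2 powr (1 / t)"
    have r: "r > 0" using \<rho> by (simp add: r_def)
    obtain B where B: "B > 0" "gevrey_le s h (\<lambda>x. B * gs_weight t r x) \<psi>"
      using GS_space_weightE[OF \<psi> t s0(1) h r] .
    obtain C2 where C2: "0 < C2" "\<And>a K x \<xi>. a \<in> borel_measurable borel \<Longrightarrow> (\<And>y. cmod (a y) \<le> K) \<Longrightarrow>
      cmod (L2_pairing f (\<lambda>y. a y * (translate_fun x \<psi> y * expi \<xi> y))) \<le> C2 * K * gs_weight t \<rho> x"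
      by (rule L2_pairing_spatial_decay[OF f \<psi> t s0(1) \<rho>]) blast
    define C where "C = c0 * (C1 * (B * exp (r * R powr (1 / t))) + C2 * K + C2)"
    have "cmod (STFT \<psi> u x \<xi>) \<le> C * (exp (- \<rho> * norm x powr (1 / t)) * exp (q * norm \<xi> powr (1 / s)))" for x \<xi>
    proof -
      define E where "E = exp (q * norm \<xi> powr (1 / s))"
      have E: "E \<ge> 1" using q by (simp add: E_def)
      define g where "g = (\<lambda>y. translate_fun x \<psi> y * expi \<xi> y)"
      have T: "translate_fun x \<psi> \<in> GS_space t s" by (rule GS_space_translate[OF \<psi> t s0(1)])
      have g: "g \<in> GS_space t s"
        unfolding g_def by (rule GS_space_mult[OF T gevrey_bdd_expi[OF s0(1)] t s0(2)])
      have "cmod (u (\<lambda>y. translate_fun x \<psi> y * cnj (cnj (\<kappa> y)) * expi \<xi> y)) \<le>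
         C1 * (B * (exp (r * R powr (1 / t)) * gs_weight t \<rho> x)) * exp (q * norm \<xi> powr (1 / s))"
      proof (rule ub0[rule_format, OF GS_space_gevrey_bdd[OF T t s0(1)], where w = "\<lambda>y. B * gs_weight t r (y - x)"])
        show "gevrey_le s h (\<lambda>y. B * gs_weight t r (y - x)) (translate_fun x \<psi>)"
          using gevrey_le_affine[OF sm\<psi> B(2), of 1 h "- x"] h by (simp add: translate_fun_affine)
        show "0 \<le> B * (exp (r * R powr (1 / t)) * gs_weight t \<rho> x)" using B by simp
        fix y assume "y \<in> fun_supp (\<lambda>x. cnj (\<kappa> x))"
        then have y: "norm y \<le> R" using R by (auto simp: supp)
        have "gs_weight t r (y - x) = gs_weight t r (x - y)" by (simp add: gs_weight_def norm_minus_commute)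
        also have "\<dots> \<le> exp (r * norm y powr (1 / t)) * gs_weight t (r / 2 powr (1 / t)) x"
          using r t by (intro gs_weight_diff_le) auto
        also have "r / 2 powr (1 / t) = \<rho>" by (simp add: r_def)
        also have "exp (r * norm y powr (1 / t)) * gs_weight t \<rho> x \<le> exp (r * R powr (1 / t)) * gs_weight t \<rho> x"
          using y r t by (intro mult_right_mono) (auto intro!: powr_mono2)
        finally show "B * gs_weight t r (y - x) \<le> B * (exp (r * R powr (1 / t)) * gs_weight t \<rho> x)"
          using B by (intro mult_left_mono) auto
      qed
      then have 1: "cmod (u (\<lambda>y. \<kappa> y * g y)) \<le> C1 * (B * exp (r * R powr (1 / t))) * (gs_weight t \<rho> x * E)"
        by (simp add: g_def E_def mult_ac)
      have wE: "gs_weight t \<rho> x \<le> gs_weight t \<rho> x * E" using mult_left_mono[OF E, of "gs_weight t \<rho> x"] by simp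
      have 2: "cmod (L2_pairing f (\<lambda>y. \<kappa> y * g y)) \<le> C2 * K * (gs_weight t \<rho> x * E)"
      proof -
        have "cmod (L2_pairing f (\<lambda>y. \<kappa> y * g y)) \<le> C2 * K * gs_weight t \<rho> x"
          unfolding g_def by (rule C2(2)[OF smooth_fun_measurable[OF smk] gevrey_le_cmod[OF K(2)]])
        also have "\<dots> \<le> C2 * K * (gs_weight t \<rho> x * E)" using C2(1) K(1) by (intro mult_left_mono wE) auto
        finally show ?thesis .
      qed
      have 3: "cmod (L2_pairing f g) \<le> C2 * (gs_weight t \<rho> x * E)"
      proof -
        have "cmod (L2_pairing f (\<lambda>y. 1 * g y)) \<le> C2 * 1 * gs_weight t \<rho> x"
          unfolding g_def by (rule C2(2)) auto
        also have "\<dots> \<le> C2 * (gs_weight t \<rho> x * E)" using C2(1) wE by simp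
        finally show ?thesis by simp
      qed
      have "cmod (u g) \<le> cmod (u (\<lambda>y. \<kappa> y * g y)) + cmod (L2_pairing f (\<lambda>y. \<kappa> y * g y)) + cmod (L2_pairing f g)"
        unfolding cut[OF g] by (rule order_trans[OF norm_triangle_ineq]) (simp add: norm_triangle_ineq4)
      also have "\<dots> \<le> C1 * (B * exp (r * R powr (1 / t))) * (gs_weight t \<rho> x * E) + C2 * K * (gs_weight t \<rho> x * E) + C2 * (gs_weight t \<rho> x * E)"
        by (intro add_mono 1 2 3)
      also have "\<dots> = (C1 * (B * exp (r * R powr (1 / t))) + C2 * K + C2) * (gs_weight t \<rho> x * E)"
        by (simp add: algebra_simps)
      finally have "c0 * cmod (u g) \<le> c0 * ((C1 * (B * exp (r * R powr (1 / t))) + C2 * K + C2) * (gs_weight t \<rho> x * E))"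
        using c0 by (intro mult_left_mono) auto
      moreover have "cmod (STFT \<psi> u x \<xi>) = c0 * cmod (u g)"
        using c0 by (simp add: STFT_eq_expi g_def norm_mult c0_def)
      ultimately show ?thesis by (simp add: C_def gs_weight_def E_def mult_ac)
    qed
    moreover have "C > 0" using c0 C1 C2(1) B(1) K(1) by (auto simp: C_def intro!: mult_pos_pos add_pos_pos)
    ultimately show "\<exists>C>0. \<forall>x \<xi>. cmod (STFT \<psi> u x \<xi>) \<le> C * (exp (- \<rho> * norm x powr (1 / t)) * exp (q * norm \<xi> powr (1 / s)))"
      by blast
  qed
qed

text \<open>Where the cutoff \<open>\<kappa>\<close> lives, \<open>1 = (\<Sum>y. \<phi> y * cnj (\<phi> y)) / q\<close> for finitely many of the
  functions \<open>\<phi> y\<close> that witness \<open>(y, \<xi>0) \<notin> WF_Gevrey s u\<close>; the term \<open>1 - \<kappa>1\<close> keeps \<open>q\<close> away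
  from zero elsewhere.\<close>

lemma STFT_frequency_decay:
  fixes u :: "(real ^ 'n::finite \<Rightarrow> complex) \<Rightarrow> complex"
  assumes s: "1 < s" and t: "0 < t" and \<psi>: "\<psi> \<in> GS_space t s" and u: "u \<in> compact_plus_GS t s"
    and \<xi>0: "\<xi>0 \<noteq> 0" and wf: "\<And>y. (y, \<xi>0) \<notin> WF_Gevrey s u"
  obtains \<epsilon> where "0 < \<epsilon>" "\<And>r. 0 < r \<Longrightarrow> \<exists>C. \<forall>x \<xi> \<tau>. 0 < \<tau> \<longrightarrow> dist \<xi> \<xi>0 < \<epsilon> \<longrightarrow>
    exp (r * \<tau>) * cmod (STFT \<psi> u x (\<tau> powr s *\<^sub>R \<xi>)) \<le> C"
proof -
  have s0: "0 < s" "1 \<le> s" using s by auto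
  obtain f \<kappa> R where ud: "u \<in> GS_dual t s" and f: "f \<in> GS_space t s" and \<kappa>: "\<kappa> \<in> Gevrey_c s"
    and R: "0 < R" "fun_supp \<kappa> \<subseteq> cball 0 R"
    and cut0: "\<forall>g\<in>GS_space t s. u g = u (\<lambda>x. \<kappa> x * g x) - L2_pairing f (\<lambda>x. \<kappa> x * g x) + L2_pairing f g"
    using compact_plus_GS_cutoff[OF u s t] .
  note cut = cut0[rule_format]
  have al: "antilinear_on (GS_space t s) u" using ud by (auto simp: GS_dual_def)
  have b\<kappa>: "gevrey_bdd s \<kappa>" by (rule Gevrey_c_gevrey_bdd[OF \<kappa> s0(1)])
  obtain \<kappa>1 :: "real ^ 'n \<Rightarrow> complex" where \<kappa>1: "\<kappa>1 \<in> Gevrey_c s" "\<And>x. norm x \<le> R \<Longrightarrow> \<kappa>1 x = 1"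
    using exists_cutoff_large[OF s R(1)] by metis
  have b\<kappa>1: "gevrey_bdd s \<kappa>1" by (rule Gevrey_c_gevrey_bdd[OF \<kappa>1(1) s0(1)])
  define P where "P \<phi> \<longleftrightarrow> (\<exists>\<Gamma>. open \<Gamma> \<and> \<Gamma> \<subseteq> - {0} \<and> \<xi>0 \<in> \<Gamma> \<and> (\<forall>\<xi>\<in>\<Gamma>. \<forall>c>0. c *\<^sub>R \<xi> \<in> \<Gamma>) \<and>
      (\<forall>r>0. bdd_above
        ((\<lambda>\<xi>. exp (r * norm \<xi> powr (1 / s)) * cmod (localized_fourier u \<phi> \<xi>)) ` \<Gamma>)))" for \<phi>
  have "(y, \<xi>0) \<in> WF_Gevrey s u \<longleftrightarrow> \<not> (\<exists>\<phi>\<in>Gevrey_c s. \<phi> y = 1 \<and> P \<phi>)" for y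
    using \<xi>0 by (simp add: WF_Gevrey_def P_def)
  then have "\<forall>y. \<exists>\<phi>. \<phi> \<in> Gevrey_c s \<and> \<phi> y = 1 \<and> P \<phi>" using wf by auto
  from choice[OF this] obtain \<phi> where \<phi>: "\<And>y. \<phi> y \<in> Gevrey_c s" "\<And>y. \<phi> y y = 1" and \<phi>\<Gamma>: "\<And>y. P (\<phi> y)"
    by auto
  have b\<phi>: "gevrey_bdd s (\<phi> y)" for y by (rule Gevrey_c_gevrey_bdd[OF \<phi>(1) s0(1)])
  define M where "M y \<epsilon> R0 r \<longleftrightarrow> (\<exists>h>0. \<exists>C>0. \<forall>b B \<xi> \<tau>. gevrey_bdd s b \<longrightarrow>
     fun_supp b \<subseteq> cball 0 R0 \<longrightarrow> gevrey_le s h (\<lambda>_. B) b \<longrightarrow> 0 < \<tau> \<longrightarrow> dist \<xi> \<xi>0 < \<epsilon> \<longrightarrow>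
     exp (r * \<tau>) * cmod (u (\<lambda>x. b x * cnj (\<phi> y x) * expi (\<tau> powr s *\<^sub>R \<xi>) x)) \<le> C * B)" for y \<epsilon> R0 r
  have "\<forall>y. \<exists>\<epsilon>>0. \<forall>R0 r. 0 < R0 \<longrightarrow> 0 < r \<longrightarrow> M y \<epsilon> R0 r"
  proof
    fix y
    obtain \<Gamma> where \<Gamma>: "open \<Gamma>" "\<xi>0 \<in> \<Gamma>" "\<forall>\<xi>\<in>\<Gamma>. \<forall>c>0. c *\<^sub>R \<xi> \<in> \<Gamma>"
      "\<forall>r>0. bdd_above ((\<lambda>\<xi>. exp (r * norm \<xi> powr (1 / s)) * cmod (localized_fourier u (\<phi> y) \<xi>)) ` \<Gamma>)"
      using \<phi>\<Gamma>[of y] unfolding P_def by auto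
    show "\<exists>\<epsilon>>0. \<forall>R0 r. 0 < R0 \<longrightarrow> 0 < r \<longrightarrow> M y \<epsilon> R0 r"
      unfolding M_def
      by (rule microlocal_multiplication[OF ud t s \<phi>(1)[of y] \<Gamma>(1,2) \<Gamma>(3)[rule_format] \<xi>0 \<Gamma>(4)[rule_format]])
         auto
  qed
  from choice[OF this] obtain e where e: "\<And>y. e y > 0" and mm: "\<And>y R0 r. 0 < R0 \<Longrightarrow> 0 < r \<Longrightarrow> M y (e y) R0 r"
    by auto
  define V where "V y = {x. 1/2 < cmod (\<phi> y x)}" for y
  have V: "open (V y)" "y \<in> V y" for y
  proof -
    have "continuous_on UNIV (\<phi> y)" by (rule smooth_fun_continuous[OF gevrey_bdd_smooth[OF b\<phi>]])
    then show "open (V y)" unfolding V_def by (intro open_Collect_less continuous_intros)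
    show "y \<in> V y" by (simp add: V_def \<phi>(2))
  qed
  obtain Y where Y: "finite Y" "fun_supp \<kappa>1 \<subseteq> (\<Union>y\<in>Y. V y)"
  proof (rule compactE_image[OF Gevrey_c_supp[OF \<kappa>1(1)], of "fun_supp \<kappa>1" V])
    show "fun_supp \<kappa>1 \<subseteq> (\<Union>y\<in>fun_supp \<kappa>1. V y)" using V(2) by blast
  qed (use V(1) in auto)
  define q where "q x = 1 * (\<Sum>y\<in>Y. \<phi> y x * cnj (\<phi> y x)) + 1 * ((1 * 1 + (-1) * \<kappa>1 x) * cnj (1 * 1 + (-1) * \<kappa>1 x))" for x
  have bq: "gevrey_bdd s q"
    unfolding q_def
    by (intro gevrey_bdd_lincomb gevrey_bdd_sum Y(1) gevrey_bdd_mult gevrey_bdd_cnj b\<phi> b\<kappa>1 gevrey_bdd_const s0)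
  have qge: "1/4 \<le> cmod (q x)" for x
  proof -
    have qr: "q x = of_real ((\<Sum>y\<in>Y. (cmod (\<phi> y x))\<^sup>2) + (cmod (1 - \<kappa>1 x))\<^sup>2)"
      unfolding q_def by (simp add: complex_norm_square del: of_real_power)
    have nn: "(\<Sum>y\<in>Y. (cmod (\<phi> y x))\<^sup>2) \<ge> 0" by (intro sum_nonneg) simp
    have "(\<Sum>y\<in>Y. (cmod (\<phi> y x))\<^sup>2) + (cmod (1 - \<kappa>1 x))\<^sup>2 \<ge> 1/4"
    proof (cases "x \<in> fun_supp \<kappa>1")
      case True
      then obtain y where y: "y \<in> Y" "1/2 < cmod (\<phi> y x)" using Y(2) by (auto simp: V_def)
      have "1/4 = (1/2 :: real)\<^sup>2" by (simp add: power2_eq_square)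
      also have "\<dots> \<le> (cmod (\<phi> y x))\<^sup>2" using y by (intro power_mono) auto
      also have "\<dots> \<le> (\<Sum>y\<in>Y. (cmod (\<phi> y x))\<^sup>2)" by (rule member_le_sum) (use y Y in auto)
      finally have "1/4 \<le> (\<Sum>y\<in>Y. (cmod (\<phi> y x))\<^sup>2)" .
      moreover have "0 \<le> (cmod (1 - \<kappa>1 x))\<^sup>2" by simp
      ultimately show ?thesis by linarith
    next
      case False
      then have "\<kappa>1 x = 0" using in_fun_supp by blast
      then show ?thesis using nn by simp
    qed
    then show ?thesis unfolding qr norm_of_real by linarith
  qed
  have bi: "gevrey_bdd s (\<lambda>x. inverse (q x))"
    by (rule gevrey_bdd_inverse[OF bq s _ qge]) simp
  define c where "c y x = \<kappa> x * inverse (q x) * \<phi> y x" for y x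
  have bc: "gevrey_bdd s (c y)" for y unfolding c_def by (intro gevrey_bdd_mult b\<kappa> bi b\<phi> s0)
  have split: "\<kappa> x = (\<Sum>y\<in>Y. c y x * cnj (\<phi> y x))" for x
  proof (cases "\<kappa> x = 0")
    case False
    then have "norm x \<le> R" using in_fun_supp R(2) by force
    then have "q x = (\<Sum>y\<in>Y. \<phi> y x * cnj (\<phi> y x))" by (simp add: q_def \<kappa>1(2))
    moreover have "q x \<noteq> 0" using qge[of x] by auto
    ultimately have "\<kappa> x = \<kappa> x * inverse (q x) * (\<Sum>y\<in>Y. \<phi> y x * cnj (\<phi> y x))" by simp
    then show ?thesis by (simp add: c_def sum_distrib_left mult.assoc)
  qed (simp add: c_def)
  define \<epsilon> where "\<epsilon> = Min (insert (norm \<xi>0 / 2) (e ` Y))"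
  have \<epsilon>: "\<epsilon> > 0" "\<epsilon> \<le> norm \<xi>0 / 2" "\<And>y. y \<in> Y \<Longrightarrow> \<epsilon> \<le> e y"
  proof -
    show "\<epsilon> > 0" using Y(1) e \<xi>0 by (simp add: \<epsilon>_def)
    show "\<epsilon> \<le> norm \<xi>0 / 2" unfolding \<epsilon>_def by (rule Min_le) (use Y(1) in auto)
    show "\<epsilon> \<le> e y" if "y \<in> Y" for y unfolding \<epsilon>_def by (rule Min_le) (use Y(1) that in auto)
  qed
  define c0 where "c0 = (2 * pi) powr (- real CARD('n) / 2)"
  have c0: "c0 > 0" by (simp add: c0_def)
  have sm\<psi>: "smooth_fun \<psi>" by (rule GS_space_smooth[OF \<psi>])
  have b\<psi>: "gevrey_bdd s \<psi>" by (rule GS_space_gevrey_bdd[OF \<psi> t s0(1)])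
  have trans: "gevrey_le s h (\<lambda>_. D) (translate_fun x \<psi>)" if "gevrey_le s h (\<lambda>_. D) \<psi>" "h > 0" for h D x
    using gevrey_le_affine[OF sm\<psi> that(1), of 1 h "- x"] that(2) by (simp add: translate_fun_affine)
  have bT: "gevrey_bdd s (translate_fun x \<psi>)" for x
    unfolding translate_fun_affine by (rule gevrey_bdd_affine[OF b\<psi>])
  show ?thesis
  proof (rule that[OF \<epsilon>(1)])
    fix r :: real assume r: "0 < r"
    have "\<exists>C. \<forall>x \<xi> \<tau>. 0 < \<tau> \<longrightarrow> dist \<xi> \<xi>0 < \<epsilon> \<longrightarrow>
        exp (r * \<tau>) * cmod (u (\<lambda>z. c y z * translate_fun x \<psi> z * cnj (\<phi> y z) * expi (\<tau> powr s *\<^sub>R \<xi>) z)) \<le> C"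
      if y: "y \<in> Y" for y
    proof -
      obtain h C where h: "h > 0" "C > 0" and hC: "\<And>b B \<xi> \<tau>. gevrey_bdd s b \<Longrightarrow>
        fun_supp b \<subseteq> cball 0 R \<Longrightarrow> gevrey_le s h (\<lambda>_. B) b \<Longrightarrow> 0 < \<tau> \<Longrightarrow> dist \<xi> \<xi>0 < e y \<Longrightarrow>
        exp (r * \<tau>) * cmod (u (\<lambda>x. b x * cnj (\<phi> y x) * expi (\<tau> powr s *\<^sub>R \<xi>) x)) \<le> C * B"
        using mm[OF R(1) r, of y] unfolding M_def by auto
      have h2: "h / 2 > 0" using h by simp
      obtain D1 where D1: "gevrey_le s (h/2) (\<lambda>_. D1) (c y)" using gevrey_bddD[OF bc h2] by metis
      obtain D2 where D2: "gevrey_le s (h/2) (\<lambda>_. D2) \<psi>" using gevrey_bddD[OF b\<psi> h2] by metis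
      have "exp (r * \<tau>) * cmod (u (\<lambda>z. c y z * translate_fun x \<psi> z * cnj (\<phi> y z) * expi (\<tau> powr s *\<^sub>R \<xi>) z)) \<le> C * (D1 * D2)"
        if \<tau>: "0 < \<tau>" "dist \<xi> \<xi>0 < \<epsilon>" for x \<xi> \<tau>
      proof (rule hC[OF _ _ _ \<tau>(1)])
        show "gevrey_bdd s (\<lambda>z. c y z * translate_fun x \<psi> z)" by (intro gevrey_bdd_mult bc bT s0)
        show "fun_supp (\<lambda>z. c y z * translate_fun x \<psi> z) \<subseteq> cball 0 R"
          using fun_supp_mono[of \<kappa> "\<lambda>z. c y z * translate_fun x \<psi> z"] R(2) by (auto simp: c_def)
        show "gevrey_le s h (\<lambda>_. D1 * D2) (\<lambda>z. c y z * translate_fun x \<psi> z)"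
          using gevrey_le_mult[OF gevrey_bdd_smooth[OF bc] gevrey_bdd_smooth[OF bT] D1 trans[OF D2 h2] s0(2) h2] by simp
        show "dist \<xi> \<xi>0 < e y" using \<tau>(2) \<epsilon>(3)[OF y] by simp
      qed
      then show ?thesis by blast
    qed
    then have "\<forall>y\<in>Y. \<exists>C. \<forall>x \<xi> \<tau>. 0 < \<tau> \<longrightarrow> dist \<xi> \<xi>0 < \<epsilon> \<longrightarrow>
        exp (r * \<tau>) * cmod (u (\<lambda>z. c y z * translate_fun x \<psi> z * cnj (\<phi> y z) * expi (\<tau> powr s *\<^sub>R \<xi>) z)) \<le> C"
      by (rule ballI)
    from bchoice[OF this] obtain C1 where C1': "\<forall>y\<in>Y. \<forall>x \<xi> \<tau>. 0 < \<tau> \<longrightarrow> dist \<xi> \<xi>0 < \<epsilon> \<longrightarrow>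
        exp (r * \<tau>) * cmod (u (\<lambda>z. c y z * translate_fun x \<psi> z * cnj (\<phi> y z) * expi (\<tau> powr s *\<^sub>R \<xi>) z)) \<le> C1 y" ..
    note C1 = C1'[rule_format]
    define r' where "r' = r / (norm \<xi>0 / 2) powr (1 / s)"
    have r': "r' > 0" using r \<xi>0 by (simp add: r'_def)
    obtain h C2 where h: "0 < h" and C2: "0 < C2" "\<And>a D \<xi>. smooth_fun a \<Longrightarrow> gevrey_le s h (\<lambda>_. D) a \<Longrightarrow>
      cmod (L2_pairing f (\<lambda>y. a y * expi \<xi> y)) * exp (r' * norm \<xi> powr (1 / s)) \<le> C2 * D"
      using L2_pairing_frequency_decay[OF f t s0(2) r'] by metis
    have h2: "h / 2 > 0" using h by simp
    obtain D0 where D0: "gevrey_le s h (\<lambda>_. D0) \<psi>" using gevrey_bddD[OF b\<psi> h] by metis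
    obtain D1 where D1: "gevrey_le s (h/2) (\<lambda>_. D1) \<kappa>" using gevrey_bddD[OF b\<kappa> h2] by metis
    obtain D2 where D2: "gevrey_le s (h/2) (\<lambda>_. D2) \<psi>" using gevrey_bddD[OF b\<psi> h2] by metis
    have "exp (r * \<tau>) * cmod (STFT \<psi> u x (\<tau> powr s *\<^sub>R \<xi>)) \<le> c0 * ((\<Sum>y\<in>Y. C1 y) + C2 * (D1 * D2) + C2 * D0)"
      if \<tau>: "0 < \<tau>" "dist \<xi> \<xi>0 < \<epsilon>" for x \<xi> \<tau>
    proof -
      define \<Xi> where "\<Xi> = \<tau> powr s *\<^sub>R \<xi>"
      define g where "g = (\<lambda>y. translate_fun x \<psi> y * expi \<Xi> y)"
      have g: "g \<in> GS_space t s"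
        unfolding g_def by (rule GS_space_mult[OF GS_space_translate[OF \<psi> t s0(1)] gevrey_bdd_expi[OF s0(1)] t s0(2)])
      have rle: "exp (r * \<tau>) \<le> exp (r' * norm \<Xi> powr (1 / s))"
      proof -
        have n: "norm \<xi>0 / 2 \<le> norm \<xi>"
          using \<tau>(2) \<epsilon>(2) norm_triangle_ineq2[of \<xi>0 \<xi>] by (simp add: dist_norm norm_minus_commute)
        have "norm \<Xi> powr (1 / s) = \<tau> * norm \<xi> powr (1 / s)"
          using \<tau> s0 by (simp add: \<Xi>_def powr_mult powr_powr)
        also have "\<dots> \<ge> \<tau> * (norm \<xi>0 / 2) powr (1 / s)"
          using \<tau> s0 n by (intro mult_left_mono powr_mono2) auto
        finally have "r' * (\<tau> * (norm \<xi>0 / 2) powr (1 / s)) \<le> r' * norm \<Xi> powr (1 / s)"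
          using r' by (intro mult_left_mono) auto
        moreover have "r' * (\<tau> * (norm \<xi>0 / 2) powr (1 / s)) = r * \<tau>" using \<xi>0 by (simp add: r'_def)
        ultimately show ?thesis by simp
      qed
      have L2: "exp (r * \<tau>) * cmod (L2_pairing f (\<lambda>y. a y * expi \<Xi> y)) \<le> C2 * D"
        if "smooth_fun a" "gevrey_le s h (\<lambda>_. D) a" for a D
      proof -
        have "exp (r * \<tau>) * cmod (L2_pairing f (\<lambda>y. a y * expi \<Xi> y)) \<le>
          exp (r' * norm \<Xi> powr (1 / s)) * cmod (L2_pairing f (\<lambda>y. a y * expi \<Xi> y))"
          by (rule mult_right_mono[OF rle]) simp
        then show ?thesis using C2(2)[OF that, of \<Xi>] by (simp add: mult.commute)
      qed
      have 1: "exp (r * \<tau>) * cmod (L2_pairing f g) \<le> C2 * D0"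
        unfolding g_def by (rule L2[OF gevrey_bdd_smooth[OF bT] trans[OF D0 h]])
      have "gevrey_le s h (\<lambda>_. D1 * D2) (\<lambda>y. \<kappa> y * translate_fun x \<psi> y)"
        using gevrey_le_mult[OF gevrey_bdd_smooth[OF b\<kappa>] gevrey_bdd_smooth[OF bT] D1 trans[OF D2 h2] s0(2) h2] by simp
      from L2[OF smooth_mult[OF gevrey_bdd_smooth[OF b\<kappa>] gevrey_bdd_smooth[OF bT]] this]
      have 2: "exp (r * \<tau>) * cmod (L2_pairing f (\<lambda>y. \<kappa> y * g y)) \<le> C2 * (D1 * D2)"
        by (simp add: g_def mult.assoc)
      define k where "k y z = c y z * translate_fun x \<psi> z * cnj (\<phi> y z) * expi \<Xi> z" for y z
      have kG: "k y \<in> GS_space t s" for y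
      proof -
        have "(\<lambda>z. cnj (\<phi> y z) * (c y z * translate_fun x \<psi> z * expi \<Xi> z)) \<in> Gevrey_c s"
          by (intro Gevrey_c_mult Gevrey_c_cnj \<phi>(1) gevrey_bdd_mult bc bT gevrey_bdd_expi s0)
        moreover have "(\<lambda>z. cnj (\<phi> y z) * (c y z * translate_fun x \<psi> z * expi \<Xi> z)) = k y"
          by (auto simp: k_def mult_ac)
        ultimately show ?thesis using Gevrey_c_subset_GS[OF _ s0(1) t] by metis
      qed
      have "(\<lambda>z. \<kappa> z * g z) = (\<lambda>z. \<Sum>y\<in>Y. 1 * k y z)"
        by (rule ext, subst split) (simp add: g_def k_def sum_distrib_left sum_distrib_right mult_ac)
      then have "u (\<lambda>z. \<kappa> z * g z) = (\<Sum>y\<in>Y. u (k y))"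
        using antilinear_on_sum(2)[OF al t s0(1) Y(1) kG, of "\<lambda>_. 1"] by simp
      then have "exp (r * \<tau>) * cmod (u (\<lambda>z. \<kappa> z * g z)) \<le> exp (r * \<tau>) * (\<Sum>y\<in>Y. cmod (u (k y)))"
        by (simp add: norm_sum)
      also have "\<dots> \<le> (\<Sum>y\<in>Y. C1 y)"
        unfolding sum_distrib_left k_def \<Xi>_def by (intro sum_mono C1 \<tau>)
      finally have 3: "exp (r * \<tau>) * cmod (u (\<lambda>z. \<kappa> z * g z)) \<le> (\<Sum>y\<in>Y. C1 y)" .
      have "cmod (u g) \<le> cmod (u (\<lambda>y. \<kappa> y * g y)) + cmod (L2_pairing f (\<lambda>y. \<kappa> y * g y)) + cmod (L2_pairing f g)"
        unfolding cut[OF g] by (rule order_trans[OF norm_triangle_ineq]) (simp add: norm_triangle_ineq4)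
      then have "exp (r * \<tau>) * cmod (u g) \<le>
        exp (r * \<tau>) * (cmod (u (\<lambda>y. \<kappa> y * g y)) + cmod (L2_pairing f (\<lambda>y. \<kappa> y * g y)) + cmod (L2_pairing f g))"
        by (intro mult_left_mono) auto
      also have "\<dots> \<le> (\<Sum>y\<in>Y. C1 y) + C2 * (D1 * D2) + C2 * D0"
        unfolding distrib_left by (intro add_mono 1 2 3)
      finally have "c0 * (exp (r * \<tau>) * cmod (u g)) \<le> c0 * ((\<Sum>y\<in>Y. C1 y) + C2 * (D1 * D2) + C2 * D0)"
        using c0 by (intro mult_left_mono) auto
      moreover have "cmod (STFT \<psi> u x \<Xi>) = c0 * cmod (u g)"
        using c0 by (simp add: STFT_eq_expi g_def norm_mult c0_def)
      ultimately show ?thesis by (simp add: \<Xi>_def mult_ac)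
    qed
    then show "\<exists>C. \<forall>x \<xi> \<tau>. 0 < \<tau> \<longrightarrow> dist \<xi> \<xi>0 < \<epsilon> \<longrightarrow>
        exp (r * \<tau>) * cmod (STFT \<psi> u x (\<tau> powr s *\<^sub>R \<xi>)) \<le> C" by blast
  qed
qed

lemma not_in_WF_GS_I:
  assumes "open U" "U \<subseteq> - {(0, 0)}" "z \<in> U"
    and "\<And>r. 0 < r \<Longrightarrow> \<exists>C. \<forall>\<tau> x \<xi>. 0 < \<tau> \<longrightarrow> (x, \<xi>) \<in> U \<longrightarrow>
      exp (r * \<tau>) * cmod (STFT \<psi> u (\<tau> powr t *\<^sub>R x) (\<tau> powr s *\<^sub>R \<xi>)) \<le> C"
  shows "z \<notin> WF_GS t s \<psi> u"
proof -
  have "\<forall>r>0. bdd_above {exp (r * \<tau>) * cmod (STFT \<psi> u (\<tau> powr t *\<^sub>R x) (\<tau> powr s *\<^sub>R \<xi>))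
                            | \<tau> x \<xi>. \<tau> > 0 \<and> (x, \<xi>) \<in> U}"
  proof (intro allI impI)
    fix r :: real assume "r > 0"
    then obtain C where C: "\<forall>\<tau> x \<xi>. 0 < \<tau> \<longrightarrow> (x, \<xi>) \<in> U \<longrightarrow>
      exp (r * \<tau>) * cmod (STFT \<psi> u (\<tau> powr t *\<^sub>R x) (\<tau> powr s *\<^sub>R \<xi>)) \<le> C" using assms(4) by blast
    show "bdd_above {exp (r * \<tau>) * cmod (STFT \<psi> u (\<tau> powr t *\<^sub>R x) (\<tau> powr s *\<^sub>R \<xi>)) | \<tau> x \<xi>. \<tau> > 0 \<and> (x, \<xi>) \<in> U}"
      by (rule bdd_aboveI[of _ C]) (use C in auto)
  qed
  with assms(1-3) show ?thesis unfolding WF_GS_def by blast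
qed

theorem proposition5p2:
  fixes s t :: real
    and u :: "(real ^ 'n::finite \<Rightarrow> complex) \<Rightarrow> complex"
    and \<psi> :: "real ^ 'n \<Rightarrow> complex"
  assumes "s > 1" and "t > 0"
    and "\<psi> \<in> GS_space t s" and "\<psi> \<noteq> (\<lambda>_. 0)"
    and "u \<in> compact_plus_GS t s"
  shows "WF_GS t s \<psi> u \<subseteq> {0} \<times> snd ` WF_Gevrey s u"
proof
  fix z assume z: "z \<in> WF_GS t s \<psi> u"
  obtain x0 \<xi>0 where z0: "z = (x0, \<xi>0)" by (cases z)
  have "x0 = 0"
  proof (rule ccontr)
    assume x0: "x0 \<noteq> 0"
    obtain q where q: "0 < q" "\<And>\<rho>. 0 < \<rho> \<Longrightarrow> \<exists>C>0. \<forall>x \<xi>. cmod (STFT \<psi> u x \<xi>) \<le>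
      C * (exp (- \<rho> * norm x powr (1 / t)) * exp (q * norm \<xi> powr (1 / s)))"
      using STFT_spatial_decay[OF assms(1,2,3,5)] by metis
    define a m where "a = norm x0 / 2" and "m = norm \<xi>0 + 1"
    have am: "a > 0" "m > 0" using x0 by (auto simp: a_def m_def add_nonneg_pos)
    have "z \<notin> WF_GS t s \<psi> u"
    proof (rule not_in_WF_GS_I[of "ball x0 a \<times> ball \<xi>0 1"])
      show "open (ball x0 a \<times> ball \<xi>0 1)" by (intro open_Times open_ball)
      show "ball x0 a \<times> ball \<xi>0 1 \<subseteq> - {(0, 0)}" using x0 by (auto simp: a_def dist_norm)
      show "z \<in> ball x0 a \<times> ball \<xi>0 1" using am by (simp add: z0)
      fix r :: real assume r: "r > 0"
      define \<rho> where "\<rho> = (r + q * m powr (1 / s)) / a powr (1 / t)"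
      have \<rho>: "\<rho> > 0" using r q am by (simp add: \<rho>_def add_pos_nonneg)
      obtain C where C: "C > 0" "\<And>x \<xi>. cmod (STFT \<psi> u x \<xi>) \<le>
        C * (exp (- \<rho> * norm x powr (1 / t)) * exp (q * norm \<xi> powr (1 / s)))"
        using q(2)[OF \<rho>] by blast
      have "exp (r * \<tau>) * cmod (STFT \<psi> u (\<tau> powr t *\<^sub>R x) (\<tau> powr s *\<^sub>R \<xi>)) \<le> C"
        if \<tau>: "\<tau> > 0" and x\<xi>: "(x, \<xi>) \<in> ball x0 a \<times> ball \<xi>0 1" for \<tau> x \<xi>
      proof -
        have nx: "a \<le> norm x" using x\<xi> norm_triangle_ineq2[of x0 x] by (simp add: a_def dist_norm)
        have n\<xi>: "norm \<xi> \<le> m" using x\<xi> norm_triangle_ineq2[of \<xi> \<xi>0] by (simp add: m_def dist_norm norm_minus_commute)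
        have 1: "\<tau> * a powr (1 / t) \<le> norm (\<tau> powr t *\<^sub>R x) powr (1 / t)"
        proof -
          have "norm (\<tau> powr t *\<^sub>R x) powr (1 / t) = \<tau> * norm x powr (1 / t)"
            using \<tau> assms(2) by (simp add: powr_mult powr_powr)
          moreover have "\<tau> * a powr (1 / t) \<le> \<tau> * norm x powr (1 / t)"
            using \<tau> am nx assms(2) by (intro mult_left_mono powr_mono2) auto
          ultimately show ?thesis by simp
        qed
        have 2: "norm (\<tau> powr s *\<^sub>R \<xi>) powr (1 / s) \<le> \<tau> * m powr (1 / s)"
        proof -
          have "norm (\<tau> powr s *\<^sub>R \<xi>) powr (1 / s) = \<tau> * norm \<xi> powr (1 / s)"
            using \<tau> assms(1) by (simp add: powr_mult powr_powr)
          moreover have "\<tau> * norm \<xi> powr (1 / s) \<le> \<tau> * m powr (1 / s)"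
            using \<tau> n\<xi> assms(1) by (intro mult_left_mono powr_mono2) auto
          ultimately show ?thesis by simp
        qed
        have "\<rho> * (\<tau> * a powr (1 / t)) = (r + q * m powr (1 / s)) * \<tau>" using am by (simp add: \<rho>_def)
        then have "(r + q * m powr (1 / s)) * \<tau> \<le> \<rho> * norm (\<tau> powr t *\<^sub>R x) powr (1 / t)"
          using mult_left_mono[OF 1 less_imp_le[OF \<rho>]] by linarith
        moreover have "q * norm (\<tau> powr s *\<^sub>R \<xi>) powr (1 / s) \<le> q * (\<tau> * m powr (1 / s))"
          using mult_left_mono[OF 2, of q] q(1) by simp
        ultimately have "r * \<tau> + (- \<rho> * norm (\<tau> powr t *\<^sub>R x) powr (1 / t) + q * norm (\<tau> powr s *\<^sub>R \<xi>) powr (1 / s)) \<le> 0"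
          by (simp add: algebra_simps)
        then have e: "exp (r * \<tau>) * (exp (- \<rho> * norm (\<tau> powr t *\<^sub>R x) powr (1 / t)) * exp (q * norm (\<tau> powr s *\<^sub>R \<xi>) powr (1 / s))) \<le> 1"
          by (simp only: exp_add[symmetric] exp_le_one_iff)
        have "exp (r * \<tau>) * cmod (STFT \<psi> u (\<tau> powr t *\<^sub>R x) (\<tau> powr s *\<^sub>R \<xi>)) \<le>
          exp (r * \<tau>) * (C * (exp (- \<rho> * norm (\<tau> powr t *\<^sub>R x) powr (1 / t)) * exp (q * norm (\<tau> powr s *\<^sub>R \<xi>) powr (1 / s))))"
          by (intro mult_left_mono C) auto
        also have "\<dots> = C * (exp (r * \<tau>) * (exp (- \<rho> * norm (\<tau> powr t *\<^sub>R x) powr (1 / t)) * exp (q * norm (\<tau> powr s *\<^sub>R \<xi>) powr (1 / s))))"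
          by (simp only: mult_ac)
        also have "\<dots> \<le> C * 1" using C(1) by (intro mult_left_mono e) auto
        finally show ?thesis by simp
      qed
      then show "\<exists>C. \<forall>\<tau> x \<xi>. 0 < \<tau> \<longrightarrow> (x, \<xi>) \<in> ball x0 a \<times> ball \<xi>0 1 \<longrightarrow>
        exp (r * \<tau>) * cmod (STFT \<psi> u (\<tau> powr t *\<^sub>R x) (\<tau> powr s *\<^sub>R \<xi>)) \<le> C" by blast
    qed
    with z show False by blast
  qed
  moreover have "\<exists>y. (y, \<xi>0) \<in> WF_Gevrey s u"
  proof (rule ccontr)
    assume "\<nexists>y. (y, \<xi>0) \<in> WF_Gevrey s u"
    then have wf: "\<And>y. (y, \<xi>0) \<notin> WF_Gevrey s u" by blast
    have \<xi>0: "\<xi>0 \<noteq> 0" using z \<open>x0 = 0\<close> by (auto simp: z0 WF_GS_def)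
    obtain \<epsilon> where \<epsilon>: "0 < \<epsilon>" "\<And>r. 0 < r \<Longrightarrow> \<exists>C. \<forall>x \<xi> \<tau>. 0 < \<tau> \<longrightarrow> dist \<xi> \<xi>0 < \<epsilon> \<longrightarrow>
      exp (r * \<tau>) * cmod (STFT \<psi> u x (\<tau> powr s *\<^sub>R \<xi>)) \<le> C"
      using STFT_frequency_decay[OF assms(1,2,3,5) \<xi>0 wf] by metis
    define \<delta> where "\<delta> = min \<epsilon> (norm \<xi>0)"
    have \<delta>: "\<delta> > 0" using \<epsilon>(1) \<xi>0 by (simp add: \<delta>_def)
    have "z \<notin> WF_GS t s \<psi> u"
    proof (rule not_in_WF_GS_I[of "UNIV \<times> ball \<xi>0 \<delta>"])
      show "open (UNIV \<times> ball \<xi>0 \<delta>)" by (intro open_Times open_UNIV open_ball)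
      show "UNIV \<times> ball \<xi>0 \<delta> \<subseteq> - {(0, 0)}" by (auto simp: \<delta>_def)
      show "z \<in> UNIV \<times> ball \<xi>0 \<delta>" using \<delta> by (simp add: z0)
      fix r :: real assume "r > 0"
      then obtain C where "\<forall>x \<xi> \<tau>. 0 < \<tau> \<longrightarrow> dist \<xi> \<xi>0 < \<epsilon> \<longrightarrow>
        exp (r * \<tau>) * cmod (STFT \<psi> u x (\<tau> powr s *\<^sub>R \<xi>)) \<le> C" using \<epsilon>(2) by blast
      then show "\<exists>C. \<forall>\<tau> x \<xi>. 0 < \<tau> \<longrightarrow> (x, \<xi>) \<in> UNIV \<times> ball \<xi>0 \<delta> \<longrightarrow>
        exp (r * \<tau>) * cmod (STFT \<psi> u (\<tau> powr t *\<^sub>R x) (\<tau> powr s *\<^sub>R \<xi>)) \<le> C"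
        by (auto simp: \<delta>_def dist_commute)
    qed
    with z show False by blast
  qed
  ultimately show "z \<in> {0} \<times> snd ` WF_Gevrey s u" by (force simp: z0)
qed

end
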